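(* Let $\mathbf{X}_{t-n+1},\dots,\mathbf{X}_t$ be conditionally independent given $(\boldsymbol\mu,\boldsymbol\Sigma)$ with $\mathbf{X}_i|\boldsymbol\mu,\boldsymbol\Sigma\sim\mathcal N_k(\boldsymbol\mu,\boldsymbol\Sigma)$ for $i=t-n+1,\dots,t$, with $n>k$, and let $\mathbf{w}_t=C_t\boldsymbol\Sigma^{-1}(\boldsymbol\mu-r_{f,t+1}\mathbf 1)$. (a) Under the diffuse prior, the Bayes estimate (posterior mean) of the optimal portfolio weights at time $t$ is $$\hat{\mathbf w}_{t,d}=\mathbb E(\mathbf w_t|\mathbf x_{t,n})=C_t(n-1)\mathbf S_{t,d}^{-1}(\overline{\mathbf x}_{t,d}-r_{f,t+1}\mathbf 1).$$ (b) Under the conjugate prior, the Bayes estimate (posterior mean) of the optimal portfolio weights at time $t$ is $$\hat{\mathbf w}_{t,c}=\mathbb E(\mathbf w_t|\mathbf x_{t,n})=C_t(n+d_0-k-1)\mathbf S_{t,c}^{-1}(\overline{\mathbf x}_{t,c}-r_{f,t+1}\mathbf 1).$$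
   Context: Setting. $\boldsymbol\mu\in\mathbb R^k$ and the positive definite $k\times k$ matrix $\boldsymbol\Sigma$ are unknown parameters endowed with a prior $\pi(\boldsymbol\mu,\boldsymbol\Sigma)$; the posterior given the observation matrix $\mathbf x_{t,n}=(\mathbf x_{t-n+1},\dots,\mathbf x_t)$ (realizations of $\mathbf X_{t-n+1},\dots,\mathbf X_t$) is $\pi(\boldsymbol\mu,\boldsymbol\Sigma|\mathbf x_{t,n})\propto L(\mathbf x_{t,n}|\boldsymbol\mu,\boldsymbol\Sigma)\pi(\boldsymbol\mu,\boldsymbol\Sigma)$, with $L$ the normal likelihood. $\mathbb E(\cdot|\mathbf x_{t,n})$ is expectation under this posterior. Weights. $\mathbf w_t$ ($t\in\{0,\dots,T-1\}$) is the multi-period optimal portfolio weight vector for exponential utility, with $C_t=(\gamma W_t\prod_{i=t+2}^T R_{f,i})^{-1}$, where $\gamma>0$ is the risk aversion, $W_t$ is the current wealth, $r_{f,i}$ is the risk-free return in period $i$, $R_{f,i}=1+r_{f,i}$, and $\prod_{i=T+1}^T R_{f,i}\equiv1$. $C_t$ and $r_{f,t+1}$ are treated as known constants; $\mathbf 1$ is the $k$-vector of ones. Priors. Diffuse (Jeffreys) prior: $\pi(\boldsymbol\mu,\boldsymbol\Sigma)\propto|\boldsymbol\Sigma|^{-(k+1)/2}$. Conjugate prior: $\boldsymbol\mu|\boldsymbol\Sigma\sim\mathcal N_k(\mathbf m_0,\frac1{r_0}\boldsymbol\Sigma)$, $\boldsymbol\Sigma\sim\mathcal{IW}_k(d_0,\mathbf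 S_0)$ with hyperparameters $\mathbf m_0\in\mathbb R^k$, $r_0>0$, $d_0$, and $\mathbf S_0$ positive definite. Here $\mathcal{IW}_k(d,\mathbf S)$ (with $d>2k$) is the inverse Wishart distribution with density proportional to $|\boldsymbol\Sigma|^{-d/2}\exp(-\frac12\mathrm{tr}(\mathbf S\boldsymbol\Sigma^{-1}))$; equivalently $\boldsymbol\Sigma^{-1}$ is Wishart with $d-k-1$ degrees of freedom and scale matrix $\mathbf S^{-1}$. Data quantities. $\overline{\mathbf x}_t=\frac1n\sum_{i=t-n+1}^t\mathbf x_i$, $\mathbf S_t=\frac1{n-1}\sum_{i=t-n+1}^t(\mathbf x_i-\overline{\mathbf x}_t)(\mathbf x_i-\overline{\mathbf x}_t)^\top$; $\overline{\mathbf x}_{t,d}=\overline{\mathbf x}_t$, $\mathbf S_{t,d}=(n-1)\mathbf S_t$ (positive definite almost surely since $n>k$); $\overline{\mathbf x}_{t,c}=\frac{n\overline{\mathbf x}_t+r_0\mathbf m_0}{n+r_0}$, $\mathbf S_{t,c}=\mathbf S_{t,d}+\mathbf S_0+\frac{nr_0}{n+r_0}(\mathbf m_0-\overline{\mathbf x}_t)(\mathbf m_0-\overline{\mathbf x}_t)^\top$. *)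

theory Defs
  imports "HOL-Probability.Probability"
begin

definition pos_def :: "real^'k^'k \<Rightarrow> bool" where
  "pos_def A \<longleftrightarrow> transpose A = A \<and> (\<forall>v. v \<noteq> 0 \<longrightarrow> 0 < v \<bullet> (A *v v))"

definition outer :: "real^'k \<Rightarrow> real^'k \<Rightarrow> real^'k^'k" where
  "outer u v = (\<chi> i j. u $ i * v $ j)"

definition mvnormal_density :: "real^'k \<Rightarrow> real^'k^'k \<Rightarrow> real^'k \<Rightarrow> real" where
  "mvnormal_density \<mu> \<Sigma> x =
     1 / sqrt ((2 * pi) ^ CARD('k) * det \<Sigma>)
     * exp (- (1/2) * ((x - \<mu>) \<bullet> (matrix_inv \<Sigma> *v (x - \<mu>))))"


(* The positive definite matrices are a null set for Lebesgue measure on all k x k matrices.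
   Densities of random covariance matrices refer to Lebesgue measure in the k(k+1)/2
   coordinates Sigma_ij, i <= j. These are indexed here by the sets {i,j}, which avoids
   choosing an order on the index type. *)
definition lborel_sym :: "(real^'k^'k) measure" where
  "lborel_sym =
     distr (Pi\<^sub>M {{i, j} | i j :: 'k. True} (\<lambda>_. lborel)) borel (\<lambda>a. \<chi> i j. a {i, j})"

definition lborel_pd :: "(real^'k^'k) measure" where
  "lborel_pd = restrict_space lborel_sym {\<Sigma>. pos_def \<Sigma>}"

definition param_measure :: "((real^'k) \<times> (real^'k^'k)) measure" where
  "param_measure = lborel \<Otimes>\<^sub>M lborel_pd"

(* Parametrised so that the inverse of the matrix is Wishart with d - k - 1 degrees of freedom. *)
definition inv_wishart_kernel :: "real \<Rightarrow> real^'k^'k \<Rightarrow> real^'k^'k \<Rightarrow> real" where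
  "inv_wishart_kernel d S \<Sigma> =
     det \<Sigma> powr (- d / 2) * exp (- (1/2) * trace (S ** matrix_inv \<Sigma>))"

definition inv_wishart_density :: "real \<Rightarrow> real^'k^'k \<Rightarrow> real^'k^'k \<Rightarrow> real" where
  "inv_wishart_density d S \<Sigma> =
     inv_wishart_kernel d S \<Sigma> / (\<integral>\<Sigma>'. inv_wishart_kernel d S \<Sigma>' \<partial>lborel_pd)"

definition diffuse_prior :: "real^'k \<Rightarrow> real^'k^'k \<Rightarrow> real" where
  "diffuse_prior \<mu> \<Sigma> = det \<Sigma> powr (- (real CARD('k) + 1) / 2)"

definition conjugate_prior ::
    "real^'k \<Rightarrow> real \<Rightarrow> real \<Rightarrow> real^'k^'k \<Rightarrow> real^'k \<Rightarrow> real^'k^'k \<Rightarrow> real" where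
  "conjugate_prior m0 r0 d0 S0 \<mu> \<Sigma> =
     mvnormal_density m0 ((1 / r0) *\<^sub>R \<Sigma>) \<mu> * inv_wishart_density d0 S0 \<Sigma>"


(* Times are integers, since the window may reach back before time 0. *)
definition obs_times :: "int \<Rightarrow> nat \<Rightarrow> int set" where
  "obs_times t n = {t - int n + 1..t}"

definition likelihood ::
    "int \<Rightarrow> nat \<Rightarrow> (int \<Rightarrow> real^'k) \<Rightarrow> real^'k \<Rightarrow> real^'k^'k \<Rightarrow> real" where
  "likelihood t n x \<mu> \<Sigma> = (\<Prod>i\<in>obs_times t n. mvnormal_density \<mu> \<Sigma> (x i))"

definition posterior ::
    "(real^'k \<Rightarrow> real^'k^'k \<Rightarrow> real) \<Rightarrow> int \<Rightarrow> nat \<Rightarrow> (int \<Rightarrow> real^'k)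
      \<Rightarrow> ((real^'k) \<times> (real^'k^'k)) measure" where
  "posterior prior t n x =
     density param_measure (\<lambda>(\<mu>, \<Sigma>).
       ennreal (likelihood t n x \<mu> \<Sigma> * prior \<mu> \<Sigma>)
       / (\<integral>\<^sup>+(\<mu>', \<Sigma>'). ennreal (likelihood t n x \<mu>' \<Sigma>' * prior \<mu>' \<Sigma>') \<partial>param_measure))"

definition posterior_mean ::
    "(real^'k \<Rightarrow> real^'k^'k \<Rightarrow> real) \<Rightarrow> int \<Rightarrow> nat \<Rightarrow> (int \<Rightarrow> real^'k)
      \<Rightarrow> (real^'k \<Rightarrow> real^'k^'k \<Rightarrow> real^'k) \<Rightarrow> real^'k" where
  "posterior_mean prior t n x f = (\<integral>(\<mu>, \<Sigma>). f \<mu> \<Sigma> \<partial>posterior prior t n x)"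

(* The Bochner integral is 0 by convention where it does not exist, so existence is a
   separate condition. *)
definition posterior_mean_exists ::
    "(real^'k \<Rightarrow> real^'k^'k \<Rightarrow> real) \<Rightarrow> int \<Rightarrow> nat \<Rightarrow> (int \<Rightarrow> real^'k)
      \<Rightarrow> (real^'k \<Rightarrow> real^'k^'k \<Rightarrow> real^'k) \<Rightarrow> bool" where
  "posterior_mean_exists prior t n x f \<longleftrightarrow>
     prob_space (posterior prior t n x) \<and>
     integrable (posterior prior t n x) (\<lambda>(\<mu>, \<Sigma>). f \<mu> \<Sigma>)"


definition sample_mean :: "int \<Rightarrow> nat \<Rightarrow> (int \<Rightarrow> real^'k) \<Rightarrow> real^'k" where
  "sample_mean t n x = (1 / real n) *\<^sub>R (\<Sum>i\<in>obs_times t n. x i)"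

definition sample_cov :: "int \<Rightarrow> nat \<Rightarrow> (int \<Rightarrow> real^'k) \<Rightarrow> real^'k^'k" where
  "sample_cov t n x = (1 / (real n - 1)) *\<^sub>R
     (\<Sum>i\<in>obs_times t n. outer (x i - sample_mean t n x) (x i - sample_mean t n x))"

definition mean_d :: "int \<Rightarrow> nat \<Rightarrow> (int \<Rightarrow> real^'k) \<Rightarrow> real^'k" where
  "mean_d t n x = sample_mean t n x"

definition S_d :: "int \<Rightarrow> nat \<Rightarrow> (int \<Rightarrow> real^'k) \<Rightarrow> real^'k^'k" where
  "S_d t n x = (real n - 1) *\<^sub>R sample_cov t n x"

definition mean_c :: "real^'k \<Rightarrow> real \<Rightarrow> int \<Rightarrow> nat \<Rightarrow> (int \<Rightarrow> real^'k) \<Rightarrow> real^'k" where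
  "mean_c m0 r0 t n x =
     (1 / (real n + r0)) *\<^sub>R (real n *\<^sub>R sample_mean t n x + r0 *\<^sub>R m0)"

definition S_c ::
    "real^'k \<Rightarrow> real \<Rightarrow> real^'k^'k \<Rightarrow> int \<Rightarrow> nat \<Rightarrow> (int \<Rightarrow> real^'k) \<Rightarrow> real^'k^'k" where
  "S_c m0 r0 S0 t n x =
     S_d t n x + S0
     + (real n * r0 / (real n + r0)) *\<^sub>R outer (m0 - sample_mean t n x) (m0 - sample_mean t n x)"


definition ones :: "real^'k" where
  "ones = (\<chi> i. 1)"

(* gamma: risk aversion; W: current wealth W_t; rf i: risk-free return in period i;
   T: end of the investment horizon. *)
definition C_coef :: "real \<Rightarrow> real \<Rightarrow> (int \<Rightarrow> real) \<Rightarrow> int \<Rightarrow> int \<Rightarrow> real" where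
  "C_coef \<gamma> W rf T t = inverse (\<gamma> * W * (\<Prod>i\<in>{t + 2..T}. 1 + rf i))"

definition opt_weights ::
    "real \<Rightarrow> real \<Rightarrow> (int \<Rightarrow> real) \<Rightarrow> int \<Rightarrow> int \<Rightarrow> real^'k \<Rightarrow> real^'k^'k \<Rightarrow> real^'k" where
  "opt_weights \<gamma> W rf T t \<mu> \<Sigma> =
     C_coef \<gamma> W rf T t *\<^sub>R (matrix_inv \<Sigma> *v (\<mu> - rf (t + 1) *\<^sub>R ones))"

end

theory Submission
  imports Defs
begin

text \<open>
Under both priors the posterior is a normal-inverse-Wishart distribution. Completing the square
turns likelihood times prior into a constant times
\<open>|\<Sigma>|^(-(d+1)/2) exp(-tr(S \<Sigma>^-1)/2) exp(-r (\<mu>-m)'\<Sigma>^-1(\<mu>-m)/2)\<close>, with \<open>r = n\<close>, \<open>d = n + k\<close> and the sample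
mean and scatter matrix for the diffuse prior (\<open>diffuse_posterior_kernel\<close>), and with
\<open>r = n + r0\<close>, \<open>d = n + d0\<close> and the pooled mean and scatter matrix for the conjugate prior
(\<open>conjugate_posterior_kernel\<close>). For fixed \<open>\<Sigma>\<close> the mean vector is normal around \<open>m\<close>, so integrating it out
replaces \<open>\<mu>\<close> by \<open>m\<close> in the weights and leaves the inverse Wishart kernel with parameters \<open>d\<close> and \<open>S\<close>
(\<open>niw_posterior\<close>). What remains are two facts about that kernel, for every real \<open>d > 2k\<close>: its
integral is finite, and the mean of \<open>\<Sigma>^-1\<close> is \<open>(d-k-1) S^-1\<close> (\<open>inv_wishart_precision_mean\<close>).

The only change of variables behind them is the congruence \<open>\<Sigma> \<mapsto> A \<Sigma> A'\<close> with Jacobian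
\<open>|det A|^(k+1)\<close> (\<open>lborel_sym_congruence\<close>). A linear automorphism scales Lebesgue measure by a
factor, because translation-invariant measures are unique up to a factor
(\<open>translation_invariant_unique\<close>); the factor is multiplicative in the automorphism, and a
multiplicative function on the invertible matrices is determined by its values on diagonal ones
(\<open>linear_action_jacobian\<close>).

Finiteness rests on a duality between the invariant measures on the invertible and on the positive
definite matrices (\<open>haar_duality\<close>). It turns the inverse Wishart integral, up to a positive finite
factor, into the moment of order \<open>d-2k-1\<close> of \<open>|det g|\<close> for a Gaussian matrix \<open>g\<close>, and such moments
are finite for orders above \<open>-1\<close> (\<open>det_gauss_moment_finite\<close>): the determinant is affine in each
entry, so averaging over the diagonal entries one after the other leads through smaller and smaller
principal minors down to the constant 1.

The mean comes from the dependence of the integral on \<open>S\<close>. Stretching one coordinate by \<open>sqrt s\<close>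
changes the scale matrix from 1 to \<open>diag(1,..,s,..,1)\<close> and multiplies the integral by
\<open>s^(-(d-k-1)/2)\<close>; minus twice the logarithmic derivative at \<open>s = 1\<close> is the diagonal entry
\<open>d-k-1\<close> of the mean of \<open>\<Sigma>^-1\<close> (\<open>inv_wishart_diag_moment\<close>). Off-diagonal entries vanish by a sign flip,
    and a congruence leads from
the scale matrix 1 to a general one.

The scatter matrix of more than \<open>k\<close> independent normal observations is almost surely positive
definite because \<open>k\<close> differences of observations are almost surely linearly independent: each new
difference has to avoid a hyperplane (\<open>AE_diff_det_nonzero\<close>).
\<close>


section \<open>Lebesgue measure in the coordinates of an orthogonal family\<close>

text \<open>For an orthogonal family of nonzero vectors this is, up to a constant factor, Lebesgue measure on
its span. It covers \<open>lborel\<close>, where the family is an orthonormal basis, as well as \<open>lborel_sym\<close>,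
which lives on the proper subspace of symmetric matrices.\<close>

definition coord_measure :: "'i set \<Rightarrow> ('i \<Rightarrow> 'v::euclidean_space) \<Rightarrow> 'v measure" where
  "coord_measure I b = distr (\<Pi>\<^sub>M p\<in>I. lborel) borel (\<lambda>a. \<Sum>p\<in>I. a p *\<^sub>R b p)"

lemma product_sigma_finite_lborel: "product_sigma_finite (\<lambda>_. lborel :: real measure)"
  by (simp add: product_sigma_finite_def sigma_finite_lborel)

lemma sets_coord_measure [simp, measurable_cong]: "sets (coord_measure I b) = sets borel"
  and space_coord_measure [simp]: "space (coord_measure I b) = UNIV"
  by (simp_all add: coord_measure_def)

lemma measurable_coord_sum [measurable]:
  "(\<lambda>a. \<Sum>p\<in>I. a p *\<^sub>R (b p :: 'v::euclidean_space)) \<in> borel_measurable (\<Pi>\<^sub>M p\<in>I. lborel)"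
  by (intro borel_measurable_sum borel_measurable_scaleR) auto

lemma nn_integral_coord_measure:
  "f \<in> borel_measurable borel \<Longrightarrow>
    (\<integral>\<^sup>+x. f x \<partial>coord_measure I b) = (\<integral>\<^sup>+a. f (\<Sum>p\<in>I. a p *\<^sub>R b p) \<partial>(\<Pi>\<^sub>M p\<in>I. lborel))"
  unfolding coord_measure_def by (subst nn_integral_distr) auto

lemma PiM_lborel_affine:
  fixes s t :: "'i \<Rightarrow> real"
  assumes I: "finite I" and s: "\<And>p. p \<in> I \<Longrightarrow> s p \<noteq> 0"
  shows "density (distr (\<Pi>\<^sub>M p\<in>I. lborel) (\<Pi>\<^sub>M p\<in>I. lborel) (\<lambda>a. \<lambda>p\<in>I. t p + s p * a p))
           (\<lambda>_. ennreal (\<Prod>p\<in>I. \<bar>s p\<bar>)) = (\<Pi>\<^sub>M p\<in>I. lborel)" (is "density ?D _ = ?P")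
proof -
  interpret product_sigma_finite "\<lambda>_::'i. lborel :: real measure"
    by (rule product_sigma_finite_lborel)
  have meas: "(\<lambda>a. \<lambda>p\<in>I. t p + s p * a p) \<in> measurable ?P ?P"
    by (intro measurable_restrict) auto
  show ?thesis
  proof (rule PiM_eqI[OF I])
    show "sets (density ?D (\<lambda>_. ennreal (\<Prod>p\<in>I. \<bar>s p\<bar>))) = sets ?P" by simp
    fix A :: "'i \<Rightarrow> real set" assume A: "\<And>i. i \<in> I \<Longrightarrow> A i \<in> sets lborel"
    have AP: "Pi\<^sub>E I A \<in> sets ?P" using A I by (intro sets_PiM_I_finite) auto
    define A' where "A' p = (\<lambda>x. t p + s p * x) -` A p" for p
    have A': "A' p \<in> sets borel" if "p \<in> I" for p
    proof -
      have "(\<lambda>x. t p + s p * x) -` A p \<inter> space borel \<in> sets borel"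
        using A[OF that] by (intro measurable_sets[of _ borel borel]) auto
      then show ?thesis by (simp add: A'_def)
    qed
    have scale: "ennreal \<bar>s p\<bar> * emeasure lborel (A' p) = emeasure lborel (A p)" if "p \<in> I" for p
    proof -
      have "emeasure lborel (A p) = emeasure (density (distr lborel borel (\<lambda>x. t p
          + s p * x)) (\<lambda>_. ennreal \<bar>s p\<bar>)) (A p)"
        by (subst lborel_real_affine[OF s[OF that], of "t p"]) simp
      also have "\<dots> = ennreal \<bar>s p\<bar> * emeasure lborel (A' p)"
        using A[OF that] by (subst emeasure_density_const) (auto simp: emeasure_distr A'_def)
      finally show ?thesis by simp
    qed
    have "emeasure (density ?D (\<lambda>_. ennreal (\<Prod>p\<in>I. \<bar>s p\<bar>))) (Pi\<^sub>E I A)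
        = ennreal (\<Prod>p\<in>I. \<bar>s p\<bar>) * emeasure ?P ((\<lambda>a. \<lambda>p\<in>I. t p + s p * a p) -` Pi\<^sub>E I A \<inter> space ?P)"
      using AP meas by (simp add: emeasure_density_const emeasure_distr)
    also have "(\<lambda>a. \<lambda>p\<in>I. t p + s p * a p) -` Pi\<^sub>E I A \<inter> space ?P = Pi\<^sub>E I A'"
      by (auto simp: space_PiM A'_def PiE_def Pi_def extensional_def)
    also have "emeasure ?P (Pi\<^sub>E I A') = (\<Prod>p\<in>I. emeasure lborel (A' p))"
      using A' I by (intro emeasure_PiM) auto
    also have "ennreal (\<Prod>p\<in>I. \<bar>s p\<bar>) * (\<Prod>p\<in>I. emeasure lborel (A' p)) = (\<Prod>p\<in>I. emeasure lborel (A p))"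
      by (simp add: prod_ennreal[symmetric] prod.distrib[symmetric] scale)
    finally show "emeasure (density ?D (\<lambda>_. ennreal (\<Prod>p\<in>I. \<bar>s p\<bar>))) (Pi\<^sub>E I A)
        = (\<Prod>p\<in>I. emeasure lborel (A p))" .
  qed
qed

lemma nn_integral_coord_measure_affine:
  assumes I: "finite I" and s: "\<And>p. p \<in> I \<Longrightarrow> s p \<noteq> 0" and [measurable]: "f \<in> borel_measurable borel"
  shows "(\<integral>\<^sup>+x. f x \<partial>coord_measure I b)
    = ennreal (\<Prod>p\<in>I. \<bar>s p\<bar>) * (\<integral>\<^sup>+a. f (\<Sum>p\<in>I. (t p + s p * a p) *\<^sub>R b p) \<partial>(\<Pi>\<^sub>M p\<in>I. lborel))"
proof -
  let ?P = "\<Pi>\<^sub>M p\<in>I. (lborel :: real measure)"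
  have meas: "(\<lambda>a. \<lambda>p\<in>I. t p + s p * a p) \<in> measurable ?P ?P"
    by (intro measurable_restrict) auto
  have "(\<integral>\<^sup>+x. f x \<partial>coord_measure I b) = (\<integral>\<^sup>+a. f (\<Sum>p\<in>I. a p *\<^sub>R b p)
      \<partial>density (distr ?P ?P (\<lambda>a. \<lambda>p\<in>I. t p + s p * a p)) (\<lambda>_. ennreal (\<Prod>p\<in>I. \<bar>s p\<bar>)))"
    by (subst PiM_lborel_affine[OF I s]) (simp_all add: nn_integral_coord_measure)
  also have "\<dots> = ennreal (\<Prod>p\<in>I. \<bar>s p\<bar>) * (\<integral>\<^sup>+a. f (\<Sum>p\<in>I. a p
      *\<^sub>R b p) \<partial>(distr ?P ?P (\<lambda>a. \<lambda>p\<in>I. t p + s p * a p)))"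
    by (subst nn_integral_density) (auto simp: nn_integral_cmult)
  also have "(\<integral>\<^sup>+a. f (\<Sum>p\<in>I. a p *\<^sub>R b p) \<partial>(distr ?P ?P (\<lambda>a. \<lambda>p\<in>I. t p + s p * a p)))
     = (\<integral>\<^sup>+a. f (\<Sum>p\<in>I. (t p + s p * a p) *\<^sub>R b p) \<partial>?P)"
    using meas by (subst nn_integral_distr) (auto intro!: nn_integral_cong arg_cong[where f=f] sum.cong)
  finally show ?thesis .
qed

lemma span_image_coords:
  assumes "finite I" "x \<in> span (b ` I)"
  obtains t where "x = (\<Sum>p\<in>I. t p *\<^sub>R (b p :: 'v::euclidean_space))"
proof -
  have "\<exists>t. x = (\<Sum>p\<in>I. t p *\<^sub>R b p)" using assms(2)
  proof (induction rule: span_induct_alt)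
    case base show ?case by (intro exI[of _ "\<lambda>_. 0"]) simp
  next
    case (step c x y)
    then obtain p t where "p \<in> I" "x = b p" "y = (\<Sum>p\<in>I. t p *\<^sub>R b p)" by auto
    then have "c *\<^sub>R x + y = (\<Sum>q\<in>I. (t q + (if q = p then c else 0)) *\<^sub>R b q)"
      using assms(1) by (simp add: algebra_simps sum.distrib if_distrib[of "\<lambda>c. c
          *\<^sub>R _"] sum.delta cong: if_cong)
    then show ?case by (intro exI[of _ "\<lambda>q. t q + (if q = p then c else 0)"])
  qed
  then show ?thesis using that by blast
qed

lemma coord_measure_translation:
  assumes I: "finite I" and y: "y \<in> span (b ` I)" and [measurable]: "f \<in> borel_measurable borel"
  shows "(\<integral>\<^sup>+x. f (x + y) \<partial>coord_measure I b) = (\<integral>\<^sup>+x. f x \<partial>coord_measure I b)"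
proof -
  obtain t where t: "y = (\<Sum>p\<in>I. t p *\<^sub>R b p)" using span_image_coords[OF I y] .
  show ?thesis
    using nn_integral_coord_measure_affine[OF I, of "\<lambda>_. 1" f b t]
    by (simp add: nn_integral_coord_measure t algebra_simps sum.distrib)
qed

lemma AE_coord_measure_span: 
  "AE x in coord_measure I b. x \<in> span (b ` I)"
proof -
  have "closed (span (b ` I))" by (simp add: closed_subspace)
  then have "{x \<in> space borel. x \<in> span (b ` I)} \<in> sets borel" by simp
  then show ?thesis
    unfolding coord_measure_def by (subst AE_distr_iff) (auto intro!: AE_I2 span_sum intro: span_scale
        span_base)
qed

lemma nn_integral_gauss_real_finite:
  fixes c :: real assumes c: "0 < c"
  shows "(\<integral>\<^sup>+(x::real). ennreal (exp (- c * x\<^sup>2)) \<partial>lborel) < \<infinity>"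
proof -
  define s where "s = sqrt (1 / (2 * c))"
  have s: "s > 0" "s\<^sup>2 = 1 / (2 * c)" using c by (auto simp: s_def)
  have "exp (- c * x\<^sup>2) = sqrt (2 * pi * s\<^sup>2) * normal_density 0 s x" for x
    using c s by (simp add: normal_density_def)
  then have "integrable lborel (\<lambda>x. exp (- c * x\<^sup>2))"
    using s(1) by (simp only:) (intro integrable_mult_right integrable_normal_density)
  then show ?thesis by (subst nn_integral_eq_integral) auto
qed

abbreviation gauss :: "real \<Rightarrow> 'v::real_normed_vector \<Rightarrow> ennreal" where
  "gauss c x \<equiv> ennreal (exp (- c * (norm x)\<^sup>2))"

text \<open>By orthogonality the squared norm is a sum over the coordinates, so the integral is a product of
one-dimensional Gaussian integrals. A Gaussian is the reference function in what follows: it is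
integrable at every scale, positive everywhere and even.\<close>

lemma coord_measure_gauss_finite:
  fixes c :: real and b :: "'i \<Rightarrow> 'v::euclidean_space"
  assumes c: "0 < c" and I: "finite I" and b0: "\<And>p. p \<in> I \<Longrightarrow> b p \<noteq> 0"
    and orth: "pairwise (\<lambda>p q. orthogonal (b p) (b q)) I"
  shows "(\<integral>\<^sup>+x. gauss c x \<partial>coord_measure I b) < \<infinity>"
    and "0 < (\<integral>\<^sup>+x. gauss c x \<partial>coord_measure I b)"
proof -
  interpret product_sigma_finite "\<lambda>_::'i. lborel :: real measure"
    by (rule product_sigma_finite_lborel)
  have norm: "(norm (\<Sum>p\<in>I. a p *\<^sub>R b p))\<^sup>2 = (\<Sum>p\<in>I. (a p)\<^sup>2 * (norm (b p))\<^sup>2)" for a :: "'i \<Rightarrow> real"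
    using orth I by (subst norm_sum_Pythagorean) (auto simp: pairwise_def orthogonal_def power_mult_distrib)
  have eq: "(\<integral>\<^sup>+x. gauss c x \<partial>coord_measure I b)
    = (\<integral>\<^sup>+a. (\<Prod>p\<in>I. ennreal (exp (- (c * (norm (b p))\<^sup>2) * (a p)\<^sup>2))) \<partial>(\<Pi>\<^sub>M p\<in>I. lborel))"
    by (subst nn_integral_coord_measure, measurable)
      (simp add: norm prod_ennreal exp_sum[OF I, symmetric] sum_distrib_left sum_negf algebra_simps)
  also have "\<dots> = (\<Prod>p\<in>I. \<integral>\<^sup>+x. ennreal (exp (- (c * (norm (b p))\<^sup>2) * x\<^sup>2)) \<partial>lborel)"
    by (rule product_nn_integral_prod[OF I]) auto
  finally have eq: "(\<integral>\<^sup>+x. gauss c x \<partial>coord_measure I b)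
     = (\<Prod>p\<in>I. \<integral>\<^sup>+x. ennreal (exp (- (c * (norm (b p))\<^sup>2) * x\<^sup>2)) \<partial>lborel)" .
  show "(\<integral>\<^sup>+x. gauss c x \<partial>coord_measure I b) < \<infinity>"
    unfolding eq less_top[symmetric] infinity_ennreal_def
    using nn_integral_gauss_real_finite c b0
    by (auto simp: ennreal_prod_eq_top less_top[symmetric])
  have "(\<integral>\<^sup>+x. ennreal (exp (- c * x\<^sup>2)) \<partial>lborel) \<noteq> 0" for c :: real
    by (subst nn_integral_0_iff_AE) (auto simp: ennreal_eq_0_iff not_le trivial_limit_def[symmetric]
        ae_filter_eq_bot_iff)
  then show "0 < (\<integral>\<^sup>+x. gauss c x \<partial>coord_measure I b)"
    unfolding eq using I by (simp add: zero_less_iff_neq_zero)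
qed

lemma sigma_finite_if_gauss_finite:
  fixes M :: "'v::euclidean_space measure"
  assumes [measurable_cong]: "sets M = sets borel" and c: "0 < c"
    and fin: "(\<integral>\<^sup>+x. gauss c x \<partial>M) < \<infinity>"
  shows "sigma_finite_measure M"
proof
  have sp: "space M = UNIV" using sets_eq_imp_space_eq[OF assms(1)] by simp
  have ball: "emeasure M (cball 0 (real n)) \<noteq> \<infinity>" for n
  proof -
    have "emeasure M (cball 0 (real n)) = (\<integral>\<^sup>+x. indicator (cball 0 (real n)) x \<partial>M)"
      using assms(1) by (intro nn_integral_indicator[symmetric]) simp
    also have "\<dots> \<le> (\<integral>\<^sup>+x. ennreal (exp (c * (real n)\<^sup>2)) * gauss c x \<partial>M)"
    proof (intro nn_integral_mono)
      fix x :: 'v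
      show "indicator (cball 0 (real n)) x \<le> ennreal (exp (c * (real n)\<^sup>2)) * gauss c x"
        using c by (auto simp: indicator_def ennreal_mult[symmetric] exp_add[symmetric] power_mono
            mult_left_mono)
    qed
    also have "\<dots> = ennreal (exp (c * (real n)\<^sup>2)) * (\<integral>\<^sup>+x. gauss c x \<partial>M)"
      by (intro nn_integral_cmult) auto
    also have "\<dots> < \<infinity>" using fin by (simp add: ennreal_mult_less_top)
    finally show ?thesis by simp
  qed
  show "\<exists>A. countable A \<and> A \<subseteq> sets M \<and> \<Union>A = space M \<and> (\<forall>a\<in>A. emeasure M a \<noteq> \<infinity>)"
    using ball assms(1) sp
    by (intro exI[of _ "range (\<lambda>n::nat. cball 0 (real n))"]) (auto simp: real_arch_simple)
qed

text \<open>Both sides equal the double integral of \<open>f x * g (y + x)\<close> over \<open>y\<close> in \<open>M\<close> and \<open>x\<close> in \<open>N\<close>. A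
translation of \<open>y\<close> gives \<open>f x * g y\<close>. A translation of \<open>x\<close> gives \<open>f (x - y) * g x\<close>, which is
\<open>f (y - x) * g x\<close> as \<open>f\<close> is even, and then a translation of \<open>y\<close> gives \<open>f y
    * g x\<close>. The set \<open>S\<close> admits measures that live on a proper subspace and are
invariant only under its translations.\<close>

lemma translation_invariant_unique:
  fixes M N :: "'v::euclidean_space measure"
  assumes sf: "sigma_finite_measure M" "sigma_finite_measure N"
    and [measurable_cong]: "sets M = sets borel" "sets N = sets borel"
    and AE: "AE x in M. x \<in> S" "AE x in N. x \<in> S"
    and trM: "\<And>y f. y \<in> S \<Longrightarrow> f \<in> borel_measurable borel \<Longrightarrow> (\<integral>\<^sup>+x. f (x + y) \<partial>M) = (\<integral>\<^sup>+x. f x \<partial>M)"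
    and trN: "\<And>y f. y \<in> S \<Longrightarrow> f \<in> borel_measurable borel \<Longrightarrow> (\<integral>\<^sup>+x. f (x + y) \<partial>N) = (\<integral>\<^sup>+x. f x \<partial>N)"
    and [measurable]: "f \<in> borel_measurable borel" "g \<in> borel_measurable borel"
    and even: "\<And>x. f (- x) = f x" and neg: "\<And>x. x \<in> S \<Longrightarrow> - x \<in> S"
  shows "(\<integral>\<^sup>+x. f x \<partial>N) * (\<integral>\<^sup>+x. g x \<partial>M) = (\<integral>\<^sup>+x. f x \<partial>M) * (\<integral>\<^sup>+x. g x \<partial>N)"
proof -
  interpret M: sigma_finite_measure M by fact
  interpret N: sigma_finite_measure N by fact
  interpret pair_sigma_finite M N ..
  have "(\<integral>\<^sup>+x. f x \<partial>N) * (\<integral>\<^sup>+x. g x \<partial>M) = (\<integral>\<^sup>+x. (\<integral>\<^sup>+y. f x * g y \<partial>M) \<partial>N)"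
    by (simp add: nn_integral_cmult nn_integral_multc)
  also have "\<dots> = (\<integral>\<^sup>+x. (\<integral>\<^sup>+y. f x * g (y + x) \<partial>M) \<partial>N)"
    using AE(2) by (intro nn_integral_cong_AE) (auto simp: nn_integral_cmult trM elim!: eventually_mono)
  also have "\<dots> = (\<integral>\<^sup>+y. (\<integral>\<^sup>+x. f x * g (y + x) \<partial>N) \<partial>M)"
    by (rule Fubini') measurable
  also have "\<dots> = (\<integral>\<^sup>+y. (\<integral>\<^sup>+x. f (x - y) * g x \<partial>N) \<partial>M)"
    using AE(1)
  proof (intro nn_integral_cong_AE, eventually_elim)
    fix y assume "y \<in> S"
    then show "(\<integral>\<^sup>+x. f x * g (y + x) \<partial>N) = (\<integral>\<^sup>+x. f (x - y) * g x \<partial>N)"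
      using trN[of "- y" "\<lambda>x. f x * g (y + x)"] neg by simp
  qed
  also have "\<dots> = (\<integral>\<^sup>+x. (\<integral>\<^sup>+y. f (x - y) * g x \<partial>M) \<partial>N)"
    by (rule Fubini'[symmetric]) measurable
  also have "\<dots> = (\<integral>\<^sup>+x. (\<integral>\<^sup>+y. f y \<partial>M) * g x \<partial>N)"
    using AE(2)
  proof (intro nn_integral_cong_AE, eventually_elim)
    fix x assume "x \<in> S"
    have "(\<integral>\<^sup>+y. f (x - y) * g x \<partial>M) = (\<integral>\<^sup>+y. f (x - y) \<partial>M) * g x"
      by (rule nn_integral_multc) measurable
    also have "(\<integral>\<^sup>+y. f (x - y) \<partial>M) = (\<integral>\<^sup>+y. f (y + - x) \<partial>M)"
      using even by (metis (no_types, opaque_lifting) minus_diff_eq diff_conv_add_uminus)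
    also have "\<dots> = (\<integral>\<^sup>+y. f y \<partial>M)" using neg[OF \<open>x \<in> S\<close>] by (intro trM) auto
    finally show "(\<integral>\<^sup>+y. f (x - y) * g x \<partial>M) = (\<integral>\<^sup>+y. f y \<partial>M) * g x" .
  qed
  also have "\<dots> = (\<integral>\<^sup>+x. f x \<partial>M) * (\<integral>\<^sup>+x. g x \<partial>N)"
    by (simp add: nn_integral_cmult)
  finally show ?thesis .
qed

section \<open>Jacobians of linear actions of the general linear group\<close>

text \<open>The image measure under \<open>L\<close> is again invariant under translations in the span, hence a multiple of
the measure itself, and a Gaussian as test function identifies the factor. The inverse of \<open>L\<close> on the
span makes this factor finite, as a Gaussian of \<open>L x\<close> lies below a wider Gaussian of \<open>x\<close>, and
nonzero.\<close>

lemma linear_image_scales_coord_measure: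
  fixes b :: "'i \<Rightarrow> 'v::euclidean_space"
  assumes I: "finite I" and b0: "\<And>p. p \<in> I \<Longrightarrow> b p \<noteq> 0"
    and orth: "pairwise (\<lambda>p q. orthogonal (b p) (b q)) I"
    and L: "linear L" "\<And>x. x \<in> span (b ` I) \<Longrightarrow> L x \<in> span (b ` I)"
    and L': "linear L'" "\<And>x. x \<in> span (b ` I) \<Longrightarrow> L' x \<in> span (b ` I)"
    and inv: "\<And>x. x \<in> span (b ` I) \<Longrightarrow> L (L' x) = x" "\<And>x. x \<in> span (b ` I) \<Longrightarrow> L' (L x) = x"
  obtains c :: real where "0 < c"
    "\<And>f. f \<in> borel_measurable borel \<Longrightarrow>
      (\<integral>\<^sup>+x. f (L x) \<partial>coord_measure I b) = ennreal c * (\<integral>\<^sup>+x. f x \<partial>coord_measure I b)"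
proof -
  define M where "M = coord_measure I b"
  define S where "S = span (b ` I)"
  define G :: "real \<Rightarrow> 'v \<Rightarrow> ennreal" where "G c x = gauss c x" for c x
  have [measurable]: "L \<in> borel_measurable borel" "L' \<in> borel_measurable borel" "G c \<in> borel_measurable
      borel" for c
    using L(1) L'(1) by (auto intro!: borel_measurable_continuous_onI linear_continuous_on
        linear_conv_bounded_linear[THEN iffD1] simp: G_def[abs_def])
  have setsM [simp, measurable_cong]: "sets M = sets borel" by (simp add: M_def)
  have AES: "AE x in M. x \<in> S" unfolding M_def S_def by (rule AE_coord_measure_span)
  have Gfin: "(\<integral>\<^sup>+x. G c x \<partial>M) < \<infinity>" "0 < (\<integral>\<^sup>+x. G c x \<partial>M)" if "0 < c" for c
    unfolding G_def M_def by (rule coord_measure_gauss_finite[OF that I b0 orth]; simp)+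
  define N where "N = distr M borel L"
  have [simp, measurable_cong]: "sets N = sets borel" by (simp add: N_def)
  have nnN: "(\<integral>\<^sup>+x. f x \<partial>N) = (\<integral>\<^sup>+x. f (L x) \<partial>M)" if "f \<in> borel_measurable borel" for f
    using that by (simp add: N_def nn_integral_distr)
  obtain K where K: "K > 0" "\<And>x. norm (L' x) \<le> norm x * K"
    using L'(1) bounded_linear.pos_bounded linear_conv_bounded_linear by blast
  have "(\<integral>\<^sup>+x. G 1 x \<partial>N) = (\<integral>\<^sup>+x. G 1 (L x) \<partial>M)" by (rule nnN) measurable
  also have "\<dots> \<le> (\<integral>\<^sup>+x. G (1 / K\<^sup>2) x \<partial>M)"
    using AES
  proof (intro nn_integral_mono_AE, eventually_elim)
    fix x assume "x \<in> S"
    then have "norm x \<le> norm (L x) * K" using K(2)[of "L x"] inv S_def by simp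
    then have "(norm x)\<^sup>2 \<le> (norm (L x))\<^sup>2 * K\<^sup>2"
      by (metis norm_ge_zero power_mono power_mult_distrib)
    then show "G 1 (L x) \<le> G (1 / K\<^sup>2) x"
      using K(1) by (auto simp: G_def divide_simps)
  qed
  also have "\<dots> < \<infinity>" using K(1) by (intro Gfin) auto
  finally have N1: "(\<integral>\<^sup>+x. G 1 x \<partial>N) < \<infinity>" .
  have sfM: "sigma_finite_measure M"
    using Gfin(1)[of 1] by (intro sigma_finite_if_gauss_finite[of M 1]) (auto simp: G_def)
  have sfN: "sigma_finite_measure N"
    using N1 by (intro sigma_finite_if_gauss_finite[of N 1]) (auto simp: G_def)
  have trM: "(\<integral>\<^sup>+x. f (x + y) \<partial>M) = (\<integral>\<^sup>+x. f x \<partial>M)" if "y \<in> S" "f \<in> borel_measurable borel" for y f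
    using coord_measure_translation[OF I] that by (auto simp: M_def S_def)
  have trN: "(\<integral>\<^sup>+x. f (x + y) \<partial>N) = (\<integral>\<^sup>+x. f x \<partial>N)" if y: "y \<in> S"
      and [measurable]: "f \<in> borel_measurable borel" for y f
  proof -
    have "(\<integral>\<^sup>+x. f (x + y) \<partial>N) = (\<integral>\<^sup>+x. f (L (x + L' y)) \<partial>M)"
      using y by (simp add: nnN linear_add[OF L(1)] inv S_def)
    also have "\<dots> = (\<integral>\<^sup>+x. f (L x) \<partial>M)"
      using y L'(2) by (intro trM) (auto simp: S_def)
    finally show ?thesis by (simp add: nnN)
  qed
  have "closed S" by (simp add: closed_subspace S_def)
  then have [measurable]: "S \<in> sets borel" by simp
  have AEN: "AE x in N. x \<in> S"
    unfolding N_def using AES L(2) by (subst AE_distr_iff) (auto simp: S_def elim!: eventually_mono)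
  have uniq: "(\<integral>\<^sup>+x. G 1 x \<partial>N) * (\<integral>\<^sup>+x. f x \<partial>M) = (\<integral>\<^sup>+x. G 1 x \<partial>M) * (\<integral>\<^sup>+x. f x \<partial>N)"
    if [measurable]: "f \<in> borel_measurable borel" for f
    by (rule translation_invariant_unique[OF sfM sfN _ _ AES AEN trM trN])
      (auto simp: G_def S_def span_neg)
  obtain m where m: "(\<integral>\<^sup>+x. G 1 x \<partial>M) = ennreal m" "m > 0"
    using Gfin[of 1] by (cases "\<integral>\<^sup>+x. G 1 x \<partial>M") auto
  obtain n where n: "(\<integral>\<^sup>+x. G 1 x \<partial>N) = ennreal n" "n \<ge> 0"
    using N1 by (cases "\<integral>\<^sup>+x. G 1 x \<partial>N") auto
  have eq: "(\<integral>\<^sup>+x. f (L x) \<partial>M) = ennreal (n / m) * (\<integral>\<^sup>+x. f x \<partial>M)" if f: "f \<in> borel_measurable borel" for f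
  proof -
    have "ennreal (n / m) * (\<integral>\<^sup>+x. f x \<partial>M) = ennreal (1 / m) * (ennreal n * (\<integral>\<^sup>+x. f x \<partial>M))"
      using m n by (simp add: mult.assoc[symmetric] ennreal_mult[symmetric])
    also have "\<dots> = ennreal (1 / m) * (ennreal m * (\<integral>\<^sup>+x. f x \<partial>N))"
      using uniq[OF f] by (simp add: m n)
    also have "\<dots> = (\<integral>\<^sup>+x. f x \<partial>N)"
      using m by (simp add: mult.assoc[symmetric] ennreal_mult[symmetric])
    finally show ?thesis by (simp add: nnN[OF f])
  qed
  \<comment> \<open>A factor 0 would annihilate the Gaussian itself, as it is a function of \<open>L x\<close> on the span.\<close>
  have "n \<noteq> 0"
  proof
    assume "n = 0"
    have "(\<integral>\<^sup>+x. G 1 x \<partial>M) = (\<integral>\<^sup>+x. G 1 (L' (L x)) \<partial>M)"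
      using AES by (intro nn_integral_cong_AE) (auto simp: S_def inv elim!: eventually_mono)
    also have "\<dots> = 0" by (subst eq[of "\<lambda>x. G 1 (L' x)"]) (auto simp: \<open>n = 0\<close>)
    finally show False using Gfin[of 1] by simp
  qed
  then show ?thesis using that[of "n / m"] eq m n by (simp add: M_def)
qed

text \<open>Elementary matrices generate all invertible ones, and on those that are not diagonal the value is
forced: a transposition is an involution, and conjugation with a diagonal matrix of entry 2 turns a
shear into its own square.\<close>

lemma invertible_matrix_multiplicative_eq_1:
  fixes u :: "real^'k^'k \<Rightarrow> real"
  assumes pos: "\<And>A. det A \<noteq> 0 \<Longrightarrow> 0 < u A"
    and mult: "\<And>A B. det A \<noteq> 0 \<Longrightarrow> det B \<noteq> 0 \<Longrightarrow> u (A ** B) = u A * u B"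
    and diag: "\<And>A. det A \<noteq> 0 \<Longrightarrow> (\<And>i j. i \<noteq> j \<Longrightarrow> A $ i $ j = 0) \<Longrightarrow> u A = 1"
  shows "det A \<noteq> 0 \<Longrightarrow> u A = 1"
proof (induction A rule: induct_matrix_elementary)
  case (1 A B)
  then show ?case using assms(2) by (auto simp: det_mul)
next
  case (2 A i)
  then show ?case using det_zero_row by blast
next
  case (3 A)
  then show ?case using diag by blast
next
  case (4 m n)
  let ?P = "(\<chi> i j. mat 1 $ i $ Transposition.transpose m n j) :: real^'k^'k"
  have tr: "i = Transposition.transpose m n k \<longleftrightarrow> k = Transposition.transpose m n i" for i k
    by (auto simp: transpose_def)
  have PP: "?P ** ?P = mat 1"
  proof -
    have "(\<Sum>k\<in>UNIV. ?P $ i $ k * ?P $ k $ j) = mat 1 $ i $ j" for i j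
    proof -
      have "(\<Sum>k\<in>UNIV. ?P $ i $ k * ?P $ k $ j)
        = (\<Sum>k\<in>UNIV. if k = Transposition.transpose m n i then ?P $ k $ j else 0)"
        by (intro sum.cong) (auto simp: mat_def tr[of i])
      also have "\<dots> = mat 1 $ i $ j" using tr[of "Transposition.transpose m n i" j] by (auto simp: mat_def)
      finally show ?thesis .
    qed
    then show ?thesis by (simp add: matrix_matrix_mult_def vec_eq_iff)
  qed
  have "u (mat 1) = 1" by (rule diag) (simp, simp add: mat_def)
  then have "u ?P * u ?P = 1" using mult[of ?P ?P] 4(2) PP by simp
  then show ?case using pos[OF 4(2)] by (auto simp: square_eq_1_iff)
next
  case (5 m n c)
  let ?E = "\<lambda>c. (\<chi> i j. if i = m \<and> j = n then c else of_bool (i = j)) :: real^'k^'k"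
  let ?D = "\<lambda>d. (\<chi> i j. if i = j then (if i = m then d else 1) else 0) :: real^'k^'k"
  have detE: "det (?E c) \<noteq> 0" by (rule 5)
  have DD: "det (?D d) \<noteq> 0" "u (?D d) = 1" if "d \<noteq> 0" for d
  proof -
    show "det (?D d) \<noteq> 0" using that by (subst det_diagonal) auto
    then show "u (?D d) = 1" by (rule diag) auto
  qed
  \<comment> \<open>Conjugation with the diagonal matrix doubles the off-diagonal entry, and so does squaring.\<close>
  have "(\<Sum>k\<in>UNIV. if k = m then c else if k = n then c else 0) = 2 * c"
    using 5(1) by (subst sum.mono_neutral_right[of _ "{m, n}"]) auto
  then have "?D 2 ** ?E c ** ?D (1/2) = ?E c ** ?E c"
    using 5(1)
    by (auto simp: matrix_matrix_mult_def vec_eq_iff if_distrib[of "\<lambda>x. x * _"] if_distrib[of "\<lambda>x. _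
        * x"] of_bool_def cong: if_cong)
  then have "u (?E c) = u (?E c) * u (?E c)"
    using mult[of "?D 2 ** ?E c" "?D (1/2)"] mult[of "?D 2" "?E c"] mult[of "?E c" "?E c"] detE DD[of 2]
        DD[of "1/2"]
    by (simp add: det_mul)
  then show ?case using pos[OF detE] by simp
qed

text \<open>The scaling factors of a linear action of the invertible matrices are multiplicative, so they form
a power of the determinant as soon as they do so on diagonal matrices, where each coordinate is
scaled separately.\<close>

lemma linear_action_jacobian:
  fixes b :: "'i \<Rightarrow> 'v::euclidean_space" and L :: "real^'k^'k \<Rightarrow> 'v \<Rightarrow> 'v"
  assumes I: "finite I" and b0: "\<And>p. p \<in> I \<Longrightarrow> b p \<noteq> 0"
    and orth: "pairwise (\<lambda>p q. orthogonal (b p) (b q)) I"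
    and lin: "\<And>A. linear (L A)" and inS: "\<And>A x. x \<in> span (b ` I) \<Longrightarrow> L A x \<in> span (b ` I)"
    and one: "\<And>x. x \<in> span (b ` I) \<Longrightarrow> L (mat 1) x = x" and mult: "\<And>A B x. L (A ** B) x = L A (L B x)"
    and diag: "\<And>A p. det A \<noteq> 0 \<Longrightarrow> (\<And>i j. i \<noteq> j \<Longrightarrow> A $ i $ j = 0) \<Longrightarrow> p \<in> I \<Longrightarrow> L A (b p) = s A p *\<^sub>R b p"
    and s: "\<And>A. det A \<noteq> 0 \<Longrightarrow> (\<And>i j. i \<noteq> j \<Longrightarrow> A $ i $ j = 0) \<Longrightarrow> (\<Prod>p\<in>I. \<bar>s A p\<bar>) = \<bar>det A\<bar> ^ N"
    and A: "det A \<noteq> 0" and f: "f \<in> borel_measurable borel"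
  shows "(\<integral>\<^sup>+x. f x \<partial>coord_measure I b) = ennreal (\<bar>det A\<bar> ^ N) * (\<integral>\<^sup>+x. f (L A x) \<partial>coord_measure I b)"
proof -
  let ?M = "coord_measure I b"
  define P where "P A c \<longleftrightarrow> 0 < c \<and> (\<forall>f\<in>borel_measurable borel. (\<integral>\<^sup>+x. f (L A x) \<partial>?M)
      = ennreal c * (\<integral>\<^sup>+x. f x \<partial>?M))"
    for A and c :: real
  define c where "c A = (SOME c. P A c)" for A
  have measL [measurable]: "L A \<in> borel_measurable borel" for A
    using lin by (auto intro!: borel_measurable_continuous_onI linear_continuous_on
        linear_conv_bounded_linear[THEN iffD1])
  have c: "P A (c A)" if "det A \<noteq> 0" for A
  proof -
    obtain A' where A': "A ** A' = mat 1" "A' ** A = mat 1"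
      using \<open>det A \<noteq> 0\<close> unfolding invertible_det_nz[symmetric] invertible_def by blast
    have inv: "L A (L A' x) = x" "L A' (L A x) = x" if "x \<in> span (b ` I)" for x
      using A' one[OF that] by (simp_all add: mult[symmetric])
    obtain c0 where "P A c0"
      using linear_image_scales_coord_measure[OF I b0 orth lin inS lin inS inv] unfolding P_def by metis
    then show ?thesis unfolding c_def by (rule someI)
  qed
  define G where "G = (\<integral>\<^sup>+x. gauss 1 x \<partial>?M)"
  have G: "0 < G" "G < \<infinity>"
    unfolding G_def using coord_measure_gauss_finite[OF _ I b0 orth, of 1] by auto
  have uniq: "c1 = c2" if "P A c1" "P A c2" for A c1 c2
  proof -
    have "G * ennreal c1 = G * ennreal c2" using that unfolding P_def G_def by (force simp: mult.commute)
    then have "ennreal c1 = ennreal c2" using G by (auto simp: ennreal_mult_cancel_left)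
    then show ?thesis using that by (simp add: P_def)
  qed
  have cm: "c (A ** B) = c A * c B" if "det A \<noteq> 0" "det B \<noteq> 0" for A B
  proof (rule uniq[OF c])
    show "det (A ** B) \<noteq> 0" using that by (simp add: det_mul)
    have cA: "P A (c A)" "P B (c B)" using that c by auto
    show "P (A ** B) (c A * c B)" unfolding P_def
    proof (intro conjI ballI)
      show "0 < c A * c B" using cA by (simp add: P_def)
      fix f :: "'v \<Rightarrow> ennreal" assume [measurable]: "f \<in> borel_measurable borel"
      have "(\<integral>\<^sup>+x. f (L (A ** B) x) \<partial>?M) = (\<integral>\<^sup>+x. (\<lambda>x. f (L A x)) (L B x) \<partial>?M)" by (simp add: mult)
      also have "\<dots> = ennreal (c B) * (\<integral>\<^sup>+x. f (L A x) \<partial>?M)" 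
        using cA(2) unfolding P_def by (elim conjE ballE[of _ _ "\<lambda>x. f (L A x)"]) auto
      also have "\<dots> = ennreal (c A * c B) * (\<integral>\<^sup>+x. f x \<partial>?M)"
        using cA unfolding P_def by (simp add: ennreal_mult mult_ac)
      finally show "(\<integral>\<^sup>+x. f (L (A ** B) x) \<partial>?M) = ennreal (c A * c B) * (\<integral>\<^sup>+x. f x \<partial>?M)" .
    qed
  qed
  have cd: "c A * \<bar>det A\<bar> ^ N = 1" if A: "det A \<noteq> 0" and d: "\<And>i j. i \<noteq> j \<Longrightarrow> A $ i $ j = 0" for A
  proof -
    have pr: "(\<Prod>p\<in>I. \<bar>s A p\<bar>) = \<bar>det A\<bar> ^ N" by (rule s[OF A d])
    have s0: "s A p \<noteq> 0" if "p \<in> I" for p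
    proof
      assume "s A p = 0"
      then have "(\<Prod>p\<in>I. \<bar>s A p\<bar>) = 0" using I that by auto
      then show False using pr A by simp
    qed
    have "P A (1 / \<bar>det A\<bar> ^ N)" unfolding P_def
    proof (intro conjI ballI)
      show "0 < 1 / \<bar>det A\<bar> ^ N" using A by simp
      fix f :: "'v \<Rightarrow> ennreal" assume [measurable]: "f \<in> borel_measurable borel"
      have "(\<integral>\<^sup>+x. f x \<partial>?M) = ennreal (\<bar>det A\<bar> ^ N)
          * (\<integral>\<^sup>+a. f (\<Sum>p\<in>I. (0 + s A p * a p) *\<^sub>R b p) \<partial>(\<Pi>\<^sub>M p\<in>I. lborel))"
        using nn_integral_coord_measure_affine[OF I, of "s A" f b "\<lambda>_. 0"] s0 by (simp add: pr)
      also have "(\<integral>\<^sup>+a. f (\<Sum>p\<in>I. (0 + s A p * a p) *\<^sub>R b p) \<partial>(\<Pi>\<^sub>M p\<in>I. lborel)) = (\<integral>\<^sup>+x. f (L A x) \<partial>?M)"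
        by (subst nn_integral_coord_measure)
          (auto simp: linear_sum[OF lin] linear_scale[OF lin] diag[OF A d] mult.commute intro!:
              nn_integral_cong arg_cong[where f=f] sum.cong)
      finally have "(\<integral>\<^sup>+x. f x \<partial>?M) = ennreal (\<bar>det A\<bar> ^ N) * (\<integral>\<^sup>+x. f (L A x) \<partial>?M)" .
      then show "(\<integral>\<^sup>+x. f (L A x) \<partial>?M) = ennreal (1 / \<bar>det A\<bar> ^ N) * (\<integral>\<^sup>+x. f x \<partial>?M)"
        using A by (simp add: mult.assoc[symmetric] ennreal_mult[symmetric])
    qed
    from uniq[OF c[OF A] this] show ?thesis using A by simp
  qed
  have "c A * \<bar>det A\<bar> ^ N = 1"
  proof (rule invertible_matrix_multiplicative_eq_1[of "\<lambda>A. c A * \<bar>det A\<bar> ^ N", OF _ _ _ A])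
    show "0 < c A * \<bar>det A\<bar> ^ N" if "det A \<noteq> 0" for A using c[OF that] that by (simp add: P_def)
    show "c (A ** B) * \<bar>det (A ** B)\<bar> ^ N = c A * \<bar>det A\<bar> ^ N * (c B * \<bar>det B\<bar> ^ N)"
        if "det A \<noteq> 0" "det B \<noteq> 0" for A B
      by (simp add: cm[OF that] det_mul abs_mult power_mult_distrib)
  qed (rule cd)
  moreover have "c A > 0" "(\<integral>\<^sup>+x. f (L A x) \<partial>?M) = ennreal (c A) * (\<integral>\<^sup>+x. f x \<partial>?M)"
    using c[OF A] f by (auto simp: P_def)
  ultimately show ?thesis
    by (simp add: mult.assoc[symmetric] ennreal_mult[symmetric] mult.commute)
qed

lemma lborel_eq_coord_measure: "lborel = coord_measure Basis (\<lambda>b. b :: 'v::euclidean_space)"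
  unfolding coord_measure_def by (rule lborel_eq)

lemma Basis_vec_real: "(Basis :: (real^'k) set) = range (\<lambda>i. axis i 1)"
  by (auto simp: Basis_vec_def)

lemma Basis_matrix_real: "(Basis :: (real^'k^'k) set) = (\<lambda>(i, j). axis i (axis j 1)) ` UNIV"
  by (auto simp: Basis_vec_def)

lemma matrix_mult_diag_component:
  fixes A :: "real^'k^'k"
  assumes "\<And>i j. i \<noteq> j \<Longrightarrow> A $ i $ j = 0"
  shows "(A *v x) $ i = A $ i $ i * x $ i"
proof -
  have "(\<Sum>j\<in>UNIV. A $ i $ j * x $ j) = (\<Sum>j\<in>{i}. A $ i $ j * x $ j)"
    using assms by (intro sum.mono_neutral_right) auto
  then show ?thesis by (simp add: matrix_vector_mult_def)
qed

lemma diag_mult_row: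
  fixes A S :: "real^'k^'k"
  assumes d: "\<And>i j. i \<noteq> j \<Longrightarrow> A $ i $ j = 0"
  shows "(A ** S) $ i = A $ i $ i *\<^sub>R (S $ i)"
proof -
  have "(\<Sum>k\<in>UNIV. A $ i $ k * S $ k $ j) = (\<Sum>k\<in>{i}. A $ i $ k * S $ k $ j)" for j
    using d by (intro sum.mono_neutral_right) auto
  then show ?thesis by (simp add: vec_eq_iff matrix_matrix_mult_def)
qed

lemma lborel_matrix_image:
  fixes A :: "real^'k^'k"
  assumes A: "det A \<noteq> 0" and f: "f \<in> borel_measurable borel"
  shows "(\<integral>\<^sup>+x. f x \<partial>lborel) = ennreal \<bar>det A\<bar> * (\<integral>\<^sup>+x. f (A *v x) \<partial>lborel)"
proof -
  have inj: "inj (\<lambda>i::'k. axis i (1::real))" by (auto simp: inj_on_def axis_eq_axis)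
  have "(\<integral>\<^sup>+x. f x \<partial>coord_measure Basis (\<lambda>b. b))
      = ennreal (\<bar>det A\<bar> ^ 1) * (\<integral>\<^sup>+x. f (A *v x) \<partial>coord_measure Basis (\<lambda>b. b))"
  proof (rule linear_action_jacobian[where L="\<lambda>A x. A *v x"
      and s="\<lambda>A p. (A *v p) \<bullet> p", OF _ _ _ _ _ _ _ _ _ A f])
    fix A :: "real^'k^'k" assume d: "\<And>i j. i \<noteq> j \<Longrightarrow> A $ i $ j = 0"
    have Ap: "A *v axis i 1 = A $ i $ i *\<^sub>R axis i 1" for i
      by (simp add: vec_eq_iff matrix_mult_diag_component[OF d] axis_def)
    show "A *v p = ((A *v p) \<bullet> p) *\<^sub>R p" if "p \<in> Basis" for p
      using that by (auto simp: Basis_vec_real Ap inner_axis_axis)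
    show "(\<Prod>p\<in>Basis. \<bar>(A *v p) \<bullet> p\<bar>) = \<bar>det A\<bar> ^ 1"
      unfolding Basis_vec_real prod.reindex[OF inj] using det_diagonal[OF d]
      by (simp add: Ap inner_axis_axis abs_prod)
  qed (auto simp: matrix_vector_mul_assoc pairwise_def orthogonal_def inner_Basis)
  then show ?thesis by (simp add: lborel_eq_coord_measure[symmetric])
qed

lemma linear_matrix_mult_right: "linear (\<lambda>g :: real^'k^'k. g ** B)"
  by (rule linearI) (simp_all add: vec_eq_iff matrix_matrix_mult_def algebra_simps sum.distrib
      sum_distrib_left)

lemma linear_matrix_mult_left: "linear (\<lambda>g :: real^'k^'k. B ** g)"
  by (rule linearI) (simp_all add: vec_eq_iff matrix_matrix_mult_def algebra_simps sum.distrib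
      sum_distrib_left)

lemma mult_transpose_row: "(g ** transpose A) $ i = A *v (g $ i)"
  for A g :: "real^'k^'k"
  by (simp add: vec_eq_iff matrix_matrix_mult_def matrix_vector_mult_def transpose_def mult.commute)

lemma lborel_matrix_right_mult:
  fixes A :: "real^'k^'k" and f :: "real^'k^'k \<Rightarrow> ennreal"
  assumes A: "det A \<noteq> 0" and f: "f \<in> borel_measurable borel"
  shows "(\<integral>\<^sup>+g. f g \<partial>lborel) = ennreal (\<bar>det A\<bar> ^ CARD('k)) * (\<integral>\<^sup>+g. f (g ** transpose A) \<partial>lborel)"
proof -
  have inj: "inj (\<lambda>(i, j). axis i (axis j (1::real)) :: real^'k^'k)"
    by (auto simp: inj_on_def axis_eq_axis)
  have "(\<integral>\<^sup>+x. f x \<partial>coord_measure Basis (\<lambda>b. b)) =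
      ennreal (\<bar>det A\<bar> ^ CARD('k)) * (\<integral>\<^sup>+g. f (g ** transpose A) \<partial>coord_measure Basis (\<lambda>b. b))"
  proof (rule linear_action_jacobian[where L="\<lambda>A g. g ** transpose A"
      and s="\<lambda>A p. (p ** transpose A) \<bullet> p", OF _ _ _ _ _ _ _ _ _ A f])
    fix A :: "real^'k^'k" assume d: "\<And>i j. i \<noteq> j \<Longrightarrow> A $ i $ j = 0"
    have Ap: "axis i (axis j 1) ** transpose A = A $ j $ j *\<^sub>R axis i (axis j 1)" for i j :: 'k
    proof -
      have "(axis i (axis j 1) ** transpose A) $ a $ b = A $ b $ b * axis i (axis j 1) $ a $ b" for a b
        unfolding mult_transpose_row by (rule matrix_mult_diag_component) (rule d)
      then show ?thesis by (simp add: vec_eq_iff) (simp add: axis_def)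
    qed
    show "p ** transpose A = ((p ** transpose A) \<bullet> p) *\<^sub>R p" if "p \<in> Basis" for p :: "real^'k^'k"
      using that by (auto simp: Basis_matrix_real Ap inner_axis_axis)
    have "(\<Prod>p\<in>(Basis :: (real^'k^'k) set). \<bar>(p ** transpose A) \<bullet> p\<bar>) = (\<Prod>(i::'k,j)\<in>UNIV. \<bar>A $ j $ j\<bar>)"
      unfolding Basis_matrix_real prod.reindex[OF inj]
      by (auto simp: Ap inner_axis_axis intro!: prod.cong)
    also have "\<dots> = \<bar>det A\<bar> ^ CARD('k)"
      using det_diagonal[OF d]
      by (simp add: prod.cartesian_product[symmetric] UNIV_Times_UNIV[symmetric] abs_prod del:
          UNIV_Times_UNIV)
    finally show "(\<Prod>p\<in>(Basis :: (real^'k^'k) set). \<bar>(p ** transpose A) \<bullet> p\<bar>) = \<bar>det A\<bar> ^ CARD('k)" .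
  qed (auto simp: matrix_transpose_mul matrix_mul_assoc pairwise_def orthogonal_def inner_Basis
        transpose_mat linear_matrix_mult_right)
  then show ?thesis by (simp add: lborel_eq_coord_measure[symmetric])
qed

lemma lborel_matrix_left_mult:
  fixes A :: "real^'k^'k" and f :: "real^'k^'k \<Rightarrow> ennreal"
  assumes A: "det A \<noteq> 0" and f: "f \<in> borel_measurable borel"
  shows "(\<integral>\<^sup>+g. f g \<partial>lborel) = ennreal (\<bar>det A\<bar> ^ CARD('k)) * (\<integral>\<^sup>+g. f (A ** g) \<partial>lborel)"
proof -
  have inj: "inj (\<lambda>(i, j). axis i (axis j (1::real)) :: real^'k^'k)"
    by (auto simp: inj_on_def axis_eq_axis)
  have "(\<integral>\<^sup>+x. f x \<partial>coord_measure Basis (\<lambda>b. b)) =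
      ennreal (\<bar>det A\<bar> ^ CARD('k)) * (\<integral>\<^sup>+g. f (A ** g) \<partial>coord_measure Basis (\<lambda>b. b))"
  proof (rule linear_action_jacobian[where L="\<lambda>A g. A ** g"
      and s="\<lambda>A p. (A ** p) \<bullet> p", OF _ _ _ _ _ _ _ _ _ A f])
    fix A :: "real^'k^'k" assume d: "\<And>i j. i \<noteq> j \<Longrightarrow> A $ i $ j = 0"
    have Ap: "A ** axis i (axis j 1) = A $ i $ i *\<^sub>R axis i (axis j 1)" for i j :: 'k
    proof -
      have "(A ** axis i (axis j 1)) $ a = A $ a $ a *\<^sub>R (axis i (axis j 1) $ a)" for a
        by (rule diag_mult_row) (rule d)
      then show ?thesis by (simp add: vec_eq_iff) (simp add: axis_def)
    qed
    show "A ** p = ((A ** p) \<bullet> p) *\<^sub>R p" if "p \<in> Basis" for p :: "real^'k^'k"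
      using that by (auto simp: Basis_matrix_real Ap inner_axis_axis)
    have "(\<Prod>p\<in>(Basis :: (real^'k^'k) set). \<bar>(A ** p) \<bullet> p\<bar>) = (\<Prod>(i::'k,j::'k)\<in>UNIV. \<bar>A $ i $ i\<bar>)"
      unfolding Basis_matrix_real prod.reindex[OF inj]
      by (auto simp: Ap inner_axis_axis intro!: prod.cong)
    also have "\<dots> = \<bar>det A\<bar> ^ CARD('k)"
      using det_diagonal[OF d]
      by (simp add: prod.cartesian_product[symmetric] UNIV_Times_UNIV[symmetric] abs_prod
          prod_power_distrib del: UNIV_Times_UNIV)
    finally show "(\<Prod>p\<in>(Basis :: (real^'k^'k) set). \<bar>(A ** p) \<bullet> p\<bar>) = \<bar>det A\<bar> ^ CARD('k)" .
  qed (auto simp: matrix_mul_assoc pairwise_def orthogonal_def inner_Basis linear_matrix_mult_left)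
  then show ?thesis by (simp add: lborel_eq_coord_measure[symmetric])
qed

abbreviation index_pairs :: "'k set set" where
  "index_pairs \<equiv> {{i, j} | i j :: 'k. True}"

text \<open>The diagonal matrix unit for a singleton, and the sum of the two off-diagonal ones for a pair of
distinct indices.\<close>

definition sym_basis :: "'k set \<Rightarrow> real^'k^'k" where
  "sym_basis p = (\<chi> i j. if {i, j} = p then 1 else 0)"

lemma coords_sym_basis:
  "(\<Sum>p\<in>index_pairs. a p *\<^sub>R sym_basis p) = (\<chi> i j :: 'k::finite. a {i, j})"
proof -
  have "(\<Sum>p\<in>index_pairs. a p * (if {i, j} = p then 1 else 0)) = a {i, j}" for i j :: 'k
    by (subst sum.mono_neutral_right[of _ "{{i,j}}"]) auto
  then show ?thesis by (simp add: vec_eq_iff sym_basis_def)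
qed

lemma lborel_sym_eq_coord_measure: "lborel_sym = coord_measure index_pairs sym_basis"
  unfolding lborel_sym_def coord_measure_def coords_sym_basis ..

lemma span_sym_basis: "span (sym_basis ` index_pairs) = {S :: real^'k^'k. transpose S = S}"
proof
  have "subspace {S :: real^'k^'k. transpose S = S}"
    by (auto simp: subspace_def transpose_def vec_eq_iff)
  moreover have "transpose (sym_basis p) = sym_basis p" for p :: "'k set"
    by (auto simp: sym_basis_def transpose_def vec_eq_iff insert_commute)
  ultimately show "span (sym_basis ` index_pairs) \<subseteq> {S :: real^'k^'k. transpose S = S}"
    by (intro span_minimal) auto
next
  show "{S :: real^'k^'k. transpose S = S} \<subseteq> span (sym_basis ` index_pairs)"
  proof safe
    fix S :: "real^'k^'k" assume S: "transpose S = S"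
    have sym: "S $ i $ j = S $ j $ i" for i j using S by (metis transpose_def vec_lambda_beta)
    define a where "a p = (THE v. \<forall>i j. p = {i, j} \<longrightarrow> v = S $ i $ j)" for p
    have "a {i, j} = S $ i $ j" for i j
      unfolding a_def by (rule the_equality) (auto simp: doubleton_eq_iff sym)
    then have "S = (\<chi> i j. a {i, j})" by (simp add: vec_eq_iff)
    also have "\<dots> = (\<Sum>p\<in>index_pairs. a p *\<^sub>R sym_basis p)" by (rule coords_sym_basis[symmetric])
    also have "\<dots> \<in> span (sym_basis ` index_pairs)"
      by (intro span_sum span_scale span_base) auto
    finally show "S \<in> span (sym_basis ` index_pairs)" .
  qed
qed

lemma sym_basis_nonzero: "p \<in> index_pairs \<Longrightarrow> sym_basis p \<noteq> 0"
  by (auto simp: sym_basis_def vec_eq_iff)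

lemma sym_basis_orthogonal: "pairwise (\<lambda>p q. orthogonal (sym_basis p) (sym_basis q))
    (index_pairs :: 'k::finite set set)"
  by (auto simp: pairwise_def orthogonal_def sym_basis_def inner_vec_def intro!: sum.neutral split:
      if_split_asm)

text \<open>This is where the exponent \<open>k + 1\<close> of the Jacobian comes from. A congruence by \<open>diag(d)\<close> multiplies
the entry \<open>{i, j}\<close> by \<open>d i * d j\<close>, so a diagonal entry receives its factor twice, as the exponent
\<open>2 div card p\<close> expresses. Every index lies in \<open>k\<close> of the sets, one of which is a singleton.\<close>

lemma prod_index_pairs:
  fixes d :: "'k::finite \<Rightarrow> real"
  shows "(\<Prod>p\<in>index_pairs. (\<Prod>i\<in>p. d i) ^ (2 div card p)) = (\<Prod>i\<in>UNIV. d i) ^ (CARD('k) + 1)"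
proof -
  have "(\<Prod>p\<in>index_pairs. (\<Prod>i\<in>p. d i) ^ (2 div card p))
      = (\<Prod>p\<in>index_pairs. \<Prod>i\<in>{i\<in>UNIV. i \<in> p}. d i ^ (2 div card p))"
    by (simp add: prod_power_distrib)
  also have "\<dots> = (\<Prod>i\<in>UNIV. \<Prod>p\<in>{p\<in>index_pairs. i \<in> p}. d i ^ (2 div card p))"
    by (rule prod.swap_restrict) auto
  also have "\<dots> = (\<Prod>i\<in>UNIV. d i ^ (CARD('k) + 1))"
  proof (intro prod.cong refl)
    fix i :: 'k
    have eq: "{p\<in>index_pairs. i \<in> p} = (\<lambda>j. {i, j}) ` UNIV" by auto
    have inj: "inj (\<lambda>j. {i, j})" by (auto simp: inj_on_def doubleton_eq_iff)
    have "(\<Prod>p\<in>{p\<in>index_pairs. i \<in> p}. d i ^ (2 div card p)) = (\<Prod>j\<in>UNIV. d i ^ (2 div card {i, j}))"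
      unfolding eq by (simp add: prod.reindex[OF inj])
    also have "\<dots> = (\<Prod>j\<in>UNIV. d i * (if j = i then d i else 1))"
    proof (intro prod.cong refl)
      fix j
      show "d i ^ (2 div card {i, j}) = d i * (if j = i then d i else 1)"
        by (cases "i = j") (simp_all add: power2_eq_square numeral_2_eq_2[symmetric])
    qed
    also have "\<dots> = d i ^ (CARD('k) + 1)" by (simp add: prod.distrib)
    finally show "(\<Prod>p\<in>{p\<in>index_pairs. i \<in> p}. d i ^ (2 div card p)) = d i ^ (CARD('k) + 1)" .
  qed
  also have "\<dots> = (\<Prod>i\<in>UNIV. d i) ^ (CARD('k) + 1)" by (rule prod_power_distrib[symmetric])
  finally show ?thesis .
qed

lemma lborel_sym_congruence:
  fixes A :: "real^'k^'k"
  assumes A: "det A \<noteq> 0" and f: "f \<in> borel_measurable borel"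
  shows "(\<integral>\<^sup>+S. f S \<partial>lborel_sym) = ennreal (\<bar>det A\<bar> ^ (CARD('k) + 1))
      * (\<integral>\<^sup>+S. f (A ** S ** transpose A) \<partial>lborel_sym)"
  unfolding lborel_sym_eq_coord_measure
proof (rule linear_action_jacobian[where L="\<lambda>A S. A ** S ** transpose A"
    and s="\<lambda>A p. (\<Prod>i\<in>p. A $ i $ i) ^ (2 div card p)", OF _ _ _ _ _ _ _ _ _ A f])
  show "pairwise (\<lambda>p q. orthogonal (sym_basis p) (sym_basis q)) (index_pairs :: 'k set set)"
    by (rule sym_basis_orthogonal)
  show "linear (\<lambda>S. A ** S ** transpose A)" for A :: "real^'k^'k"
    using linear_compose[OF linear_matrix_mult_left[of A] linear_matrix_mult_right[of "transpose A"]]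
    by (simp add: o_def)
  show "A ** x ** transpose A \<in> span (sym_basis ` index_pairs)" if "x \<in> span (sym_basis ` index_pairs)"
      for A x :: "real^'k^'k"
    using that unfolding span_sym_basis by (simp add: matrix_transpose_mul matrix_mul_assoc)
  fix A :: "real^'k^'k" assume d: "\<And>i j. i \<noteq> j \<Longrightarrow> A $ i $ j = 0"
  show "A ** sym_basis p ** transpose A = (\<Prod>i\<in>p. A $ i $ i) ^ (2 div card p) *\<^sub>R sym_basis p"
      if "p \<in> index_pairs" for p
  proof -
    have AS: "(A ** S) $ i = A $ i $ i *\<^sub>R (S $ i)" for S :: "real^'k^'k" and i
      by (rule diag_mult_row) (rule d)
    have "(A ** sym_basis p ** transpose A) $ i $ j = A $ j $ j * A $ i $ i * sym_basis p $ i $ j" for i j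
      by (simp add: mult_transpose_row matrix_mult_diag_component[OF d] AS)
    also have "\<dots> i j = (\<Prod>i\<in>p. A $ i $ i) ^ (2 div card p) * sym_basis p $ i $ j" for i j
    proof (cases "{i, j} = p")
      case True
      have "(\<Prod>i\<in>{i, j}. A $ i $ i) ^ (2 div card {i, j}) = A $ j $ j * A $ i $ i"
        by (cases "i = j") (simp_all add: power2_eq_square numeral_2_eq_2[symmetric])
      then show ?thesis using True by simp
    next
      case False
      then show ?thesis by (simp add: sym_basis_def)
    qed
    finally show ?thesis by (simp add: vec_eq_iff)
  qed
  show "(\<Prod>p\<in>index_pairs. \<bar>(\<Prod>i\<in>p. A $ i $ i) ^ (2 div card p)\<bar>) = \<bar>det A\<bar> ^ (CARD('k) + 1)"
    using prod_index_pairs[of "\<lambda>i. \<bar>A $ i $ i\<bar>"] by (simp add: power_abs abs_prod det_diagonal[OF d])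
qed (simp_all add: transpose_mat matrix_transpose_mul matrix_mul_assoc sym_basis_nonzero)

section \<open>Matrix inverses and measurability\<close>

lemma matrix_inv_eqI:
  fixes A B :: "real^'k^'k"
  assumes "A ** B = mat 1"
  shows "matrix_inv A = B"
proof -
  have BA: "B ** A = mat 1" using assms by (simp add: matrix_left_right_inverse)
  show ?thesis unfolding matrix_inv_def
  proof (rule some_equality)
    fix A' assume "A ** A' = mat 1 \<and> A' ** A = mat 1"
    then have "(B ** A) ** A' = B" by (simp add: matrix_mul_assoc[symmetric])
    then show "A' = B" by (simp add: BA)
  qed (use assms BA in auto)
qed

lemma matrix_inv_mult:
  fixes A :: "real^'k^'k"
  assumes "det A \<noteq> 0"
  shows "A ** matrix_inv A = mat 1" "matrix_inv A ** A = mat 1"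
proof -
  obtain B where "A ** B = mat 1" "B ** A = mat 1"
    using assms unfolding invertible_det_nz[symmetric] invertible_def by blast
  then show "A ** matrix_inv A = mat 1" "matrix_inv A ** A = mat 1"
    by (simp_all add: matrix_inv_eqI)
qed

lemma matrix_inv_mult_vec:
  fixes A :: "real^'k^'k"
  assumes "det A \<noteq> 0"
  shows "A *v (matrix_inv A *v x) = x" "matrix_inv A *v (A *v x) = x"
  using matrix_inv_mult[OF assms] by (simp_all add: matrix_vector_mul_assoc)

lemma det_matrix_inv:
  fixes A :: "real^'k^'k"
  assumes "det A \<noteq> 0"
  shows "det (matrix_inv A) = inverse (det A)"
proof -
  have "det A * det (matrix_inv A) = 1"
    by (simp add: det_mul[symmetric] matrix_inv_mult[OF assms])
  then show ?thesis by (rule inverse_unique[symmetric])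
qed

lemma matrix_inv_transpose:
  fixes A :: "real^'k^'k"
  assumes "det A \<noteq> 0"
  shows "matrix_inv (transpose A) = transpose (matrix_inv A)"
  by (rule matrix_inv_eqI) (simp add: matrix_transpose_mul[symmetric] matrix_inv_mult[OF assms]
      transpose_mat)

lemma matrix_inv_prod:
  fixes A B :: "real^'k^'k"
  assumes "det A \<noteq> 0" "det B \<noteq> 0"
  shows "matrix_inv (A ** B) = matrix_inv B ** matrix_inv A"
proof (rule matrix_inv_eqI)
  have "(A ** B) ** (matrix_inv B ** matrix_inv A) = A ** (B ** matrix_inv B) ** matrix_inv A"
    by (simp add: matrix_mul_assoc)
  then show "(A ** B) ** (matrix_inv B ** matrix_inv A) = mat 1"
    by (simp add: matrix_inv_mult assms)
qed

lemma matrix_inv_scaleR: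
  fixes A :: "real^'k^'k"
  assumes "det A \<noteq> 0" "c \<noteq> 0"
  shows "matrix_inv (c *\<^sub>R A) = (1 / c) *\<^sub>R matrix_inv A"
  by (rule matrix_inv_eqI) (use assms matrix_inv_mult(1)[of A] in \<open>simp add: matrix_scalar_ac
      scalar_matrix_assoc[symmetric] scalar_mult_eq_scaleR\<close>)

text \<open>Off the invertible matrices the inverse is an arbitrary but fixed matrix; this makes it Borel
measurable on the whole space.\<close>

lemma matrix_inv_not_invertible:
  fixes A :: "real^'k^'k"
  assumes "det A = 0"
  shows "matrix_inv A = (SOME B. False)"
proof -
  have "(A ** B = mat 1 \<and> B ** A = mat 1) = False" for B
    using assms invertible_det_nz[of A] unfolding invertible_def by auto
  then show ?thesis by (simp only: matrix_inv_def)
qed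

lemma matrix_inv_component:
  fixes A :: "real^'k^'k"
  assumes "det A \<noteq> 0"
  shows "matrix_inv A $ i $ j = det (\<chi> a b. if b = i then axis j 1 $ a else A $ a $ b) / det A"
proof -
  have "A *v (matrix_inv A *v axis j 1) = axis j 1" by (simp add: matrix_inv_mult_vec[OF assms])
  then have "matrix_inv A *v axis j 1 = (\<chi> k. det (\<chi> a b. if b
      = k then axis j 1 $ a else A $ a $ b) / det A)"
    by (simp add: cramer[OF assms])
  then have "(matrix_inv A *v axis j 1) $ i = det (\<chi> a b. if b
      = i then axis j 1 $ a else A $ a $ b) / det A"
    by (simp only: vec_lambda_beta)
  then show ?thesis by (simp add: matrix_vector_mult_basis column_def)
qed

lemma inner_adjoint: "x \<bullet> (A *v y) = (transpose A *v x) \<bullet> y" for A :: "real^'k^'k"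
  by (simp add: dot_lmul_matrix transpose_matrix_vector)


lemma measurable_vec_nth [measurable]: "(\<lambda>x :: 'a::euclidean_space^'k. x $ i) \<in> borel_measurable borel"
  by (intro borel_measurable_continuous_onI continuous_intros)

lemma measurable_vec_componentI:
  fixes f :: "'a \<Rightarrow> real^'k"
  assumes "\<And>i. (\<lambda>x. f x $ i) \<in> borel_measurable M"
  shows "f \<in> borel_measurable M"
  by (subst borel_measurable_euclidean_space) (auto simp: Basis_vec_real inner_axis assms)

lemma measurable_matrix_componentI:
  fixes f :: "'a \<Rightarrow> real^'k^'k"
  assumes "\<And>i j. (\<lambda>x. f x $ i $ j) \<in> borel_measurable M"
  shows "f \<in> borel_measurable M"
  by (subst borel_measurable_euclidean_space) (auto simp: Basis_matrix_real inner_axis assms)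

lemma measurable_det [measurable (raw)]:
  fixes f :: "'a \<Rightarrow> real^'k^'k"
  assumes [measurable]: "f \<in> borel_measurable M"
  shows "(\<lambda>x. det (f x)) \<in> borel_measurable M"
  unfolding det_def by measurable

lemma measurable_trace [measurable (raw)]:
  fixes f :: "'a \<Rightarrow> real^'k^'k"
  assumes [measurable]: "f \<in> borel_measurable M"
  shows "(\<lambda>x. trace (f x)) \<in> borel_measurable M"
  unfolding trace_def by measurable

lemma measurable_matrix_matrix_mult [measurable (raw)]:
  fixes f g :: "'a \<Rightarrow> real^'k^'k"
  assumes [measurable]: "f \<in> borel_measurable M" "g \<in> borel_measurable M"
  shows "(\<lambda>x. f x ** g x) \<in> borel_measurable M"
  by (rule measurable_matrix_componentI) (simp add: matrix_matrix_mult_def)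

lemma measurable_matrix_vector_mult [measurable (raw)]:
  fixes f :: "'a \<Rightarrow> real^'k^'k" and g :: "'a \<Rightarrow> real^'k"
  assumes [measurable]: "f \<in> borel_measurable M" "g \<in> borel_measurable M"
  shows "(\<lambda>x. f x *v g x) \<in> borel_measurable M"
  by (rule measurable_vec_componentI) (simp add: matrix_vector_mult_def)

lemma measurable_transpose [measurable (raw)]:
  fixes f :: "'a \<Rightarrow> real^'k^'k"
  assumes [measurable]: "f \<in> borel_measurable M"
  shows "(\<lambda>x. transpose (f x)) \<in> borel_measurable M"
  by (rule measurable_matrix_componentI) (simp add: transpose_def)

lemma measurable_matrix_inv [measurable (raw)]:
  fixes f :: "'a \<Rightarrow> real^'k^'k"
  assumes [measurable]: "f \<in> borel_measurable M"
  shows "(\<lambda>x. matrix_inv (f x)) \<in> borel_measurable M"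
proof (rule measurable_matrix_componentI)
  fix i j
  have [measurable]: "(\<lambda>x. \<chi> a b. if b = i then axis j 1 $ a else f x $ a $ b) \<in> borel_measurable M"
    by (rule measurable_matrix_componentI) simp
  have "(\<lambda>x. matrix_inv (f x) $ i $ j) =
    (\<lambda>x. if det (f x) = 0 then (SOME B. False) $ i $ j
         else det (\<chi> a b. if b = i then axis j 1 $ a else f x $ a $ b) / det (f x))"
    by (auto simp: fun_eq_iff matrix_inv_not_invertible matrix_inv_component)
  then show "(\<lambda>x. matrix_inv (f x) $ i $ j) \<in> borel_measurable M" by simp
qed

section \<open>Positive definite matrices\<close>

lemma pos_def_symmetric: "pos_def S \<Longrightarrow> S $ i $ j = S $ j $ i"
proof -
  assume "pos_def S"
  then have "transpose S $ j $ i = S $ j $ i" by (simp add: pos_def_def)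
  then show ?thesis by (simp add: transpose_def)
qed

lemma inner_congruence:
  "v \<bullet> ((A ** S ** transpose A) *v v) = (transpose A *v v) \<bullet> (S *v (transpose A *v v))"
      for A S :: "real^'k^'k"
  unfolding matrix_vector_mul_assoc[symmetric] by (rule inner_adjoint)

lemma pos_def_congruence:
  fixes A S :: "real^'k^'k"
  assumes A: "det A \<noteq> 0" and S: "pos_def S"
  shows "pos_def (A ** S ** transpose A)"
proof -
  have "transpose A *v v \<noteq> 0" if "v \<noteq> 0" for v
  proof
    assume "transpose A *v v = 0"
    then have "matrix_inv (transpose A) *v (transpose A *v v) = 0" by simp
    then show False using that A by (simp add: matrix_inv_mult_vec del: transpose_matrix_vector)
  qed
  then show ?thesis using S
    by (auto simp: pos_def_def inner_congruence matrix_transpose_mul matrix_mul_assoc)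
qed

lemma pos_def_congruence_iff:
  fixes A S :: "real^'k^'k"
  assumes A: "det A \<noteq> 0"
  shows "pos_def (A ** S ** transpose A) \<longleftrightarrow> pos_def S"
proof
  assume "pos_def (A ** S ** transpose A)"
  then have "pos_def (matrix_inv A ** (A ** S ** transpose A) ** transpose (matrix_inv A))"
    using A by (intro pos_def_congruence[of "matrix_inv A"]) (simp_all add: det_matrix_inv)
  also have "matrix_inv A ** (A ** S ** transpose A) ** transpose (matrix_inv A)
     = (matrix_inv A ** A) ** S ** transpose (matrix_inv A ** A)"
    by (simp add: matrix_transpose_mul matrix_mul_assoc)
  finally show "pos_def S" by (simp add: matrix_inv_mult[OF A] transpose_mat)
qed (rule pos_def_congruence[OF A])

lemma pos_def_mat_1: "pos_def (mat 1 :: real^'k^'k)"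
  by (simp add: pos_def_def transpose_mat)

lemma pos_def_mult_transpose: "det A \<noteq> 0 \<Longrightarrow> pos_def (A ** transpose A)" for A :: "real^'k^'k"
  using pos_def_congruence[OF _ pos_def_mat_1, of A] by simp

text \<open>Gram-Schmidt for the inner product \<open>u \<bullet> (S *v v)\<close>: as long as an index is missing, the vectors
\<open>S *v b i\<close> span a proper subspace, and a vector orthogonal to it extends the family.\<close>

lemma conjugate_family:
  fixes S :: "real^'k^'k"
  assumes S: "pos_def S"
  shows "\<exists>b. \<forall>i\<in>(I :: 'k set). \<forall>j\<in>I. b i \<bullet> (S *v b j) = (if i = j then 1 else 0)"
proof -
  have "finite I" by simp
  then show ?thesis
  proof (induction I rule: finite_induct)
    case empty show ?case by simp
  next
    case (insert m I)
    then obtain b where b: "\<And>i j. i \<in> I \<Longrightarrow> j \<in> I \<Longrightarrow> b i \<bullet> (S *v b j) = (if i = j then 1 else 0)" by blast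
    have "dim ((\<lambda>i. S *v b i) ` I) \<le> card ((\<lambda>i. S *v b i) ` I)" by (rule dim_le_card') simp
    also have "\<dots> \<le> card I" by (simp add: card_image_le)
    also have "card I < CARD('k)" using \<open>m \<notin> I\<close>
        by (metis UNIV_I finite psubsetI psubset_card_mono subset_UNIV)
    finally have "dim ((\<lambda>i. S *v b i) ` I) < DIM(real^'k)" by simp
    then obtain v where v: "v \<noteq> 0" "\<And>y. y \<in> span ((\<lambda>i. S *v b i) ` I) \<Longrightarrow> orthogonal v y"
      using orthogonal_to_subspace_exists by blast
    have q: "v \<bullet> (S *v v) > 0" using S v(1) by (simp add: pos_def_def)
    define w where "w = (1 / sqrt (v \<bullet> (S *v v))) *\<^sub>R v"
    have ww: "w \<bullet> (S *v w) = 1" using q by (simp add: w_def matrix_vector_mult_scaleR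
        real_sqrt_mult[symmetric])
    have wb: "w \<bullet> (S *v b i) = 0" if "i \<in> I" for i
      using v(2)[of "S *v b i"] that by (auto simp: w_def orthogonal_def span_base)
    have bw: "b i \<bullet> (S *v w) = 0" if "i \<in> I" for i
      using wb[OF that] S by (simp add: inner_adjoint[of "b i"] pos_def_def inner_commute)
    show ?case
      using b ww wb bw \<open>m \<notin> I\<close> by (intro exI[of _ "b(m := w)"]) auto
  qed
qed

text \<open>The rows of \<open>B\<close> form a full conjugate family, so that \<open>B S B' = 1\<close>; the factor is the inverse
of \<open>B\<close>.\<close>

lemma pos_def_factor:
  fixes S :: "real^'k^'k"
  assumes "pos_def S"
  obtains A where "det A \<noteq> 0" "S = A ** transpose A"
proof -
  obtain b where b: "\<And>i j :: 'k. b i \<bullet> (S *v b j) = (if i = j then 1 else 0)"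
    using conjugate_family[OF assms, of UNIV] by auto
  define B where "B = (\<chi> i. b i)"
  have "(B ** S ** transpose B) $ i $ j = b i \<bullet> (S *v b j)" for i j
  proof -
    have "(B ** S ** transpose B) $ i $ j = (B ** (S ** transpose B)) $ i $ j"
      by (simp add: matrix_mul_assoc)
    also have "\<dots> = (\<Sum>l\<in>UNIV. b i $ l * (S *v b j) $ l)"
      unfolding matrix_matrix_mult_def[of B] by (simp add: B_def matrix_matrix_mult_def
          matrix_vector_mult_def transpose_def)
    finally show ?thesis by (simp add: inner_vec_def)
  qed
  then have BSB: "B ** S ** transpose B = mat 1" by (simp add: vec_eq_iff mat_def b)
  then have "det B * det S * det B = 1" using det_mul[of "B ** S" "transpose B"] by (simp add: det_mul)
  then have dB: "det B \<noteq> 0" by auto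
  define A where "A = matrix_inv B"
  have "A ** (B ** S ** transpose B) ** transpose A = (A ** B) ** S ** transpose (A ** B)"
    by (simp add: matrix_transpose_mul matrix_mul_assoc)
  then have "S = A ** transpose A" by (simp add: BSB A_def matrix_inv_mult[OF dB] transpose_mat)
  moreover have "det A \<noteq> 0" using dB by (simp add: A_def det_matrix_inv)
  ultimately show ?thesis using that by blast
qed

lemma pos_def_det: "pos_def S \<Longrightarrow> 0 < det S" for S :: "real^'k^'k"
  by (erule pos_def_factor) (auto simp: det_mul zero_less_mult_iff linorder_neq_iff)

lemma matrix_inv_mult_transpose:
  "det A \<noteq> 0 \<Longrightarrow> matrix_inv (A ** transpose A) = transpose (matrix_inv A) ** matrix_inv A"
      for A :: "real^'k^'k"
  by (simp add: matrix_inv_prod matrix_inv_transpose)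

lemma pos_def_matrix_inv:
  fixes S :: "real^'k^'k"
  assumes "pos_def S" shows "pos_def (matrix_inv S)"
proof -
  obtain A where A: "det A \<noteq> 0" "S = A ** transpose A" using assms by (rule pos_def_factor)
  then show ?thesis
    using pos_def_mult_transpose[of "transpose (matrix_inv A)"]
    by (simp add: matrix_inv_mult_transpose det_matrix_inv)
qed

lemma pos_def_diag_pos: "pos_def S \<Longrightarrow> 0 < S $ i $ i" for S :: "real^'k^'k"
proof -
  assume "pos_def S"
  then have "0 < axis i 1 \<bullet> (S *v axis i 1)" unfolding pos_def_def by (metis axis_eq_0_iff zero_neq_one)
  then show ?thesis by (simp add: matrix_vector_mult_basis inner_axis' column_def)
qed

text \<open>By compactness of the unit sphere, the quadratic form of a positive definite matrix is bounded below
on it by some \<open>1 / (n + 1)\<close>. Hence the set is a countable union of closed sets.\<close>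

lemma borel_pos_def [measurable]: "{S :: real^'k^'k. pos_def S} \<in> sets borel"
proof -
  let ?Q = "\<lambda>n v. {S :: real^'k^'k. transpose S = S \<and> 1 / real (Suc n) \<le> v \<bullet> (S *v v)}"
  have Q: "closed (?Q n v)" for n v
    unfolding matrix_vector_mult_def inner_vec_def transpose_def
    by (intro closed_Collect_conj closed_Collect_eq closed_Collect_le continuous_intros)
  have "{S :: real^'k^'k. pos_def S} = (\<Union>n. \<Inter>v\<in>sphere 0 1. ?Q n v)"
  proof (intro set_eqI iffI)
    fix S :: "real^'k^'k" assume "S \<in> {S. pos_def S}"
    then have S: "pos_def S" by simp
    have cont: "continuous_on (sphere 0 1) (\<lambda>v. v \<bullet> (S *v v))"
      unfolding matrix_vector_mult_def inner_vec_def by (intro continuous_intros)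
    have "axis undefined 1 \<in> sphere (0 :: real^'k) 1" by simp
    then obtain u :: "real^'k" where u: "u \<in> sphere 0 1" "\<And>v. v \<in> sphere 0 1 \<Longrightarrow> u \<bullet> (S *v u) \<le> v \<bullet> (S *v v)"
      using continuous_attains_inf[OF compact_sphere _ cont] by blast
    have "u \<noteq> 0" using u(1) by auto
    then have "0 < u \<bullet> (S *v u)" using S by (simp add: pos_def_def)
    then obtain n where "1 / real (Suc n) < u \<bullet> (S *v u)"
      using reals_Archimedean inverse_eq_divide by metis
    then have "S \<in> ?Q n v" if "v \<in> sphere 0 1" for v
      using u(2)[OF that] S by (simp add: pos_def_def)
    then show "S \<in> (\<Union>n. \<Inter>v\<in>sphere 0 1. ?Q n v)" by blast
  next
    fix S :: "real^'k^'k" assume "S \<in> (\<Union>n. \<Inter>v\<in>sphere 0 1. ?Q n v)"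
    then obtain n where n: "\<And>v. v \<in> sphere 0 1 \<Longrightarrow> S \<in> ?Q n v" by blast
    have "axis undefined 1 \<in> sphere (0 :: real^'k) 1" by simp
    then have sym: "transpose S = S" using n by blast
    have "0 < v \<bullet> (S *v v)" if "v \<noteq> 0" for v
    proof -
      have "v /\<^sub>R norm v \<in> sphere 0 1" using that by simp
      then have "1 / real (Suc n) \<le> (v /\<^sub>R norm v) \<bullet> (S *v (v /\<^sub>R norm v))" using n by blast
      moreover have "0 < 1 / real (Suc n)" by simp
      ultimately have "0 < (v /\<^sub>R norm v) \<bullet> (S *v (v /\<^sub>R norm v))" by linarith
      then show ?thesis using that by (simp add: matrix_vector_mult_scaleR zero_less_mult_iff)
    qed
    then show "S \<in> {S. pos_def S}" using sym by (simp add: pos_def_def)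
  qed
  moreover have "closed (\<Inter>v\<in>sphere 0 1. ?Q n v)" for n using Q by blast
  ultimately show ?thesis by (simp only:) (intro sets.countable_UN, auto)
qed

section \<open>Lebesgue measure on the positive definite matrices\<close>

lemma sets_lborel_sym [simp, measurable_cong]: "sets lborel_sym = sets borel"
  by (simp add: lborel_sym_def)

lemma space_lborel_sym [simp]: "space lborel_sym = UNIV"
  by (simp add: lborel_sym_def)

lemma space_lborel_pd [simp]: "space lborel_pd = {S. pos_def S}"
  by (simp add: lborel_pd_def space_restrict_space)

lemma sets_lborel_pd [measurable_cong]: "sets lborel_pd = sets (restrict_space borel {S. pos_def S})"
  unfolding lborel_pd_def by (intro sets_restrict_space_cong) simp

lemma measurable_lborel_pd: "f \<in> measurable borel N \<Longrightarrow> f \<in> measurable lborel_pd N"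
  by (subst measurable_cong_sets[OF sets_lborel_pd refl]) (rule measurable_restrict_space1)

lemma lborel_sym_gauss_finite:
  "0 < c \<Longrightarrow> (\<integral>\<^sup>+S. gauss c S \<partial>lborel_sym) < \<infinity>"
  unfolding lborel_sym_eq_coord_measure
  by (rule coord_measure_gauss_finite[OF _ _ sym_basis_nonzero sym_basis_orthogonal]) auto

lemma sigma_finite_lborel_sym: "sigma_finite_measure lborel_sym"
  using lborel_sym_gauss_finite[of 1] by (intro sigma_finite_if_gauss_finite[of _ 1]) simp_all

lemma sigma_finite_lborel_pd: "sigma_finite_measure lborel_pd"
  unfolding lborel_pd_def
  by (intro sigma_finite_measure_restrict_space sigma_finite_lborel_sym) simp

lemma nn_integral_lborel_pd:
  "(\<integral>\<^sup>+S. f S \<partial>lborel_pd) = (\<integral>\<^sup>+S. f S * indicator {S. pos_def S} S \<partial>lborel_sym)"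
  unfolding lborel_pd_def by (rule nn_integral_restrict_space) simp

lemma lborel_pd_congruence:
  fixes A :: "real^'k^'k"
  assumes A: "det A \<noteq> 0" and [measurable]: "f \<in> borel_measurable borel"
  shows "(\<integral>\<^sup>+S. f S \<partial>lborel_pd) = ennreal (\<bar>det A\<bar> ^ (CARD('k) + 1))
      * (\<integral>\<^sup>+S. f (A ** S ** transpose A) \<partial>lborel_pd)"
  unfolding nn_integral_lborel_pd
  by (subst lborel_sym_congruence[OF A]) (measurable, simp add: indicator_def pos_def_congruence_iff[OF A])

section \<open>Moments of the determinant of a Gaussian matrix\<close>

lemma lborel_gauss_finite:
  "0 < c \<Longrightarrow> (\<integral>\<^sup>+x. gauss c (x :: 'v::euclidean_space) \<partial>lborel) < \<infinity>"
  "0 < c \<Longrightarrow> 0 < (\<integral>\<^sup>+x. gauss c (x :: 'v::euclidean_space) \<partial>lborel)"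
  unfolding lborel_eq_coord_measure
  by (rule coord_measure_gauss_finite; auto simp: pairwise_def orthogonal_def inner_Basis)+

lemma lborel_translation:
  "f \<in> borel_measurable borel \<Longrightarrow> (\<integral>\<^sup>+x. f (x + y) \<partial>lborel) = (\<integral>\<^sup>+x. f x \<partial>lborel)"
      for y :: "'v::euclidean_space"
  unfolding lborel_eq_coord_measure by (rule coord_measure_translation) auto

lemma inverse_ennreal_mult_real:
  assumes "0 < a" "0 \<le> b"
  shows "inverse (ennreal (a * b)) = inverse (ennreal a) * inverse (ennreal b)"
  using assms by (simp add: ennreal_mult ennreal_inverse_mult')

text \<open>A negative power with the value \<open>\<infinity>\<close> at 0, unlike \<open>powr\<close> with a negative exponent, which is 0 there.
Bounds with a vanishing base on the right-hand side then hold trivially.\<close>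

abbreviation inv_powr :: "real \<Rightarrow> real \<Rightarrow> ennreal" where
  "inv_powr r x \<equiv> inverse (ennreal (\<bar>x\<bar> powr r))"

lemma nn_integral_inverse_powr_finite:
  fixes r :: real
  assumes r: "0 \<le> r" "r < 1"
  shows "(\<integral>\<^sup>+x. inv_powr r x * indicator {-1..1} x \<partial>lborel) < \<infinity>"
proof -
  let ?f = "\<lambda>x. ennreal (x powr (- r)) * indicator {0..1} x"
  have "(\<integral>\<^sup>+x. inv_powr r x * indicator {-1..1} x \<partial>lborel)
      \<le> (\<integral>\<^sup>+x. ?f x + ?f (0 + (-1) * x) \<partial>lborel)"
  proof (intro nn_integral_mono_AE)
    have "AE x in lborel. x \<noteq> (0::real)" by (rule AE_lborel_singleton)
    then show "AE x in lborel. inv_powr r x * indicator {-1..1} x \<le> ?f x + ?f (0 + (-1) * x)"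
    proof eventually_elim
      fix x :: real assume "x \<noteq> 0"
      then show "inv_powr r x * indicator {-1..1} x \<le> ?f x + ?f (0 + (-1) * x)"
        by (cases "x > 0") (auto simp: indicator_def inverse_ennreal powr_minus)
    qed
  qed
  also have "\<dots> = (\<integral>\<^sup>+x. ?f x \<partial>lborel) + (\<integral>\<^sup>+x. ?f (0 + (-1) * x) \<partial>lborel)"
    by (intro nn_integral_add) auto
  also have "(\<integral>\<^sup>+x. ?f (0 + (-1) * x) \<partial>lborel) = (\<integral>\<^sup>+x. ?f x \<partial>lborel)"
    using nn_integral_real_affine[of ?f "-1" 0] by simp
  also have "(\<integral>\<^sup>+x. ?f x \<partial>lborel) = ennreal (1 powr (- r + 1) / (- r + 1))"
    using r by (intro nn_integral_has_integral_lebesgue' has_integral_powr_from_0) auto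
  finally show ?thesis by (simp add: less_top[symmetric] top_unique)
     (metis ennreal_add_eq_top ennreal_neq_top top.extremum_uniqueI)
qed

text \<open>Dividing by \<open>\<beta>\<close> reduces the claim to slope 1. There the part of the interval within distance 1
of the zero contributes at most the integral of \<open>|x|^(-r)\<close> over \<open>{-1..1}\<close>, wherever the zero lies,
and the integrand is at most 1 on the rest.\<close>

lemma nn_integral_inverse_powr_affine:
  fixes r :: real
  assumes r: "0 \<le> r" "r < 1"
  obtains C :: real where "0 < C" "\<And>\<alpha> \<beta>. (\<integral>\<^sup>+x. inv_powr r (\<alpha> + x * \<beta>) * indicator {0..1} x \<partial>lborel)
      \<le> ennreal C * inv_powr r \<beta>"
proof -
  define K where "K = (\<integral>\<^sup>+x. inv_powr r x * indicator {-1..1} x \<partial>lborel)"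
  have "K < \<infinity>" unfolding K_def by (rule nn_integral_inverse_powr_finite[OF r])
  then obtain k where k: "K = ennreal k" "k \<ge> 0" by (cases K) auto
  have unit: "(\<integral>\<^sup>+x. inv_powr r (y + x) * indicator {0..1} x \<partial>lborel) \<le> ennreal (1 + k)" for y :: real
  proof -
    have "inv_powr r (y + x) * indicator {0..1} x
       \<le> indicator {0..1} x + inv_powr r (x + y) * indicator {-1..1} (x + y)" for x
    proof (cases "\<bar>y + x\<bar> \<le> 1")
      case True
      then show ?thesis by (auto simp: indicator_def add.commute)
    next
      case False
      then have "1 \<le> \<bar>y + x\<bar> powr r" using r by (simp add: ge_one_powr_ge_zero)
      then have "inv_powr r (y + x) \<le> 1"
        by (subst inverse_ennreal) (auto simp: inverse_le_1_iff)
      then show ?thesis by (auto simp: indicator_def intro: order_trans)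
    qed
    then have "(\<integral>\<^sup>+x. inv_powr r (y + x) * indicator {0..1} x \<partial>lborel)
      \<le> (\<integral>\<^sup>+x. indicator {0..1} x + inv_powr r (x + y) * indicator {-1..1} (x + y) \<partial>lborel)"
      by (intro nn_integral_mono)
    also have "\<dots> = (\<integral>\<^sup>+x. indicator {0..1::real} x \<partial>lborel)
        + (\<integral>\<^sup>+x. inv_powr r (x + y) * indicator {-1..1} (x + y) \<partial>lborel)"
      by (intro nn_integral_add) auto
    also have "(\<integral>\<^sup>+x. inv_powr r (x + y) * indicator {-1..1} (x + y) \<partial>lborel) = K"
      unfolding K_def by (rule lborel_translation[of "\<lambda>x. inv_powr r x * indicator {-1..1} x"]) measurable
    finally show ?thesis using k by simp
  qed
  show ?thesis
  proof (rule that[of "1 + k"])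
    show "0 < 1 + k" using k by simp
    fix \<alpha> \<beta> :: real
    show "(\<integral>\<^sup>+x. inv_powr r (\<alpha> + x * \<beta>) * indicator {0..1} x \<partial>lborel)
      \<le> ennreal (1 + k) * inv_powr r \<beta>"
    proof (cases "\<beta> = 0")
      case True
      then show ?thesis using k by (simp add: ennreal_mult_top)
    next
      case False
      have "\<bar>\<alpha> + x * \<beta>\<bar> powr r = \<bar>\<beta>\<bar> powr r * \<bar>\<alpha> / \<beta> + x\<bar> powr r" for x
      proof -
        have "\<alpha> + x * \<beta> = \<beta> * (\<alpha> / \<beta> + x)" using False by (simp add: algebra_simps)
        then show ?thesis by (simp only: abs_mult powr_mult)
      qed
      then have "inv_powr r (\<alpha> + x * \<beta>) = inv_powr r \<beta> * inv_powr r (\<alpha> / \<beta> + x)" for x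
        using False by (simp add: inverse_ennreal_mult_real)
      then have "(\<integral>\<^sup>+x. inv_powr r (\<alpha> + x * \<beta>) * indicator {0..1} x \<partial>lborel)
         = inv_powr r \<beta> * (\<integral>\<^sup>+x. inv_powr r (\<alpha> / \<beta> + x) * indicator {0..1} x \<partial>lborel)"
        by (simp add: mult.assoc nn_integral_cmult)
      also have "\<dots> \<le> inv_powr r \<beta> * ennreal (1 + k)"
        by (intro mult_left_mono unit) auto
      finally show ?thesis by (simp add: mult.commute)
    qed
  qed
qed

text \<open>The principal minor of \<open>g\<close> on the rows and columns outside \<open>I\<close>, written as a determinant of full
size.\<close>

definition partial_det :: "'k set \<Rightarrow> real^'k^'k \<Rightarrow> real" where
  "partial_det I g = det (\<chi> i. if i \<in> I then axis i 1 else g $ i)"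

lemma partial_det_measurable [measurable]:
  fixes I :: "'k::finite set"
  shows "partial_det I \<in> borel_measurable borel"
proof -
  have [measurable]: "(\<lambda>g :: real^'k^'k. (\<chi> i.
      if i \<in> I then axis i 1 else g $ i) :: real^'k^'k) \<in> borel_measurable borel"
  proof (rule measurable_matrix_componentI)
    fix i j
    show "(\<lambda>g :: real^'k^'k. (\<chi> i. if i \<in> I then axis i 1 else g $ i) $ i $ j) \<in> borel_measurable borel"
      by (cases "i \<in> I") simp_all
  qed
  show ?thesis unfolding partial_det_def[abs_def] by measurable
qed

lemma partial_det_shift:
  assumes "j \<notin> I"
  shows "partial_det I (g + x *\<^sub>R axis j (axis j 1)) = partial_det I g + x * partial_det (insert j I) g"
proof -
  let ?c = "\<lambda>i. if i \<in> I then axis i 1 else g $ i"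
  have "(\<chi> i. if i \<in> I then axis i 1 else (g + x *\<^sub>R axis j (axis j 1)) $ i)
     = (\<chi> i. if i = j then g $ j + x *s axis j 1 else ?c i)"
    using assms by (auto simp: vec_eq_iff axis_def)
  moreover have "(\<chi> i. ?c i) = (\<chi> i. if i = j then g $ j else ?c i)"
    using assms by (auto simp: vec_eq_iff)
  moreover have "(\<chi> i. if i \<in> insert j I then axis i 1 else g $ i)
      = (\<chi> i. if i = j then axis j 1 else ?c i)"
    using assms by (auto simp: vec_eq_iff)
  ultimately show ?thesis
    unfolding partial_det_def
    by (simp only: det_row_add[of j "\<lambda>_. g $ j" "\<lambda>_. x *s axis j 1" ?c] det_row_mul[of j x "\<lambda>_. axis j
        1" ?c])
qed

text \<open>Lebesgue measure does not change when the entry \<open>(j, j)\<close> is shifted by \<open>x\<close>, so the integral equals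
its average over \<open>x\<close> in \<open>{0..1}\<close>. As the minor for \<open>I\<close> is affine in that entry with the minor for
\<open>insert j I\<close> as slope, the average over \<open>x\<close> is bounded by a multiple of the same negative power of
this smaller minor, while the Gaussian loses half of its exponent. The last minor is constantly 1.\<close>

lemma partial_det_gauss_moment_finite:
  fixes r c :: real and I :: "'k::finite set"
  assumes r: "0 \<le> r" "r < 1" and c: "0 < c"
  shows "(\<integral>\<^sup>+g. inv_powr r (partial_det I g) * gauss c g \<partial>lborel) < \<infinity>"
proof -
  have "finite (- I)" by simp
  then show ?thesis using c
  proof (induction "- I" arbitrary: I c rule: finite_psubset_induct)
    case psubset
    note c = \<open>0 < c\<close>
    show ?case
    proof (cases "I = UNIV")
      case True
      have "partial_det UNIV g = 1" for g :: "real^'k^'k"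
      proof -
        have "(\<chi> i. axis i 1) = (mat 1 :: real^'k^'k)" by (auto simp: vec_eq_iff mat_def axis_def)
        then show ?thesis by (simp add: partial_det_def)
      qed
      then show ?thesis using lborel_gauss_finite(1)[OF c] by (simp add: True)
    next
      case False
      then obtain j where j: "j \<notin> I" by auto
      obtain C where C: "0 < C" "\<And>\<alpha> \<beta>. (\<integral>\<^sup>+x. inv_powr r (\<alpha> + x * \<beta>) * indicator {0..1} x \<partial>lborel)
        \<le> ennreal C * inv_powr r \<beta>"
        using nn_integral_inverse_powr_affine[OF r] by blast
      let ?u = "axis j (axis j 1) :: real^'k^'k"
      let ?E = "\<lambda>c g. gauss c (g :: real^'k^'k)"
      let ?F = "\<lambda>g. inv_powr r (partial_det I g) * ?E c g"
      have E: "?E c (g + x *\<^sub>R ?u) \<le> ennreal (exp c) * ?E (c / 2) g" if "x \<in> {0..1}" for x g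
      proof -
        have "norm g \<le> norm (g + x *\<^sub>R ?u) + norm (x *\<^sub>R ?u)"
          by (metis add_diff_cancel_right' norm_triangle_ineq4)
        also have "norm (x *\<^sub>R ?u) \<le> 1" using that by simp
        finally have "(norm g)\<^sup>2 \<le> (norm (g + x *\<^sub>R ?u) + 1)\<^sup>2" by (simp add: power_mono)
        also have "\<dots> \<le> 2 * (norm (g + x *\<^sub>R ?u))\<^sup>2 + 2"
          using zero_le_power2[of "norm (g + x *\<^sub>R ?u) - 1"] by (simp add: power2_eq_square algebra_simps)
        finally have "c * ((norm g)\<^sup>2 / 2) \<le> c * ((norm (g + x *\<^sub>R ?u))\<^sup>2 + 1)"
          using c by (intro mult_left_mono) auto
        then show ?thesis
          by (simp add: ennreal_mult[symmetric] exp_add[symmetric] algebra_simps)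
      qed
      have "(\<integral>\<^sup>+g. ?F g \<partial>lborel) = (\<integral>\<^sup>+x. (\<integral>\<^sup>+g. ?F g \<partial>lborel) * indicator {0..1::real} x \<partial>lborel)"
        by (simp add: nn_integral_cmult)
      also have "\<dots> = (\<integral>\<^sup>+x. (\<integral>\<^sup>+g. ?F (g + x *\<^sub>R ?u) * indicator {0..1} x \<partial>lborel) \<partial>lborel)"
        by (intro nn_integral_cong, subst nn_integral_multc, measurable, subst lborel_translation[of
            ?F]) auto
      also have "\<dots> = (\<integral>\<^sup>+g. (\<integral>\<^sup>+x. ?F (g + x *\<^sub>R ?u) * indicator {0..1} x \<partial>lborel) \<partial>lborel)"
        by (rule lborel_pair.Fubini') measurable
      also have "\<dots> \<le> (\<integral>\<^sup>+g. (ennreal C * inv_powr r (partial_det (insert j I) g))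
          * (ennreal (exp c) * ?E (c / 2) g) \<partial>lborel)"
      proof (intro nn_integral_mono)
        fix g :: "real^'k^'k"
        have "(\<integral>\<^sup>+x. ?F (g + x *\<^sub>R ?u) * indicator {0..1} x \<partial>lborel)
          \<le> (\<integral>\<^sup>+x. (inv_powr r (partial_det I g
              + x * partial_det (insert j I) g) * indicator {0..1} x) * (ennreal (exp c)
              * ?E (c / 2) g) \<partial>lborel)"
        proof (intro nn_integral_mono)
          fix x :: real
          show "?F (g + x *\<^sub>R ?u) * indicator {0..1} x
              \<le> (inv_powr r (partial_det I g + x * partial_det (insert j I) g) * indicator {0..1} x)
              * (ennreal (exp c) * ?E (c / 2) g)"
            unfolding partial_det_shift[OF j]
            using E[of x g] by (cases "x \<in> {0..1}") (auto intro!: mult_left_mono)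
        qed
        also have "\<dots> = (\<integral>\<^sup>+x. inv_powr r (partial_det I g + x * partial_det (insert j I) g)
            * indicator {0..1} x \<partial>lborel) * (ennreal (exp c) * ?E (c / 2) g)"
          by (rule nn_integral_multc) measurable
        also have "\<dots> \<le> (ennreal C * inv_powr r (partial_det (insert j I) g))
            * (ennreal (exp c) * ?E (c / 2) g)"
          by (intro mult_right_mono C(2)) auto
        finally show "(\<integral>\<^sup>+x. ?F (g + x *\<^sub>R ?u) * indicator {0..1} x \<partial>lborel)
          \<le> (ennreal C * inv_powr r (partial_det (insert j I) g)) * (ennreal (exp c) * ?E (c / 2) g)" .
      qed
      also have "\<dots> = (\<integral>\<^sup>+g. ennreal (C * exp c)
          * (inv_powr r (partial_det (insert j I) g) * ?E (c / 2) g) \<partial>lborel)"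
        using C(1) by (intro nn_integral_cong) (simp add: ennreal_mult mult_ac)
      also have "\<dots> = ennreal (C * exp c) * (\<integral>\<^sup>+g. inv_powr r (partial_det (insert j I) g)
          * ?E (c / 2) g \<partial>lborel)"
        by (rule nn_integral_cmult) measurable
      also have "\<dots> < \<infinity>"
      proof -
        have "- insert j I \<subset> - I" using j by auto
        from psubset.hyps(2)[OF this, of "c / 2"] c show ?thesis
          by (simp add: ennreal_mult_less_top)
      qed
      finally show ?thesis .
    qed
  qed
qed

lemma abs_det_le: "\<bar>det g\<bar> \<le> fact CARD('k) * norm g ^ CARD('k)" for g :: "real^'k^'k"
proof -
  have comp: "\<bar>g $ i $ j\<bar> \<le> norm g" for i j
    by (meson component_le_norm_cart order_trans Finite_Cartesian_Product.norm_nth_le)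
  have "\<bar>det g\<bar> \<le> (\<Sum>p\<in>{p. p permutes UNIV}. \<bar>of_int (sign p) * (\<Prod>i\<in>UNIV. g $ i $ p i)\<bar>)"
    unfolding det_def by (rule sum_abs)
  also have "\<dots> \<le> (\<Sum>p\<in>{p. p permutes (UNIV :: 'k set)}. norm g ^ CARD('k))"
  proof (intro sum_mono)
    fix p :: "'k \<Rightarrow> 'k"
    have "\<bar>of_int (sign p) * (\<Prod>i\<in>UNIV. g $ i $ p i)\<bar> = (\<Prod>i\<in>UNIV. \<bar>g $ i $ p i\<bar>)"
      by (simp add: abs_mult abs_prod sign_def)
    also have "\<dots> \<le> (\<Prod>i\<in>(UNIV :: 'k set). norm g)" by (intro prod_mono) (auto simp: comp)
    finally show "\<bar>of_int (sign p) * (\<Prod>i\<in>UNIV. g $ i $ p i)\<bar> \<le> norm g ^ CARD('k)" by simp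
  qed
  also have "\<dots> = fact CARD('k) * norm g ^ CARD('k)" by (simp add: card_permutations)
  finally show ?thesis .
qed

lemma power_le_exp: "0 \<le> (x::real) \<Longrightarrow> x ^ n \<le> fact n * exp x"
proof -
  assume x: "0 \<le> x"
  have "(\<Sum>m\<in>{n}. x ^ m /\<^sub>R fact m) \<le> exp x"
    unfolding exp_def by (rule sum_le_suminf) (use x summable_exp_generic[of x] in auto)
  then show ?thesis by (simp add: field_simps)
qed

text \<open>For negative orders the previous lemma applies with \<open>I = {}\<close>; for the others, the determinant is
bounded by a power of the norm, which the Gaussian absorbs.\<close>

lemma det_gauss_moment_finite:
  fixes s :: real
  assumes s: "- 1 < s"
  shows "(\<integral>\<^sup>+g. ennreal (\<bar>det (g :: real^'k^'k)\<bar> powr s * exp (- (1/2) * (norm g)\<^sup>2)) \<partial>lborel) < \<infinity>"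
proof (cases "s < 0")
  case True
  have "(\<integral>\<^sup>+g. ennreal (\<bar>det (g :: real^'k^'k)\<bar> powr s * exp (- (1/2) * (norm g)\<^sup>2)) \<partial>lborel)
    \<le> (\<integral>\<^sup>+g. inverse (ennreal (\<bar>partial_det {} (g :: real^'k^'k)\<bar> powr (- s))) * gauss (1/2) g \<partial>lborel)"
  proof (intro nn_integral_mono)
    fix g :: "real^'k^'k"
    have "ennreal (\<bar>det g\<bar> powr s) \<le> inverse (ennreal (\<bar>det g\<bar> powr (- s)))"
      by (cases "det g = 0") (auto simp: inverse_ennreal powr_minus)
    then show "ennreal (\<bar>det g\<bar> powr s * exp (- (1/2) * (norm g)\<^sup>2))
        \<le> inverse (ennreal (\<bar>partial_det {} g\<bar> powr (- s))) * gauss (1/2) g"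
      by (auto simp: partial_det_def ennreal_mult intro!: mult_right_mono)
  qed
  also have "\<dots> < \<infinity>" using True s by (intro partial_det_gauss_moment_finite) auto
  finally show ?thesis .
next
  case False
  define n where "n = nat \<lceil>s\<rceil>"
  define m where "m = CARD('k) * n"
  define F where "F = (fact CARD('k) :: real) ^ n"
  have n: "s \<le> real n" by (simp add: n_def real_nat_ceiling_ge)
  have "1 \<le> (fact CARD('k) :: real)" by simp
  then have F: "F \<ge> 1" unfolding F_def by (rule one_le_power)
  define C where "C = 2 * F * (4 ^ m * (fact m * exp (1/4)))"
  have bound: "\<bar>det g\<bar> powr s * exp (- (1/2) * (norm g)\<^sup>2) \<le> C * exp (- (1/4) * (norm g)\<^sup>2)"
      for g :: "real^'k^'k"
  proof -
    let ?y = "1 + (norm g)\<^sup>2"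
    have y: "norm g \<le> ?y" using zero_le_power2[of "norm g - 1/2"]
        by (simp add: power2_eq_square algebra_simps)
    have "\<bar>det g\<bar> powr s \<le> 1 + \<bar>det g\<bar> ^ n"
    proof (cases "\<bar>det g\<bar> \<le> 1")
      case True
      then have "\<bar>det g\<bar> powr s \<le> 1 powr s" using False by (intro powr_mono2) auto
      then show ?thesis by (simp add: add_increasing2)
    next
      case big: False
      then have "\<bar>det g\<bar> powr s \<le> \<bar>det g\<bar> powr real n" using n by (intro powr_mono) auto
      then show ?thesis using big by (simp add: powr_realpow)
    qed
    also have "\<bar>det g\<bar> ^ n \<le> (fact CARD('k) * ?y ^ CARD('k)) ^ n"
      using y by (intro power_mono order_trans[OF abs_det_le] mult_left_mono power_mono) auto
    also have "\<dots> = F * ?y ^ m" by (simp add: power_mult_distrib power_mult m_def F_def)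
    also have "1 + F * ?y ^ m \<le> 2 * F * ?y ^ m"
    proof -
      have "1 \<le> ?y ^ m" by (rule one_le_power) simp
      then have "1 * 1 \<le> F * ?y ^ m" using F by (intro mult_mono) auto
      then show ?thesis by simp
    qed
    also have "?y ^ m = 4 ^ m * (?y / 4) ^ m" by (simp add: power_divide)
    also have "2 * F * (4 ^ m * (?y / 4) ^ m) \<le> 2 * F * (4 ^ m * (fact m * exp (?y / 4)))"
      using F by (intro mult_left_mono power_le_exp) auto
    also have "\<dots> = C * exp ((norm g)\<^sup>2 / 4)" by (simp add: C_def exp_add[symmetric] add_divide_distrib)
    finally have "\<bar>det g\<bar> powr s * exp (- (1/2) * (norm g)\<^sup>2)
        \<le> C * exp ((norm g)\<^sup>2 / 4) * exp (- (1/2) * (norm g)\<^sup>2)"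
      by (intro mult_right_mono) auto
    also have "\<dots> = C * exp (- (1/4) * (norm g)\<^sup>2)" by (simp add: mult.assoc exp_add[symmetric])
    finally show ?thesis .
  qed
  have C: "C \<ge> 0" using F by (simp add: C_def)
  have "(\<integral>\<^sup>+g. ennreal (\<bar>det (g :: real^'k^'k)\<bar> powr s * exp (- (1/2) * (norm g)\<^sup>2)) \<partial>lborel)
     \<le> (\<integral>\<^sup>+g. ennreal C * gauss (1/4) (g :: real^'k^'k) \<partial>lborel)"
    using bound C by (intro nn_integral_mono) (simp add: ennreal_mult[symmetric] del: times_divide_eq_left)
  also have "\<dots> = ennreal C * (\<integral>\<^sup>+g. gauss (1/4) (g :: real^'k^'k) \<partial>lborel)"
    by (rule nn_integral_cmult) measurable
  also have "\<dots> < \<infinity>" using lborel_gauss_finite(1)[of "1/4", where 'v="real^'k^'k"]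
      by (simp add: ennreal_mult_less_top)
  finally show ?thesis .
qed

section \<open>Invariant measures and their duality\<close>

text \<open>Haar measure on the invertible matrices. The singular ones have density 0 because
\<open>0 powr y = 0\<close>.\<close>

definition gl_haar :: "(real^'k^'k) measure" where
  "gl_haar = density lborel (\<lambda>g. ennreal (\<bar>det g\<bar> powr (- real CARD('k))))"

text \<open>The measure on the positive definite matrices that is invariant under all congruences.\<close>

definition pd_haar :: "(real^'k^'k) measure" where
  "pd_haar = density lborel_pd (\<lambda>S. ennreal (det S powr (- (real CARD('k) + 1) / 2)))"

lemma nn_integral_gl_haar:
  "f \<in> borel_measurable borel \<Longrightarrow>
    (\<integral>\<^sup>+g. f g \<partial>gl_haar) = (\<integral>\<^sup>+g. ennreal (\<bar>det (g :: real^'k^'k)\<bar> powr (- real CARD('k))) * f g \<partial>lborel)"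
  unfolding gl_haar_def by (rule nn_integral_density) auto

lemma nn_integral_pd_haar:
  "f \<in> borel_measurable borel \<Longrightarrow>
    (\<integral>\<^sup>+S. f S \<partial>pd_haar) = (\<integral>\<^sup>+S. ennreal (det (S :: real^'k^'k) powr (- (real CARD('k)
        + 1) / 2)) * f S \<partial>lborel_pd)"
  unfolding pd_haar_def by (rule nn_integral_density; rule measurable_lborel_pd; measurable)

lemma sets_gl_haar [simp, measurable_cong]: "sets gl_haar = sets borel"
  by (simp add: gl_haar_def)

lemma sets_pd_haar: "sets pd_haar = sets (restrict_space borel {S. pos_def S})"
  by (simp add: pd_haar_def sets_lborel_pd)

lemma space_pd_haar: "space pd_haar = {S. pos_def S}"
  by (simp add: pd_haar_def)

lemma sigma_finite_gl_haar: "sigma_finite_measure (gl_haar :: (real^'k^'k) measure)"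
  unfolding gl_haar_def by (subst sigma_finite_measure.sigma_finite_iff_density_finite[OF
      sigma_finite_lborel]) auto

lemma sigma_finite_pd_haar: "sigma_finite_measure (pd_haar :: (real^'k^'k) measure)"
proof -
  have "(\<lambda>S :: real^'k^'k. ennreal (det S powr (- (real CARD('k) + 1) / 2))) \<in> borel_measurable lborel_pd"
    by (rule measurable_lborel_pd) measurable
  then show ?thesis
    unfolding pd_haar_def by (subst sigma_finite_measure.sigma_finite_iff_density_finite[OF
        sigma_finite_lborel_pd]) auto
qed

lemma powr_neg_card_cancel: "a > 0 \<Longrightarrow> ennreal (a ^ n) * ennreal (a powr (- real n)) = 1"
  by (simp add: ennreal_mult[symmetric] powr_minus powr_realpow)

lemma gl_haar_left_mult:
  fixes A :: "real^'k^'k" and f :: "real^'k^'k \<Rightarrow> ennreal"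
  assumes A: "det A \<noteq> 0" and [measurable]: "f \<in> borel_measurable borel"
  shows "(\<integral>\<^sup>+g. f (A ** g) \<partial>gl_haar) = (\<integral>\<^sup>+g. f g \<partial>gl_haar)"
proof -
  let ?w = "\<lambda>g :: real^'k^'k. ennreal (\<bar>det g\<bar> powr (- real CARD('k)))"
  have "(\<integral>\<^sup>+g. f g \<partial>gl_haar) = ennreal (\<bar>det A\<bar> ^ CARD('k)) * (\<integral>\<^sup>+g. ?w (A ** g) * f (A ** g) \<partial>lborel)"
    by (subst nn_integral_gl_haar, measurable, subst lborel_matrix_left_mult[OF A]) auto
  also have "(\<integral>\<^sup>+g. ?w (A ** g) * f (A ** g) \<partial>lborel) = (\<integral>\<^sup>+g. ?w A * (?w g * f (A ** g)) \<partial>lborel)"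
    by (simp add: det_mul abs_mult powr_mult ennreal_mult mult.assoc)
  also have "\<dots> = ?w A * (\<integral>\<^sup>+g. ?w g * f (A ** g) \<partial>lborel)"
    by (rule nn_integral_cmult) measurable
  also have "(\<integral>\<^sup>+g. ?w g * f (A ** g) \<partial>lborel) = (\<integral>\<^sup>+g. f (A ** g) \<partial>gl_haar)"
    by (subst nn_integral_gl_haar) auto
  finally show ?thesis
    using A by (simp add: mult.assoc[symmetric] powr_neg_card_cancel)
qed

lemma gl_haar_right_mult:
  fixes A :: "real^'k^'k" and f :: "real^'k^'k \<Rightarrow> ennreal"
  assumes A: "det A \<noteq> 0" and [measurable]: "f \<in> borel_measurable borel"
  shows "(\<integral>\<^sup>+g. f (g ** A) \<partial>gl_haar) = (\<integral>\<^sup>+g. f g \<partial>gl_haar)"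
proof -
  let ?w = "\<lambda>g :: real^'k^'k. ennreal (\<bar>det g\<bar> powr (- real CARD('k)))"
  have A': "det (transpose A) \<noteq> 0" using A by simp
  have "(\<integral>\<^sup>+g. f g \<partial>gl_haar) = ennreal (\<bar>det A\<bar> ^ CARD('k)) * (\<integral>\<^sup>+g. ?w (g ** A) * f (g ** A) \<partial>lborel)"
    by (subst nn_integral_gl_haar, measurable, subst lborel_matrix_right_mult[OF A']) auto
  also have "(\<integral>\<^sup>+g. ?w (g ** A) * f (g ** A) \<partial>lborel) = (\<integral>\<^sup>+g. ?w A * (?w g * f (g ** A)) \<partial>lborel)"
    by (simp add: det_mul abs_mult powr_mult ennreal_mult mult_ac)
  also have "\<dots> = ?w A * (\<integral>\<^sup>+g. ?w g * f (g ** A) \<partial>lborel)"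
    by (rule nn_integral_cmult) measurable
  also have "(\<integral>\<^sup>+g. ?w g * f (g ** A) \<partial>lborel) = (\<integral>\<^sup>+g. f (g ** A) \<partial>gl_haar)"
    by (subst nn_integral_gl_haar) auto
  finally show ?thesis
    using A by (simp add: mult.assoc[symmetric] powr_neg_card_cancel)
qed

lemma det_congruence: "det (A ** S ** transpose A) = (det A)\<^sup>2 * det S" for A S :: "real^'k^'k"
  by (simp add: det_mul power2_eq_square)

lemma pd_haar_congruence:
  fixes A :: "real^'k^'k" and f :: "real^'k^'k \<Rightarrow> ennreal"
  assumes A: "det A \<noteq> 0" and [measurable]: "f \<in> borel_measurable borel"
  shows "(\<integral>\<^sup>+S. f (A ** S ** transpose A) \<partial>pd_haar) = (\<integral>\<^sup>+S. f S \<partial>pd_haar)"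
proof -
  let ?w = "\<lambda>S :: real^'k^'k. ennreal (det S powr (- (real CARD('k) + 1) / 2))"
  let ?c = "ennreal (\<bar>det A\<bar> powr (- real (CARD('k) + 1)))"
  have w: "?w (A ** S ** transpose A) = ?c * ?w S" if "pos_def S" for S
  proof -
    have "(det A)\<^sup>2 = \<bar>det A\<bar> powr 2" using A by (simp add: powr_numeral)
    moreover have "2 * (- (real CARD('k) + 1) / 2) = - real (CARD('k) + 1)" by simp
    ultimately have "(det A)\<^sup>2 powr (- (real CARD('k) + 1) / 2) = \<bar>det A\<bar> powr (- real (CARD('k) + 1))"
      by (simp only: powr_powr)
    then show ?thesis
      by (simp add: det_congruence powr_mult ennreal_mult del: of_nat_add)
  qed
  have "(\<integral>\<^sup>+S. f S \<partial>pd_haar) = ennreal (\<bar>det A\<bar> ^ (CARD('k) + 1))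
      * (\<integral>\<^sup>+S. ?w (A ** S ** transpose A) * f (A ** S ** transpose A) \<partial>lborel_pd)"
    by (subst nn_integral_pd_haar, measurable, subst lborel_pd_congruence[OF A]) auto
  also have "(\<integral>\<^sup>+S. ?w (A ** S ** transpose A) * f (A ** S ** transpose A) \<partial>lborel_pd)
      = (\<integral>\<^sup>+S. ?c * (?w S * f (A ** S ** transpose A)) \<partial>lborel_pd)"
    by (intro nn_integral_cong) (simp only: space_lborel_pd mem_Collect_eq w mult.assoc)
  also have "\<dots> = ?c * (\<integral>\<^sup>+S. ?w S * f (A ** S ** transpose A) \<partial>lborel_pd)"
    by (rule nn_integral_cmult, rule measurable_lborel_pd) measurable
  also have "(\<integral>\<^sup>+S. ?w S * f (A ** S ** transpose A) \<partial>lborel_pd)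
      = (\<integral>\<^sup>+S. f (A ** S ** transpose A) \<partial>pd_haar)"
    by (subst nn_integral_pd_haar) auto
  finally show ?thesis
    using A powr_neg_card_cancel[of "\<bar>det A\<bar>" "CARD('k) + 1"]
        by (simp add: mult.assoc[symmetric] del: of_nat_add power_Suc)
qed

lemma AE_gl_haar: "AE g in gl_haar. det g \<noteq> 0"
  unfolding gl_haar_def by (subst AE_density) auto

text \<open>Both sides equal the integral of \<open>\<phi> S * H (g' S^-1 g)\<close> over \<open>S\<close> and \<open>g\<close>. For fixed \<open>S = A A'\<close>, left
invariance allows the substitution of \<open>A g\<close> for \<open>g\<close>, after which \<open>H\<close> has the argument \<open>g' g\<close> and the
left-hand side splits off. For fixed \<open>g\<close>, substituting \<open>g S g'\<close> for \<open>S\<close> gives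
\<open>\<phi> (g S g') * H (S^-1)\<close>, and right invariance then replaces \<open>g S g'\<close> by \<open>g g'\<close>.\<close>

lemma haar_duality:
  fixes \<phi> H :: "real^'k^'k \<Rightarrow> ennreal"
  assumes [measurable]: "\<phi> \<in> borel_measurable borel" "H \<in> borel_measurable borel"
  shows "(\<integral>\<^sup>+S. \<phi> S \<partial>pd_haar) * (\<integral>\<^sup>+g. H (transpose g ** g) \<partial>gl_haar)
    = (\<integral>\<^sup>+g. \<phi> (g ** transpose g) \<partial>gl_haar) * (\<integral>\<^sup>+S. H (matrix_inv S) \<partial>pd_haar)"
proof -
  let ?J = "\<integral>\<^sup>+S. \<phi> S \<partial>pd_haar" and ?MH = "\<integral>\<^sup>+g. H (transpose g ** g) \<partial>gl_haar"
  let ?M = "\<integral>\<^sup>+g. \<phi> (g ** transpose g) \<partial>gl_haar"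
  interpret P: sigma_finite_measure "pd_haar :: (real^'k^'k) measure" by (rule sigma_finite_pd_haar)
  interpret G: sigma_finite_measure "gl_haar :: (real^'k^'k) measure" by (rule sigma_finite_gl_haar)
  interpret pair_sigma_finite "pd_haar :: (real^'k^'k) measure" "gl_haar :: (real^'k^'k) measure" ..
  have id: "(\<lambda>x. x) \<in> measurable pd_haar (borel :: (real^'k^'k) measure)"
    by (subst measurable_cong_sets[OF sets_pd_haar refl]) (rule measurable_restrict_space1, simp)
  have fst [measurable]: "fst \<in> borel_measurable
      ((pd_haar :: (real^'k^'k) measure) \<Otimes>\<^sub>M (gl_haar :: (real^'k^'k) measure))"
    using measurable_compose[OF measurable_fst id] .
  have snd [measurable]: "snd \<in> borel_measurable
      ((pd_haar :: (real^'k^'k) measure) \<Otimes>\<^sub>M (gl_haar :: (real^'k^'k) measure))"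
    using measurable_snd by (simp cong: measurable_cong_sets)
  have mP: "f \<in> measurable borel N \<Longrightarrow> f \<in> measurable (pd_haar :: (real^'k^'k) measure) N"
      for f :: "real^'k^'k \<Rightarrow> 'b" and N
    using measurable_compose[OF id] .
  have "?J * ?MH
    = (\<integral>\<^sup>+S. (\<integral>\<^sup>+g. \<phi> S * H (transpose g ** g) \<partial>gl_haar) \<partial>pd_haar)"
  proof -
    have "(\<integral>\<^sup>+S. (\<integral>\<^sup>+g. \<phi> S * H (transpose g ** g) \<partial>gl_haar) \<partial>pd_haar) = (\<integral>\<^sup>+S. \<phi> S * ?MH \<partial>pd_haar)"
      by (intro nn_integral_cong nn_integral_cmult) measurable
    also have "\<dots> = ?J * ?MH"
      by (intro nn_integral_multc mP) measurable
    finally show ?thesis ..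
  qed
  also have "\<dots> = (\<integral>\<^sup>+S. (\<integral>\<^sup>+g. \<phi> S * H (transpose g ** matrix_inv S ** g) \<partial>gl_haar) \<partial>pd_haar)"
  proof (rule nn_integral_cong)
    fix S :: "real^'k^'k" assume "S \<in> space pd_haar"
    then have "pos_def S" by (simp add: space_pd_haar)
    then obtain A where A: "det A \<noteq> 0" "S = A ** transpose A" by (rule pos_def_factor)
    have A': "det (matrix_inv A) \<noteq> 0" using A by (simp add: det_matrix_inv)
    have eq: "transpose (matrix_inv A ** g) ** (matrix_inv A ** g) = transpose g ** matrix_inv S ** g"
        for g :: "real^'k^'k"
      unfolding A(2) matrix_inv_mult_transpose[OF A(1)] by (simp add: matrix_transpose_mul matrix_mul_assoc)
    show "(\<integral>\<^sup>+g. \<phi> S * H (transpose g ** g) \<partial>gl_haar)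
        = (\<integral>\<^sup>+g. \<phi> S * H (transpose g ** matrix_inv S ** g) \<partial>gl_haar)"
      using gl_haar_left_mult[OF A', of "\<lambda>g. \<phi> S * H (transpose g ** g)"] unfolding eq by simp
  qed
  also have "\<dots> = (\<integral>\<^sup>+g. (\<integral>\<^sup>+S. \<phi> S * H (transpose g ** matrix_inv S ** g) \<partial>pd_haar) \<partial>gl_haar)"
    by (rule Fubini'[symmetric]) measurable
  also have "\<dots> = (\<integral>\<^sup>+g. (\<integral>\<^sup>+S. \<phi> (g ** S ** transpose g) * H (matrix_inv S) \<partial>pd_haar) \<partial>gl_haar)"
    using AE_gl_haar
  proof (intro nn_integral_cong_AE, eventually_elim)
    fix g :: "real^'k^'k" assume g: "det g \<noteq> 0"
    have "transpose g ** matrix_inv (g ** S ** transpose g) ** g = matrix_inv S" if "pos_def S" for S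
    proof -
      have S: "det S \<noteq> 0" using pos_def_det[OF that] by simp
      have "transpose g ** matrix_inv (g ** S ** transpose g) ** g
        = (transpose g ** matrix_inv (transpose g)) ** matrix_inv S ** (matrix_inv g ** g)"
        using g S by (simp add: matrix_inv_prod det_mul matrix_mul_assoc)
      then show ?thesis using g by (simp add: matrix_inv_mult)
    qed
    then have "(\<integral>\<^sup>+S. \<phi> (g ** S ** transpose g) * H (matrix_inv S) \<partial>pd_haar)
       = (\<integral>\<^sup>+S. \<phi> (g ** S ** transpose g) * H (transpose g ** matrix_inv (g ** S ** transpose g) ** g)
           \<partial>pd_haar)"
      by (intro nn_integral_cong) (simp add: space_pd_haar)
    also have "\<dots> = (\<integral>\<^sup>+S. \<phi> S * H (transpose g ** matrix_inv S ** g) \<partial>pd_haar)"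
      by (rule pd_haar_congruence[OF g, of "\<lambda>S. \<phi> S * H (transpose g ** matrix_inv S ** g)"]) measurable
    finally show "(\<integral>\<^sup>+S. \<phi> S * H (transpose g ** matrix_inv S ** g) \<partial>pd_haar)
        = (\<integral>\<^sup>+S. \<phi> (g ** S ** transpose g) * H (matrix_inv S) \<partial>pd_haar)" ..
  qed
  also have "\<dots> = (\<integral>\<^sup>+S. (\<integral>\<^sup>+g. \<phi> (g ** S ** transpose g) * H (matrix_inv S) \<partial>gl_haar) \<partial>pd_haar)"
    by (rule Fubini') measurable
  also have "\<dots> = (\<integral>\<^sup>+S. ?M * H (matrix_inv S) \<partial>pd_haar)"
  proof (rule nn_integral_cong)
    fix S :: "real^'k^'k" assume "S \<in> space pd_haar"
    then have "pos_def S" by (simp add: space_pd_haar)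
    then obtain A where A: "det A \<noteq> 0" "S = A ** transpose A" by (rule pos_def_factor)
    have "(\<integral>\<^sup>+g. \<phi> (g ** S ** transpose g) * H (matrix_inv S) \<partial>gl_haar)
        = (\<integral>\<^sup>+g. \<phi> (g ** S ** transpose g) \<partial>gl_haar) * H (matrix_inv S)"
      by (rule nn_integral_multc) measurable
    also have "(\<integral>\<^sup>+g. \<phi> (g ** S ** transpose g) \<partial>gl_haar)
        = (\<integral>\<^sup>+g. \<phi> ((g ** A) ** transpose (g ** A)) \<partial>gl_haar)"
      unfolding A(2) by (simp add: matrix_transpose_mul matrix_mul_assoc)
    also have "\<dots> = ?M"
      by (rule gl_haar_right_mult[OF A(1), of "\<lambda>g. \<phi> (g ** transpose g)"]) measurable
    finally show "(\<integral>\<^sup>+g. \<phi> (g ** S ** transpose g) * H (matrix_inv S) \<partial>gl_haar) = ?M * H (matrix_inv S)" .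
  qed
  also have "\<dots> = ?M * (\<integral>\<^sup>+S. H (matrix_inv S) \<partial>pd_haar)"
    by (intro nn_integral_cmult mP) measurable
  finally show ?thesis .
qed

section \<open>Finiteness of the inverse Wishart integral\<close>

lemma measurable_inv_wishart_kernel [measurable]:
  "inv_wishart_kernel d S \<in> borel_measurable borel"
  unfolding inv_wishart_kernel_def[abs_def] by measurable

lemma inv_wishart_kernel_nonneg [simp]: "0 \<le> inv_wishart_kernel d S \<Sigma>"
  by (simp add: inv_wishart_kernel_def)

lemma inv_wishart_kernel_pos: "pos_def \<Sigma> \<Longrightarrow> 0 < inv_wishart_kernel d S \<Sigma>"
  using pos_def_det[of \<Sigma>] by (simp add: inv_wishart_kernel_def)

lemma trace_mult_transpose_self: "trace (transpose g ** g) = (norm g)\<^sup>2" for g :: "real^'k^'k"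
proof -
  have "trace (transpose g ** g) = (\<Sum>i\<in>UNIV. \<Sum>j\<in>UNIV. g $ j $ i * g $ j $ i)"
    by (simp add: trace_def matrix_matrix_mult_def transpose_def)
  also have "\<dots> = g \<bullet> g" by (subst sum.swap) (simp add: inner_vec_def)
  finally show ?thesis by (simp add: power2_norm_eq_inner)
qed

lemma lborel_sym_ball_finite: "(\<integral>\<^sup>+S. indicator {S :: real^'k^'k. norm S < R} S \<partial>lborel_sym) < \<infinity>"
proof -
  have "(\<integral>\<^sup>+S. indicator {S :: real^'k^'k. norm S < R} S \<partial>lborel_sym)
    \<le> (\<integral>\<^sup>+S. ennreal (exp (R\<^sup>2)) * gauss 1 (S :: real^'k^'k) \<partial>lborel_sym)"
  proof (intro nn_integral_mono)
    fix S :: "real^'k^'k"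
    have "(norm S)\<^sup>2 \<le> R\<^sup>2" if "norm S < R" using that by (intro power_mono) auto
    then show "indicator {S. norm S < R} S \<le> ennreal (exp (R\<^sup>2)) * gauss 1 S"
      by (auto simp: indicator_def ennreal_mult[symmetric] exp_add[symmetric])
  qed
  also have "\<dots> = ennreal (exp (R\<^sup>2)) * (\<integral>\<^sup>+S. gauss 1 (S :: real^'k^'k) \<partial>lborel_sym)"
    by (rule nn_integral_cmult) measurable
  also have "\<dots> < \<infinity>"
    using lborel_sym_gauss_finite[of 1, where 'a='k] by (simp add: ennreal_mult_less_top)
  finally show ?thesis .
qed

text \<open>Duality, with \<open>H\<close> such that the integral of \<open>H (S^-1)\<close> is the one in question and with the
indicator \<open>\<phi>\<close> of a bounded set on which the determinant stays away from 0. This \<open>\<phi>\<close> has a finite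
integral over the positive definite matrices and a positive one over the invertible matrices, and
\<open>H\<close> contributes the moment of order \<open>d - 2 k - 1\<close> of a Gaussian determinant. The order exceeds
\<open>-1\<close> exactly if \<open>d > 2 k\<close>.\<close>

lemma inv_wishart_kernel_one_finite:
  fixes d :: real
  assumes d: "2 * real CARD('k) < d"
  shows "(\<integral>\<^sup>+\<Sigma>. ennreal (inv_wishart_kernel d (mat 1 :: real^'k^'k) \<Sigma>) \<partial>lborel_pd) < \<infinity>"
proof -
  let ?k = "real CARD('k)"
  \<comment> \<open>The set must contain a neighbourhood of the identity, to have positive measure.\<close>
  define R where "R = norm (mat 1 :: real^'k^'k) + 1"
  define \<phi> :: "real^'k^'k \<Rightarrow> ennreal" where "\<phi> = indicator {S. norm S < R \<and> 1/2 < det S}"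
  define H :: "real^'k^'k \<Rightarrow> ennreal" where "H B
      = ennreal (det B powr ((d - ?k - 1) / 2) * exp (- (1/2) * trace B))" for B
  have [measurable]: "\<phi> \<in> borel_measurable borel" "H \<in> borel_measurable borel"
    unfolding \<phi>_def H_def[abs_def] by measurable
  have Z: "(\<integral>\<^sup>+S. H (matrix_inv S) \<partial>pd_haar) =
      (\<integral>\<^sup>+\<Sigma>. ennreal (inv_wishart_kernel d (mat 1 :: real^'k^'k) \<Sigma>) \<partial>lborel_pd)"
  proof (subst nn_integral_pd_haar, measurable, rule nn_integral_cong)
    fix S :: "real^'k^'k" assume "S \<in> space lborel_pd"
    then have S: "0 < det S" using pos_def_det by simp
    have "inverse (det S) powr ((d - ?k - 1) / 2) = det S powr (- ((d - ?k - 1) / 2))"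
      using S by (simp only: inverse_powr powr_minus less_imp_le)
    moreover have "- (?k + 1) / 2 + - ((d - ?k - 1) / 2) = - d / 2" by (simp add: field_simps)
    ultimately have "det S powr (- (?k + 1) / 2) * inverse (det S) powr ((d - ?k - 1) / 2)
        = det S powr (- d / 2)"
      by (simp only: powr_add[symmetric])
    then show "ennreal (det S powr (- (?k + 1) / 2)) * H (matrix_inv S)
        = ennreal (inv_wishart_kernel d (mat 1) S)"
      using S by (simp add: H_def det_matrix_inv inv_wishart_kernel_def ennreal_mult[symmetric]
          mult.assoc[symmetric])
  qed
  have MH: "(\<integral>\<^sup>+g. H (transpose g ** g) \<partial>gl_haar) < \<infinity>"
  proof -
    have "(\<integral>\<^sup>+g. H (transpose g ** g) \<partial>gl_haar)
      = (\<integral>\<^sup>+g. ennreal (\<bar>det (g :: real^'k^'k)\<bar> powr (d - 2 * ?k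
          - 1) * exp (- (1/2) * (norm g)\<^sup>2)) \<partial>lborel)"
    proof (subst nn_integral_gl_haar, measurable, rule nn_integral_cong)
      fix g :: "real^'k^'k"
      show "ennreal (\<bar>det g\<bar> powr (- ?k)) * H (transpose g ** g)
          = ennreal (\<bar>det g\<bar> powr (d - 2 * ?k - 1) * exp (- (1/2) * (norm g)\<^sup>2))"
      proof (cases "det g = 0")
        case False
        have half: "2 * ((d - ?k - 1) / 2) = d - ?k - 1" by simp
        have "det (transpose g ** g) = \<bar>det g\<bar> powr 2"
          using False
          by (simp add: det_mul powr_numeral power2_eq_square)
        then have "det (transpose g ** g) powr ((d - ?k - 1) / 2) = \<bar>det g\<bar> powr (d - ?k - 1)"
          using half by (simp only: powr_powr)
        moreover have "\<bar>det g\<bar> powr (- ?k) * \<bar>det g\<bar> powr (d - ?k - 1) = \<bar>det g\<bar> powr (d - 2 * ?k - 1)"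
          by (simp add: powr_add[symmetric] algebra_simps)
        ultimately show ?thesis
          by (simp add: H_def trace_mult_transpose_self ennreal_mult[symmetric] mult.assoc[symmetric])
      qed simp
    qed
    also have "\<dots> < \<infinity>" using d by (intro det_gauss_moment_finite) simp
    finally show ?thesis .
  qed
  have J: "(\<integral>\<^sup>+S. \<phi> S \<partial>pd_haar) < \<infinity>"
  proof -
    let ?C = "(1/2 :: real) powr (- (?k + 1) / 2)"
    have "(\<integral>\<^sup>+S. \<phi> S \<partial>pd_haar) = (\<integral>\<^sup>+S. ennreal (det (S :: real^'k^'k) powr (- (?k + 1) / 2)) * \<phi> S
        * indicator {S. pos_def S} S \<partial>lborel_sym)"
      by (subst nn_integral_pd_haar) (measurable, simp add: nn_integral_lborel_pd)
    also have "\<dots> \<le> (\<integral>\<^sup>+S. ennreal ?C * indicator {S :: real^'k^'k. norm S < R} S \<partial>lborel_sym)"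
    proof (intro nn_integral_mono)
      fix S :: "real^'k^'k"
      show "ennreal (det S powr (- (?k + 1) / 2)) * \<phi> S * indicator {S. pos_def S} S
          \<le> ennreal ?C * indicator {S. norm S < R} S"
        by (auto simp: \<phi>_def indicator_def intro!: ennreal_leI powr_mono2')
    qed
    also have "\<dots> = ennreal ?C * (\<integral>\<^sup>+S. indicator {S :: real^'k^'k. norm S < R} S \<partial>lborel_sym)"
      by (rule nn_integral_cmult) measurable
    also have "\<dots> < \<infinity>" using lborel_sym_ball_finite[of R, where 'k='k] by (simp add: ennreal_mult_less_top)
    finally show ?thesis .
  qed
  have M: "(\<integral>\<^sup>+g. \<phi> (g ** transpose g) \<partial>gl_haar) \<noteq> 0"
  proof
    define U where "U = {g :: real^'k^'k. norm (g ** transpose g) < R \<and> 1/2 < det (g ** transpose g)}"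
    assume "(\<integral>\<^sup>+g. \<phi> (g ** transpose g) \<partial>gl_haar) = 0"
    then have "(\<integral>\<^sup>+g. ennreal (\<bar>det (g :: real^'k^'k)\<bar> powr (- ?k)) * \<phi> (g ** transpose g) \<partial>lborel) = 0"
      by (subst (asm) nn_integral_gl_haar) auto
    then have "AE g in lborel. ennreal (\<bar>det (g :: real^'k^'k)\<bar> powr (- ?k)) * \<phi> (g ** transpose g) = 0"
      by (subst (asm) nn_integral_0_iff_AE) auto
    then have "AE g in lborel. g \<notin> U"
      by eventually_elim (auto simp: U_def \<phi>_def det_mul indicator_def split: if_splits)
    moreover have "open U"
      unfolding U_def det_mul det_transpose det_def matrix_matrix_mult_def transpose_def
      by (intro open_Collect_conj open_Collect_less continuous_intros)
    moreover from this have "U \<in> sets lborel" by simp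
    ultimately have "U \<in> null_sets lborel" by (simp add: AE_iff_null_sets)
    then have "negligible U" using null_sets_completionI negligible_iff_null_sets by blast
    moreover have "mat 1 \<in> U" by (simp add: U_def R_def transpose_mat)
    ultimately show False using open_not_negligible[OF \<open>open U\<close>] by blast
  qed
  have "(\<integral>\<^sup>+g. \<phi> (g ** transpose g) \<partial>gl_haar)
      * (\<integral>\<^sup>+\<Sigma>. ennreal (inv_wishart_kernel d (mat 1 :: real^'k^'k) \<Sigma>) \<partial>lborel_pd) < \<infinity>"
  proof -
    have "(\<integral>\<^sup>+S. \<phi> S \<partial>pd_haar) * (\<integral>\<^sup>+g. H (transpose g ** g) \<partial>gl_haar) < \<infinity>"
      using J MH by (simp add: ennreal_mult_less_top)
    moreover have "(\<integral>\<^sup>+S. \<phi> S \<partial>pd_haar) * (\<integral>\<^sup>+g. H (transpose g ** g) \<partial>gl_haar)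
      = (\<integral>\<^sup>+g. \<phi> (g ** transpose g) \<partial>gl_haar) * (\<integral>\<^sup>+S. H (matrix_inv S) \<partial>pd_haar)"
      by (rule haar_duality) measurable
    ultimately show ?thesis unfolding Z by (simp only:)
  qed
  then show ?thesis using M by (auto simp: ennreal_mult_less_top less_top[symmetric])
qed

lemma lborel_sym_translation:
  fixes Y :: "real^'k^'k"
  assumes "transpose Y = Y" "f \<in> borel_measurable borel"
  shows "(\<integral>\<^sup>+S. f (S + Y) \<partial>lborel_sym) = (\<integral>\<^sup>+S. f S \<partial>lborel_sym)"
proof -
  have "Y \<in> span (sym_basis ` (index_pairs :: 'k set set))"
    unfolding span_sym_basis using assms(1) by simp
  then show ?thesis
    unfolding lborel_sym_eq_coord_measure
    using assms(2) by (intro coord_measure_translation) simp_all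
qed

text \<open>Every symmetric matrix becomes positive definite when a large multiple of the identity is added. If
the positive definite matrices formed a null set, countably many of its translates would therefore
cover the symmetric matrices.\<close>

lemma emeasure_lborel_pd_nonzero: "\<not> (AE S in (lborel_pd :: (real^'k^'k) measure). False)"
proof
  assume "AE S in (lborel_pd :: (real^'k^'k) measure). False"
  then have null: "AE S in lborel_sym. \<not> pos_def (S :: real^'k^'k)"
    unfolding lborel_pd_def by (subst (asm) AE_restrict_space_iff) auto
  have "AE S in lborel_sym. \<not> pos_def (S + real n *\<^sub>R mat 1 :: real^'k^'k)" for n
  proof -
    let ?f = "\<lambda>S :: real^'k^'k. indicator {S. pos_def S} S :: ennreal"
    have "(\<integral>\<^sup>+S. ?f (S + real n *\<^sub>R mat 1 :: real^'k^'k) \<partial>lborel_sym) = (\<integral>\<^sup>+S. ?f S \<partial>lborel_sym)"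
      by (rule lborel_sym_translation) (simp_all add: transpose_def mat_def vec_eq_iff)
    also have "\<dots> = 0"
      using null by (subst nn_integral_0_iff_AE) (auto elim!: eventually_mono)
    finally have "AE S in lborel_sym. ?f (S + real n *\<^sub>R mat 1) = 0"
      by (subst (asm) nn_integral_0_iff_AE) auto
    then show ?thesis by eventually_elim (auto simp: indicator_def split: if_splits)
  qed
  then have "AE S in lborel_sym. \<forall>n. \<not> pos_def (S + real n *\<^sub>R mat 1 :: real^'k^'k)"
    by (subst AE_all_countable) auto
  moreover have "AE S in lborel_sym. S \<in> span (sym_basis ` index_pairs)"
    unfolding lborel_sym_eq_coord_measure by (rule AE_coord_measure_span)
  ultimately have "AE S in (lborel_sym :: (real^'k^'k) measure). False"
  proof eventually_elim
    fix S :: "real^'k^'k"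
    assume np: "\<forall>n. \<not> pos_def (S + real n *\<^sub>R mat 1)" and "S \<in> span (sym_basis ` index_pairs)"
    then have S: "transpose S = S" unfolding span_sym_basis by simp
    obtain K where K: "0 < K" "\<And>v. norm (S *v v) \<le> norm v * K"
      using bounded_linear.pos_bounded[OF matrix_vector_mul_bounded_linear[of S]] by blast
    obtain n where n: "K < real n" using reals_Archimedean2 by blast
    have "pos_def (S + real n *\<^sub>R mat 1)"
      unfolding pos_def_def
    proof (intro conjI allI impI)
      show "transpose (S + real n *\<^sub>R mat 1) = S + real n *\<^sub>R mat 1"
        using S by (simp add: vec_eq_iff transpose_def mat_def)
      fix v :: "real^'k" assume v: "v \<noteq> 0"
      have "\<bar>v \<bullet> (S *v v)\<bar> \<le> norm v * norm (S *v v)" by (rule Cauchy_Schwarz_ineq2)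
      also have "\<dots> \<le> norm v * (norm v * K)" by (intro mult_left_mono K) auto
      also have "\<dots> < norm v * (norm v * real n)" using n v by (intro mult_strict_left_mono) auto
      also have "\<dots> = real n * (v \<bullet> v)" by (simp add: dot_square_norm power2_eq_square)
      finally show "0 < v \<bullet> ((S + real n *\<^sub>R mat 1) *v v)"
        by (simp add: matrix_vector_mult_add_rdistrib scaleR_matrix_vector_assoc[symmetric] inner_add_right)
    qed
    then show False using np by blast
  qed
  then have "(\<integral>\<^sup>+S. gauss 1 (S :: real^'k^'k) \<partial>lborel_sym) = 0"
    by (subst nn_integral_0_iff_AE) (auto elim!: eventually_mono)
  moreover have "0 < (\<integral>\<^sup>+S. gauss 1 (S :: real^'k^'k) \<partial>lborel_sym)"
    unfolding lborel_sym_eq_coord_measure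
    by (rule coord_measure_gauss_finite[OF _ _ sym_basis_nonzero sym_basis_orthogonal]) auto
  ultimately show False by simp
qed

lemma congruence_measurable_lborel_pd:
  fixes A :: "real^'k^'k"
  assumes A: "det A \<noteq> 0"
  shows "(\<lambda>S. A ** S ** transpose A) \<in> measurable lborel_pd lborel_pd"
proof -
  have "(\<lambda>S. A ** S ** transpose A) \<in> measurable lborel_pd (restrict_space borel {S. pos_def S})"
    by (intro measurable_restrict_space2 measurable_lborel_pd) (auto simp: pos_def_congruence_iff[OF A])
  then show ?thesis by (subst measurable_cong_sets[OF refl sets_lborel_pd])
qed

text \<open>The change of variables as an identity of measures, so that it applies to matrix-valued integrands
as well.\<close>

lemma lborel_pd_eq_density_distr:
  fixes A :: "real^'k^'k"
  assumes A: "det A \<noteq> 0"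
  shows "lborel_pd = density (distr lborel_pd lborel_pd (\<lambda>S. A ** S ** transpose A))
      (\<lambda>_. ennreal (\<bar>det A\<bar> ^ (CARD('k) + 1)))"
proof (rule measure_eqI)
  fix X :: "(real^'k^'k) set" assume X: "X \<in> sets lborel_pd"
  then have [measurable]: "X \<in> sets borel"
    by (auto simp: sets_lborel_pd sets_restrict_space)
  have "emeasure lborel_pd X = (\<integral>\<^sup>+S. indicator X S \<partial>lborel_pd)" using X by simp
  also have "\<dots> = ennreal (\<bar>det A\<bar> ^ (CARD('k) + 1))
      * (\<integral>\<^sup>+S. indicator X (A ** S ** transpose A) \<partial>lborel_pd)"
    by (rule lborel_pd_congruence[OF A]) simp
  also have "(\<integral>\<^sup>+S. indicator X (A ** S ** transpose A) \<partial>lborel_pd)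
      = (\<integral>\<^sup>+S. indicator X S \<partial>distr lborel_pd lborel_pd (\<lambda>S. A ** S ** transpose A))"
    using X by (subst nn_integral_distr[OF congruence_measurable_lborel_pd[OF A]]) auto
  also have "\<dots> = emeasure (distr lborel_pd lborel_pd (\<lambda>S. A ** S ** transpose A)) X"
    using X by simp
  finally show "emeasure lborel_pd X = emeasure
      (density (distr lborel_pd lborel_pd (\<lambda>S. A ** S ** transpose A)) (\<lambda>_. ennreal (\<bar>det A\<bar> ^ (CARD('k)
      + 1)))) X"
    using X by (simp add: emeasure_density_const)
qed simp

lemma lborel_pd_congruence_integral:
  fixes A :: "real^'k^'k" and F :: "real^'k^'k \<Rightarrow> 'b::{banach, second_countable_topology}"
  assumes A: "det A \<noteq> 0" and F: "F \<in> borel_measurable borel"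
  shows "(\<integral>S. F S \<partial>lborel_pd) = \<bar>det A\<bar> ^ (CARD('k) + 1) *\<^sub>R (\<integral>S. F (A ** S ** transpose A) \<partial>lborel_pd)"
    and "integrable lborel_pd F \<Longrightarrow> integrable lborel_pd (\<lambda>S. F (A ** S ** transpose A))"
proof -
  let ?D = "distr lborel_pd lborel_pd (\<lambda>S. A ** S ** transpose A)"
  let ?c = "\<bar>det A\<bar> ^ (CARD('k) + 1)"
  have FD: "F \<in> borel_measurable ?D" "F \<in> borel_measurable lborel_pd" using measurable_lborel_pd[OF F]
      by simp_all
  have "(\<integral>S. F S \<partial>lborel_pd) = (\<integral>S. F S \<partial>density ?D (\<lambda>_. ennreal ?c))"
    by (subst lborel_pd_eq_density_distr[OF A]) simp
  also have "\<dots> = (\<integral>S. ?c *\<^sub>R F S \<partial>?D)"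
    using FD by (intro integral_density) auto
  also have "\<dots> = ?c *\<^sub>R (\<integral>S. F S \<partial>?D)" by simp
  also have "(\<integral>S. F S \<partial>?D) = (\<integral>S. F (A ** S ** transpose A) \<partial>lborel_pd)"
    by (rule integral_distr[OF congruence_measurable_lborel_pd[OF A] FD(2)])
  finally show "(\<integral>S. F S \<partial>lborel_pd) = ?c *\<^sub>R (\<integral>S. F (A ** S ** transpose A) \<partial>lborel_pd)" .
  assume "integrable lborel_pd F"
  then have "integrable (density ?D (\<lambda>_. ennreal ?c)) F"
    by (subst lborel_pd_eq_density_distr[OF A, symmetric])
  then have "integrable ?D (\<lambda>S. ?c *\<^sub>R F S)"
    using FD by (subst (asm) integrable_density) auto
  then have "integrable ?D (\<lambda>S. (1 / ?c) *\<^sub>R (?c *\<^sub>R F S))" by (rule integrable_scaleR_right)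
  moreover have "(\<lambda>S. (1 / ?c) *\<^sub>R (?c *\<^sub>R F S)) = F" using A by (simp del: power_Suc)
  ultimately have "integrable ?D F" by (simp only:)
  then show "integrable lborel_pd (\<lambda>S. F (A ** S ** transpose A))"
    by (rule integrable_distr[OF congruence_measurable_lborel_pd[OF A]])
qed

section \<open>The mean of the inverse of an inverse Wishart matrix\<close>

lemma inv_wishart_kernel_congruence:
  fixes A S \<Sigma> :: "real^'k^'k"
  assumes A: "det A \<noteq> 0" and \<Sigma>: "pos_def \<Sigma>"
  shows "inv_wishart_kernel d (A ** S ** transpose A) (A ** \<Sigma> ** transpose A)
    = \<bar>det A\<bar> powr (- d) * inv_wishart_kernel d S \<Sigma>"
proof -
  have d\<Sigma>: "0 < det \<Sigma>" using pos_def_det[OF \<Sigma>] .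
  have "(A ** S ** transpose A) ** matrix_inv (A ** \<Sigma> ** transpose A)
     = A ** S ** (transpose A ** matrix_inv (transpose A)) ** matrix_inv \<Sigma> ** matrix_inv A"
    using A d\<Sigma> by (simp add: matrix_inv_prod det_mul matrix_mul_assoc)
  also have "\<dots> = A ** (S ** matrix_inv \<Sigma> ** matrix_inv A)"
    using A by (simp add: matrix_inv_mult matrix_mul_assoc)
  finally have "trace ((A ** S ** transpose A) ** matrix_inv (A ** \<Sigma> ** transpose A))
      = trace (A ** (S ** matrix_inv \<Sigma> ** matrix_inv A))"
    by (rule arg_cong)
  also have "\<dots> = trace (S ** matrix_inv \<Sigma> ** matrix_inv A ** A)" by (rule trace_mul_sym)
  also have "S ** matrix_inv \<Sigma> ** matrix_inv A ** A = S ** matrix_inv \<Sigma> ** (matrix_inv A ** A)"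
    by (simp add: matrix_mul_assoc)
  finally have tr: "trace ((A ** S ** transpose A) ** matrix_inv (A ** \<Sigma> ** transpose A))
      = trace (S ** matrix_inv \<Sigma>)"
    using A by (simp add: matrix_inv_mult)
  have "(det A)\<^sup>2 = \<bar>det A\<bar> powr 2" using A by (simp add: powr_numeral)
  then have "(det A)\<^sup>2 powr (- d / 2) = \<bar>det A\<bar> powr (2 * (- d / 2))"
    by (simp only: powr_powr)
  then show ?thesis
    unfolding inv_wishart_kernel_def tr det_congruence powr_mult by simp
qed

lemma nn_integral_inv_wishart_kernel_congruence:
  fixes A S :: "real^'k^'k"
  assumes A: "det A \<noteq> 0" and [measurable]: "f \<in> borel_measurable borel"
  shows "(\<integral>\<^sup>+\<Sigma>. f \<Sigma> * ennreal (inv_wishart_kernel d (A ** S ** transpose A) \<Sigma>) \<partial>lborel_pd)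
    = ennreal (\<bar>det A\<bar> powr (real CARD('k) + 1 - d)) *
      (\<integral>\<^sup>+\<Sigma>. f (A ** \<Sigma> ** transpose A) * ennreal (inv_wishart_kernel d S \<Sigma>) \<partial>lborel_pd)"
proof -
  have "(\<integral>\<^sup>+\<Sigma>. f \<Sigma> * ennreal (inv_wishart_kernel d (A ** S ** transpose A) \<Sigma>) \<partial>lborel_pd)
    = ennreal (\<bar>det A\<bar> ^ (CARD('k) + 1)) * (\<integral>\<^sup>+\<Sigma>. f (A ** \<Sigma> ** transpose A)
        * ennreal (inv_wishart_kernel d (A ** S ** transpose A) (A ** \<Sigma> ** transpose A)) \<partial>lborel_pd)"
    by (rule lborel_pd_congruence[OF A]) measurable
  also have "(\<integral>\<^sup>+\<Sigma>. f (A ** \<Sigma> ** transpose A)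
      * ennreal (inv_wishart_kernel d (A ** S ** transpose A) (A ** \<Sigma> ** transpose A)) \<partial>lborel_pd)
    = (\<integral>\<^sup>+\<Sigma>. ennreal (\<bar>det A\<bar> powr (- d)) * (f (A ** \<Sigma> ** transpose A)
        * ennreal (inv_wishart_kernel d S \<Sigma>)) \<partial>lborel_pd)"
    by (intro nn_integral_cong) (simp add: inv_wishart_kernel_congruence[OF A] ennreal_mult mult_ac)
  also have "\<dots> = ennreal (\<bar>det A\<bar> powr (- d))
      * (\<integral>\<^sup>+\<Sigma>. f (A ** \<Sigma> ** transpose A) * ennreal (inv_wishart_kernel d S \<Sigma>) \<partial>lborel_pd)"
    by (intro nn_integral_cmult measurable_lborel_pd) measurable
  also have "ennreal (\<bar>det A\<bar> ^ (CARD('k) + 1)) * (ennreal (\<bar>det A\<bar> powr (- d)) * x)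
      = ennreal (\<bar>det A\<bar> powr (real CARD('k) + 1 - d)) * x" for x
  proof -
    have "\<bar>det A\<bar> ^ (CARD('k) + 1) = \<bar>det A\<bar> powr (real CARD('k) + 1)"
      using A powr_realpow[of "\<bar>det A\<bar>" "CARD('k) + 1"] by (simp add: add.commute)
    then have "\<bar>det A\<bar> ^ (CARD('k) + 1) * \<bar>det A\<bar> powr (- d) = \<bar>det A\<bar> powr (real CARD('k) + 1 - d)"
      by (simp only: powr_add[symmetric]) simp
    then show ?thesis by (simp add: mult.assoc[symmetric] ennreal_mult[symmetric] del: power_Suc)
  qed
  finally show ?thesis .
qed

lemma inv_wishart_kernel_finite:
  fixes S :: "real^'k^'k"
  assumes d: "2 * real CARD('k) < d" and S: "pos_def S"
  shows "(\<integral>\<^sup>+\<Sigma>. ennreal (inv_wishart_kernel d S \<Sigma>) \<partial>lborel_pd) < \<infinity>"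
proof -
  obtain A where A: "det A \<noteq> 0" "S = A ** transpose A" using S by (rule pos_def_factor)
  show ?thesis
    using nn_integral_inv_wishart_kernel_congruence[OF A(1), of "\<lambda>_. 1" d "mat 1"]
        inv_wishart_kernel_one_finite[OF d]
    by (simp add: A(2) ennreal_mult_less_top)
qed

lemma nn_integral_exp_decay:
  fixes y :: real
  assumes y: "0 < y"
  shows "(\<integral>\<^sup>+s. ennreal (y / 2 * exp (- (1/2) * ((s - 1) * y))) * indicator {1..2} s \<partial>lborel)
      = ennreal (1 - exp (- y / 2))"
proof -
  have "(\<integral>\<^sup>+s. ennreal (y / 2 * exp (- (1/2) * ((s - 1) * y))) * indicator {1..2} s \<partial>lborel)
    = ennreal ((- exp (- (1/2) * ((2 - 1) * y))) - (- exp (- (1/2) * ((1 - 1) * y))))"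
    using y by (intro nn_integral_FTC_Icc) (auto intro!: derivative_eq_intros)
  then show ?thesis by simp
qed

lemma nn_integral_powr_1_2:
  fixes a :: real
  assumes a: "0 < a"
  shows "(\<integral>\<^sup>+s. ennreal (s powr (- a - 1)) * indicator {1..2} s \<partial>lborel) = ennreal ((1 - 2 powr (- a)) / a)"
proof -
  have "(\<integral>\<^sup>+s. ennreal (s powr (- a - 1)) * indicator {1..2} s \<partial>lborel)
    = ennreal ((- (2 powr (- a)) / a) - (- (1 powr (- a)) / a))"
    using a by (intro nn_integral_FTC_Icc) (auto intro!: derivative_eq_intros)
  then show ?thesis by (simp add: diff_divide_distrib)
qed

definition stretch :: "'k::finite \<Rightarrow> real \<Rightarrow> real^'k^'k" where
  "stretch i s = (\<chi> a b. if a = b then (if a = i then s else 1) else 0)"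

lemma det_stretch [simp]: "det (stretch i s) = s"
proof -
  have "det (stretch i s) = (\<Prod>a\<in>UNIV. if a = i then s else 1)"
    by (subst det_diagonal) (auto simp: stretch_def)
  then show ?thesis by simp
qed

lemma transpose_stretch [simp]: "transpose (stretch i s) = stretch i s"
  by (auto simp: stretch_def transpose_def vec_eq_iff)

lemma stretch_mult: "stretch i s ** stretch i t = stretch i (s * t)"
proof -
  have "(stretch i s ** stretch i t) $ a = stretch i s $ a $ a *\<^sub>R (stretch i t $ a)" for a
    by (rule diag_mult_row) (simp add: stretch_def)
  then show ?thesis by (auto simp: vec_eq_iff stretch_def)
qed

lemma stretch_1 [simp]: "stretch i 1 = mat 1"
  by (simp add: stretch_def mat_def vec_eq_iff)

lemma matrix_inv_stretch: "s \<noteq> 0 \<Longrightarrow> matrix_inv (stretch i s) = stretch i (1 / s)"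
  by (rule matrix_inv_eqI) (simp add: stretch_mult)

lemma stretch_congruence_component:
  "(stretch i s ** B ** stretch i s) $ a $ b = (if a = i then s else 1) * (if b = i then s else 1)
      * B $ a $ b"
proof -
  have 1: "(stretch i s ** C) $ a = stretch i s $ a $ a *\<^sub>R (C $ a)" for C :: "real^'a^'a" and a
    by (rule diag_mult_row) (simp add: stretch_def)
  have 2: "(C ** transpose (stretch i s)) $ a $ b = stretch i s $ b $ b * C $ a $ b" for C :: "real^'a^'a"
    unfolding mult_transpose_row by (rule matrix_mult_diag_component) (simp add: stretch_def)
  show ?thesis using 2[of "stretch i s ** B"] by (simp add: 1) (simp add: stretch_def)
qed

lemma trace_stretch_mult: "trace (stretch i s ** B) = trace B + (s - 1) * B $ i $ i"
proof -
  have 1: "(stretch i s ** B) $ a = stretch i s $ a $ a *\<^sub>R (B $ a)" for a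
    by (rule diag_mult_row) (simp add: stretch_def)
  have 2: "(stretch i s ** B) $ a $ a = (if a = i then s else 1) * B $ a $ a" for a
    by (simp add: 1) (simp add: stretch_def)
  have "trace (stretch i s ** B) = (\<Sum>a\<in>UNIV. B $ a $ a + (if a = i then (s - 1) * B $ a $ a else 0))"
    unfolding trace_def by (intro sum.cong) (auto simp: 2 algebra_simps)
  then show ?thesis by (simp add: sum.distrib trace_def)
qed

lemma matrix_inv_stretch_congruence:
  fixes \<Sigma> :: "real^'k^'k"
  assumes "s \<noteq> 0" "det \<Sigma> \<noteq> 0"
  shows "matrix_inv (stretch i s ** \<Sigma> ** stretch i s)
      = stretch i (1 / s) ** matrix_inv \<Sigma> ** stretch i (1 / s)"
  using assms by (simp add: matrix_inv_prod det_mul matrix_inv_stretch matrix_mul_assoc)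

text \<open>Let \<open>b\<close> be the \<open>i\<close>-th diagonal entry of \<open>\<Sigma>^-1\<close> and \<open>Z\<close> the integral of the kernel. The scale matrix
\<open>stretch i s\<close> multiplies the kernel by \<open>exp (- (s - 1) * b / 2)\<close> and, by congruence, its integral
by \<open>s powr (- \<alpha>)\<close> with \<open>\<alpha> = (d - k - 1) / 2\<close>. Comparing derivatives at \<open>s = 1\<close> gives the claim.
To avoid differentiation under the integral, the derivatives are integrated over \<open>s\<close> in \<open>{1..2}\<close>
and Tonelli's theorem is used, which shows the moment to be finite at the same time.\<close>

lemma inv_wishart_diag_moment:
  fixes d :: real and i :: "'k::finite"
  assumes d: "2 * real CARD('k) < d"
  shows "(\<integral>\<^sup>+\<Sigma>. ennreal (matrix_inv \<Sigma> $ i $ i)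
      * ennreal (inv_wishart_kernel d (mat 1 :: real^'k^'k) \<Sigma>) \<partial>lborel_pd)
    = ennreal (d - real CARD('k) - 1) * (\<integral>\<^sup>+\<Sigma>. ennreal (inv_wishart_kernel d (mat 1 :: real^'k^'k) \<Sigma>)
        \<partial>lborel_pd)"
proof -
  let ?K = "\<lambda>S \<Sigma>. inv_wishart_kernel d (S :: real^'k^'k) \<Sigma>"
  define \<alpha> where "\<alpha> = (d - real CARD('k) - 1) / 2"
  \<comment> \<open>As \<open>k \<ge> 1\<close>, the assumption on \<open>d\<close> makes the exponent \<open>\<alpha>\<close> positive.\<close>
  define \<kappa> where "\<kappa> = real CARD('k)"
  have k1: "1 \<le> \<kappa>" "2 * \<kappa> < d" using d by (simp_all add: \<kappa>_def Suc_leI)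
  then have "0 < d - \<kappa> - 1" by linarith
  then have \<alpha>: "\<alpha> > 0" and \<alpha>': "0 \<le> d - real CARD('k) - 1"
    by (simp_all add: \<alpha>_def \<kappa>_def)
  let ?b = "\<lambda>\<Sigma> :: real^'k^'k. matrix_inv \<Sigma> $ i $ i"
  let ?D = "\<lambda>s (\<Sigma> :: real^'k^'k). stretch i (sqrt s) ** \<Sigma> ** stretch i (sqrt s)"
  define T where "T = (\<integral>\<^sup>+\<Sigma>. ennreal (?b \<Sigma>) * ennreal (?K (mat 1) \<Sigma>) \<partial>lborel_pd)"
  define Z where "Z = (\<integral>\<^sup>+\<Sigma>. ennreal (?K (mat 1) \<Sigma>) \<partial>lborel_pd)"
  have Kst: "?K (stretch i s) \<Sigma> = ?K (mat 1) \<Sigma> * exp (- (1/2) * ((s - 1) * ?b \<Sigma>))" for s \<Sigma>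
    by (simp add: inv_wishart_kernel_def trace_stretch_mult exp_add[symmetric] algebra_simps)
  have scal: "(\<integral>\<^sup>+\<Sigma>. f \<Sigma> * ennreal (?K (stretch i s) \<Sigma>) \<partial>lborel_pd)
     = ennreal (s powr (- \<alpha>)) * (\<integral>\<^sup>+\<Sigma>. f (?D s \<Sigma>) * ennreal (?K (mat 1) \<Sigma>) \<partial>lborel_pd)"
    if s: "s > 0" and f: "f \<in> borel_measurable borel" for s f
  proof -
    have "1/2 * (real CARD('k) + 1 - d) = - \<alpha>" by (simp add: \<alpha>_def field_simps)
    moreover have "sqrt s = s powr (1/2)" using s by (simp add: powr_half_sqrt)
    ultimately have "sqrt s powr (real CARD('k) + 1 - d) = s powr (- \<alpha>)"
      by (simp only: powr_powr)
    then show ?thesis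
      using nn_integral_inv_wishart_kernel_congruence[of "stretch i (sqrt s)" f d "mat 1"] s f
      by (simp add: stretch_mult)
  qed
  have Zs: "(\<integral>\<^sup>+\<Sigma>. ennreal (?K (stretch i s) \<Sigma>) \<partial>lborel_pd) = ennreal (s powr (- \<alpha>)) * Z" if "s > 0" for s
    using scal[OF that, of "\<lambda>_. 1"] by (simp add: Z_def)
  have Ts: "(\<integral>\<^sup>+\<Sigma>. ennreal (?b \<Sigma> / 2) * ennreal (?K (stretch i s) \<Sigma>) \<partial>lborel_pd)
      = ennreal (s powr (- \<alpha> - 1)) * (T / 2)" if s: "s > 0" for s
  proof -
    have "(\<integral>\<^sup>+\<Sigma>. ennreal (?b \<Sigma> / 2) * ennreal (?K (stretch i s) \<Sigma>) \<partial>lborel_pd)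
      = ennreal (s powr (- \<alpha>)) * (\<integral>\<^sup>+\<Sigma>. ennreal (?b (?D s \<Sigma>) / 2) * ennreal (?K (mat 1) \<Sigma>) \<partial>lborel_pd)"
      using s by (intro scal) auto
    also have "(\<integral>\<^sup>+\<Sigma>. ennreal (?b (?D s \<Sigma>) / 2) * ennreal (?K (mat 1) \<Sigma>) \<partial>lborel_pd)
      = (\<integral>\<^sup>+\<Sigma>. ennreal (1 / (2 * s)) * (ennreal (?b \<Sigma>) * ennreal (?K (mat 1) \<Sigma>)) \<partial>lborel_pd)"
    proof (intro nn_integral_cong)
      fix \<Sigma> :: "real^'k^'k" assume "\<Sigma> \<in> space lborel_pd"
      then have "pos_def \<Sigma>" by simp
      then have 1: "det \<Sigma> \<noteq> 0" "0 < ?b \<Sigma>"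
        using pos_def_det pos_def_diag_pos[OF pos_def_matrix_inv] by fastforce+
      have "?b (?D s \<Sigma>) / 2 = 1 / (2 * s) * ?b \<Sigma>"
        using s 1 by (simp add: matrix_inv_stretch_congruence stretch_congruence_component)
      moreover have "ennreal (1 / (2 * s) * ?b \<Sigma>) = ennreal (1 / (2 * s)) * ennreal (?b \<Sigma>)"
        using s 1 by (intro ennreal_mult) auto
      ultimately show "ennreal (?b (?D s \<Sigma>) / 2) * ennreal (?K (mat 1) \<Sigma>)
         = ennreal (1 / (2 * s)) * (ennreal (?b \<Sigma>) * ennreal (?K (mat 1) \<Sigma>))"
        by (simp only: mult.assoc)
    qed
    also have "\<dots> = ennreal (1 / (2 * s)) * T"
      unfolding T_def by (intro nn_integral_cmult measurable_lborel_pd) measurable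
    also have "ennreal (s powr (- \<alpha>)) * (ennreal (1 / (2 * s)) * T) = ennreal (s powr (- \<alpha> - 1)) * (T / 2)"
    proof -
      have "s powr (- \<alpha>) * (1 / (2 * s)) = s powr (- \<alpha> - 1) * (1/2)"
        using s by (simp add: powr_diff)
      then have "ennreal (s powr (- \<alpha>)) * ennreal (1 / (2 * s))
          = ennreal (s powr (- \<alpha> - 1)) * ennreal (1/2)"
        using s by (simp only: ennreal_mult[symmetric] powr_ge_zero) (simp add: ennreal_mult[symmetric])
      moreover have "T / 2 = ennreal (1/2) * T"
        by (simp add: divide_ennreal_def mult.commute inverse_ennreal[of 2, simplified])
      ultimately show ?thesis by (simp add: mult.assoc[symmetric])
    qed
    finally show ?thesis .
  qed
  interpret P: sigma_finite_measure "lborel_pd :: (real^'k^'k) measure" by (rule sigma_finite_lborel_pd)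
  interpret pair_sigma_finite "lborel_pd :: (real^'k^'k) measure" "lborel :: real measure" ..
  have id: "(\<lambda>x. x) \<in> measurable lborel_pd (borel :: (real^'k^'k) measure)"
    by (rule measurable_lborel_pd) simp
  have fst [measurable]: "fst \<in> borel_measurable
      ((lborel_pd :: (real^'k^'k) measure) \<Otimes>\<^sub>M (lborel :: real measure))"
    using measurable_compose[OF measurable_fst id] .
  have "(\<integral>\<^sup>+s. (\<integral>\<^sup>+\<Sigma>. ennreal (?b \<Sigma> / 2) * ennreal (?K (stretch i s) \<Sigma>)
      * indicator {1..2} s \<partial>lborel_pd) \<partial>lborel)
     = (\<integral>\<^sup>+\<Sigma>. (\<integral>\<^sup>+s. ennreal (?b \<Sigma> / 2) * ennreal (?K (stretch i s) \<Sigma>)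
         * indicator {1..2} s \<partial>lborel) \<partial>lborel_pd)"
    unfolding Kst by (rule Fubini') measurable
  also have "\<dots> = (\<integral>\<^sup>+\<Sigma>. ennreal (?K (mat 1) \<Sigma>) * ennreal (1 - exp (- ?b \<Sigma> / 2)) \<partial>lborel_pd)"
  proof (rule nn_integral_cong)
    fix \<Sigma> :: "real^'k^'k" assume "\<Sigma> \<in> space lborel_pd"
    then have y: "0 < ?b \<Sigma>" using pos_def_diag_pos[OF pos_def_matrix_inv] by simp
    let ?y = "?b \<Sigma>"
    have "(\<integral>\<^sup>+s. ennreal (?y / 2) * ennreal (?K (stretch i s) \<Sigma>) * indicator {1..2} s \<partial>lborel)
      = (\<integral>\<^sup>+s. ennreal (?K (mat 1) \<Sigma>) * (ennreal (?y / 2 * exp (- (1/2) * ((s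
          - 1) * ?y))) * indicator {1..2} s) \<partial>lborel)"
    proof (rule nn_integral_cong)
      fix s :: real
      let ?E = "exp (- (1/2) * ((s - 1) * ?y))"
      have "ennreal (?y / 2 * ?E) = ennreal (?y / 2) * ennreal ?E" using y by (intro ennreal_mult) auto
      moreover have "ennreal (?K (stretch i s) \<Sigma>) = ennreal (?K (mat 1) \<Sigma>) * ennreal ?E"
        unfolding Kst by (intro ennreal_mult) auto
      ultimately show "ennreal (?y / 2) * ennreal (?K (stretch i s) \<Sigma>) * indicator {1..2} s
          = ennreal (?K (mat 1) \<Sigma>) * (ennreal (?y / 2 * ?E) * indicator {1..2} s)"
        by (simp only: mult_ac)
    qed
    also have "\<dots> = ennreal (?K (mat 1) \<Sigma>) * (\<integral>\<^sup>+s. ennreal (?y / 2 * exp (- (1/2) * ((s - 1) * ?y)))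
        * indicator {1..2} s \<partial>lborel)"
      by (rule nn_integral_cmult) measurable
    finally show "(\<integral>\<^sup>+s. ennreal (?y / 2) * ennreal (?K (stretch i s) \<Sigma>) * indicator {1..2} s \<partial>lborel)
       = ennreal (?K (mat 1) \<Sigma>) * ennreal (1 - exp (- ?y / 2))"
      unfolding nn_integral_exp_decay[OF y] .
  qed
  finally have L: "(\<integral>\<^sup>+s. (\<integral>\<^sup>+\<Sigma>. ennreal (?b \<Sigma> / 2) * ennreal (?K (stretch i s) \<Sigma>)
      * indicator {1..2} s \<partial>lborel_pd) \<partial>lborel)
    = (\<integral>\<^sup>+\<Sigma>. ennreal (?K (mat 1) \<Sigma>) * ennreal (1 - exp (- ?b \<Sigma> / 2)) \<partial>lborel_pd)" (is "?L = ?D") .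
  have "?L = (\<integral>\<^sup>+s. (T / 2) * (ennreal (s powr (- \<alpha> - 1)) * indicator {1..2} s) \<partial>lborel)"
  proof (rule nn_integral_cong)
    fix s :: real
    have "(\<integral>\<^sup>+\<Sigma>. ennreal (?b \<Sigma> / 2) * ennreal (?K (stretch i s) \<Sigma>) * indicator {1..2} s \<partial>lborel_pd)
      = (\<integral>\<^sup>+\<Sigma>. ennreal (?b \<Sigma> / 2) * ennreal (?K (stretch i s) \<Sigma>) \<partial>lborel_pd) * indicator {1..2} s"
      by (intro nn_integral_multc measurable_lborel_pd) measurable
    also have "\<dots> = (T / 2) * (ennreal (s powr (- \<alpha> - 1)) * indicator {1..2} s)"
    proof (cases "s \<in> {1..2}")
      case True
      then show ?thesis using Ts[of s] by (simp add: mult.commute[of "T / 2"])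
    qed simp
    finally show "(\<integral>\<^sup>+\<Sigma>. ennreal (?b \<Sigma> / 2) * ennreal (?K (stretch i s) \<Sigma>) * indicator {1..2} s \<partial>lborel_pd)
      = (T / 2) * (ennreal (s powr (- \<alpha> - 1)) * indicator {1..2} s)" .
  qed
  also have "\<dots> = (T / 2) * ennreal ((1 - 2 powr (- \<alpha>)) / \<alpha>)"
    by (subst nn_integral_cmult) (simp_all add: nn_integral_powr_1_2[OF \<alpha>])
  finally have LT: "?L = (T / 2) * ennreal ((1 - 2 powr (- \<alpha>)) / \<alpha>)" .
  have "?D + ennreal (2 powr (- \<alpha>)) * Z = (\<integral>\<^sup>+\<Sigma>. ennreal (?K (mat 1) \<Sigma>) * ennreal (1 - exp (- ?b \<Sigma> / 2))
      + ennreal (?K (stretch i 2) \<Sigma>) \<partial>lborel_pd)"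
    by (subst nn_integral_add) (auto intro!: measurable_lborel_pd simp: Zs)
  also have "\<dots> = Z"
    unfolding Z_def
  proof (rule nn_integral_cong)
    fix \<Sigma> :: "real^'k^'k" assume "\<Sigma> \<in> space lborel_pd"
    then have y: "0 < ?b \<Sigma>" using pos_def_diag_pos[OF pos_def_matrix_inv] by simp
    define e where "e = exp (- ?b \<Sigma> / 2)"
    have e: "0 < e" "e \<le> 1" using y by (auto simp: e_def)
    have "ennreal (?K (stretch i 2) \<Sigma>) = ennreal (?K (mat 1) \<Sigma>) * ennreal e"
      unfolding Kst using e by (subst ennreal_mult[symmetric]) (auto simp: e_def)
    moreover have "ennreal (1 - e) + ennreal e = 1"
      using e by (subst ennreal_plus[symmetric]) auto
    ultimately show "ennreal (?K (mat 1) \<Sigma>) * ennreal (1 - exp (- ?b \<Sigma> / 2))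
        + ennreal (?K (stretch i 2) \<Sigma>) = ennreal (?K (mat 1) \<Sigma>)"
      unfolding e_def[symmetric] by (simp only: distrib_left[symmetric] mult_1_right)
  qed
  finally have DZ: "?D + ennreal (2 powr (- \<alpha>)) * Z = Z" .
  obtain z where z: "Z = ennreal z" "0 \<le> z"
    using inv_wishart_kernel_one_finite[OF d] unfolding Z_def[symmetric] by (cases Z) auto
  have p: "2 powr (- \<alpha>) < 1" using \<alpha> powr_less_mono[of "- \<alpha>" 0 2] by simp
  define q where "q = (1 - 2 powr (- \<alpha>)) / \<alpha>"
  have q: "q > 0" using p \<alpha> by (simp add: q_def)
  \<comment> \<open>The equation \<open>T / 2 * q + 2 powr (- \<alpha>) * Z = Z\<close> determines \<open>T\<close> because \<open>Z\<close> is finite.\<close>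
  have DZ': "T / 2 * ennreal q + ennreal (2 powr (- \<alpha>)) * Z = Z"
    using DZ unfolding L[symmetric] LT q_def .
  have "T / 2 * ennreal q \<le> T / 2 * ennreal q + ennreal (2 powr (- \<alpha>)) * Z" by simp
  then have le: "T / 2 * ennreal q \<le> ennreal z" unfolding DZ' by (simp only: z(1))
  have "T \<noteq> \<infinity>"
  proof
    assume "T = \<infinity>"
    then have "T / 2 * ennreal q = \<infinity>" using q by (simp add: ennreal_top_divide ennreal_top_mult)
    with le show False by (simp add: top_unique)
  qed
  then obtain \<tau> where \<tau>: "T = ennreal \<tau>" "0 \<le> \<tau>" by (cases T) auto
  have "ennreal (\<tau> / 2 * q + 2 powr (- \<alpha>) * z) = T / 2 * ennreal q + ennreal (2 powr (- \<alpha>)) * Z"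
  proof -
    have T2: "T / 2 = ennreal (\<tau> / 2)" using \<tau> by (simp add: ennreal_divide_numeral)
    have "ennreal (\<tau> / 2 * q) = ennreal (\<tau> / 2) * ennreal q" using \<tau> q by (intro ennreal_mult) auto
    moreover have "ennreal (2 powr (- \<alpha>) * z) = ennreal (2 powr (- \<alpha>)) * ennreal z" using z
        by (intro ennreal_mult) auto
    moreover have "ennreal (\<tau> / 2 * q + 2 powr (- \<alpha>) * z)
        = ennreal (\<tau> / 2 * q) + ennreal (2 powr (- \<alpha>) * z)"
      using \<tau> z q by (intro ennreal_plus) auto
    ultimately show ?thesis by (simp only: T2 z(1))
  qed
  also have "\<dots> = ennreal z" unfolding DZ' by (rule z(1))
  finally have "\<tau> / 2 * q + 2 powr (- \<alpha>) * z = z"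
    using \<tau> z q by (subst (asm) ennreal_inj) auto
  then have "\<tau> / 2 * q = z * (1 - 2 powr (- \<alpha>))" by (simp add: algebra_simps)
  then have eq: "(\<tau> / (2 * \<alpha>)) * (1 - 2 powr (- \<alpha>)) = z * (1 - 2 powr (- \<alpha>))" by (simp add: q_def)
  have "1 - 2 powr (- \<alpha>) \<noteq> 0" using \<alpha> by simp
  from mult_right_cancel[OF this] eq have "\<tau> / (2 * \<alpha>) = z" by blast
  then have "\<tau> = (d - real CARD('k) - 1) * z" using \<alpha> by (auto simp: \<alpha>_def field_simps)
  then show ?thesis
    using \<alpha>' unfolding T_def[symmetric] Z_def[symmetric] \<tau> z using z by (simp add: ennreal_mult)
qed

lemma integral_inv_wishart_kernel_congruence:
  fixes A S :: "real^'k^'k" and F :: "real^'k^'k \<Rightarrow> 'b::{banach, second_countable_topology}"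
  assumes A: "det A \<noteq> 0" and [measurable]: "F \<in> borel_measurable borel"
  shows "(\<integral>\<Sigma>. inv_wishart_kernel d (A ** S ** transpose A) \<Sigma> *\<^sub>R F \<Sigma> \<partial>lborel_pd)
    = \<bar>det A\<bar> powr (real CARD('k) + 1 - d) *\<^sub>R
      (\<integral>\<Sigma>. inv_wishart_kernel d S \<Sigma> *\<^sub>R F (A ** \<Sigma> ** transpose A) \<partial>lborel_pd)"
proof -
  have "(\<integral>\<Sigma>. inv_wishart_kernel d (A ** S ** transpose A) \<Sigma> *\<^sub>R F \<Sigma> \<partial>lborel_pd)
    = \<bar>det A\<bar> ^ (CARD('k) + 1) *\<^sub>R (\<integral>\<Sigma>. inv_wishart_kernel d (A ** S ** transpose A) (A ** \<Sigma> **
        transpose A) *\<^sub>R F (A ** \<Sigma> ** transpose A) \<partial>lborel_pd)"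
    by (rule lborel_pd_congruence_integral(1)[OF A]) measurable
  also have "(\<integral>\<Sigma>. inv_wishart_kernel d (A ** S ** transpose A) (A ** \<Sigma> ** transpose A)
      *\<^sub>R F (A ** \<Sigma> ** transpose A) \<partial>lborel_pd)
    = (\<integral>\<Sigma>. \<bar>det A\<bar> powr (- d) *\<^sub>R (inv_wishart_kernel d S \<Sigma> *\<^sub>R F (A ** \<Sigma> ** transpose A)) \<partial>lborel_pd)"
    by (rule Bochner_Integration.integral_cong) (simp_all add: inv_wishart_kernel_congruence[OF A])
  also have "\<dots> = \<bar>det A\<bar> powr (- d) *\<^sub>R (\<integral>\<Sigma>. inv_wishart_kernel d S \<Sigma>
      *\<^sub>R F (A ** \<Sigma> ** transpose A) \<partial>lborel_pd)"
    by (rule Bochner_Integration.integral_scaleR_right)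
  also have "\<bar>det A\<bar> ^ (CARD('k) + 1) *\<^sub>R (\<bar>det A\<bar> powr (- d) *\<^sub>R x)
      = \<bar>det A\<bar> powr (real CARD('k) + 1 - d) *\<^sub>R x" for x :: 'b
  proof -
    have "\<bar>det A\<bar> ^ (CARD('k) + 1) = \<bar>det A\<bar> powr (real CARD('k) + 1)"
      using A powr_realpow[of "\<bar>det A\<bar>" "CARD('k) + 1"] by (simp add: add.commute)
    then have "\<bar>det A\<bar> ^ (CARD('k) + 1) * \<bar>det A\<bar> powr (- d) = \<bar>det A\<bar> powr (real CARD('k) + 1 - d)"
      by (simp only: powr_add[symmetric]) simp
    then show ?thesis by (simp only: scaleR_scaleR)
  qed
  finally show ?thesis .
qed

lemma integrable_inv_wishart_kernel:
  assumes "2 * real CARD('k) < d" "pos_def (S :: real^'k^'k)"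
  shows "integrable lborel_pd (inv_wishart_kernel d S)"
  using inv_wishart_kernel_finite[OF assms]
  by (intro integrableI_nonneg measurable_lborel_pd) auto

lemma integral_inv_wishart_kernel_pos:
  assumes "2 * real CARD('k) < d" "pos_def (S :: real^'k^'k)"
  shows "0 < (\<integral>\<Sigma>. inv_wishart_kernel d S \<Sigma> \<partial>lborel_pd)"
proof -
  have "(\<integral>\<Sigma>. inv_wishart_kernel d S \<Sigma> \<partial>lborel_pd) \<noteq> 0"
  proof
    assume "(\<integral>\<Sigma>. inv_wishart_kernel d S \<Sigma> \<partial>lborel_pd) = 0"
    then have "AE \<Sigma> in lborel_pd. inv_wishart_kernel d S \<Sigma> = 0"
      using integral_nonneg_eq_0_iff_AE[OF integrable_inv_wishart_kernel[OF assms]] by auto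
    moreover have "AE \<Sigma> in lborel_pd. inv_wishart_kernel d S \<Sigma> \<noteq> 0"
      using inv_wishart_kernel_pos by (intro AE_I2) (fastforce simp: less_le)
    ultimately have "AE \<Sigma> in (lborel_pd :: (real^'k^'k) measure). False" by eventually_elim simp
    then show False using emeasure_lborel_pd_nonzero by blast
  qed
  then show ?thesis using Bochner_Integration.integral_nonneg[of lborel_pd "inv_wishart_kernel d S"]
      by (simp add: less_le)
qed

lemma matrix_inv_diag_nonneg: "pos_def S \<Longrightarrow> 0 \<le> matrix_inv S $ i $ i" for S :: "real^'k^'k"
  by (rule less_imp_le[OF pos_def_diag_pos[OF pos_def_matrix_inv]])

text \<open>The quadratic form at \<open>e_i + e_j\<close> and \<open>e_i - e_j\<close> bounds each entry by the mean of two diagonal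
entries.\<close>

lemma norm_matrix_le_trace:
  fixes B :: "real^'k^'k"
  assumes "pos_def B"
  shows "norm B \<le> real CARD('k) * trace B"
proof -
  have B: "\<bar>B $ i $ j\<bar> \<le> (B $ i $ i + B $ j $ j) / 2" for i j
  proof (cases "i = j")
    case True
    then show ?thesis using pos_def_diag_pos[OF assms, of i] by simp
  next
    case False
    have quad: "0 \<le> v \<bullet> (B *v v)" for v
      using assms by (cases "v = 0") (auto simp: pos_def_def less_imp_le)
    have e: "axis i 1 \<bullet> (B *v axis j 1) = B $ i $ j" for i j
      by (simp add: matrix_vector_mult_basis inner_axis' column_def)
    have "0 \<le> (axis i 1 + axis j 1) \<bullet> (B *v (axis i 1 + axis j 1))" by (rule quad)
    then have 1: "0 \<le> B $ i $ i + B $ j $ j + 2 * B $ i $ j"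
      using pos_def_symmetric[OF assms, of i j]
          by (simp add: matrix_vector_right_distrib inner_add_left inner_add_right e)
    have "0 \<le> (axis i 1 - axis j 1) \<bullet> (B *v (axis i 1 - axis j 1))" by (rule quad)
    then have 2: "0 \<le> B $ i $ i + B $ j $ j - 2 * B $ i $ j"
      using pos_def_symmetric[OF assms, of i j]
          by (simp add: matrix_vector_mult_diff_distrib inner_diff_left inner_diff_right e)
    show ?thesis using 1 2 by (simp add: abs_le_iff)
  qed
  have "norm B \<le> (\<Sum>i\<in>UNIV. norm (B $ i))" unfolding norm_vec_def by (rule L2_set_le_sum) simp
  also have "\<dots> \<le> (\<Sum>i\<in>UNIV. \<Sum>j\<in>UNIV. \<bar>B $ i $ j\<bar>)" by (intro sum_mono norm_le_l1_cart)
  also have "\<dots> \<le> (\<Sum>i\<in>UNIV. \<Sum>j\<in>UNIV. (B $ i $ i + B $ j $ j) / 2)" by (intro sum_mono B)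
  also have "\<dots> = real CARD('k) * trace B"
    by (simp add: sum.distrib sum_divide_distrib[symmetric] trace_def sum_distrib_left[symmetric])
  finally show ?thesis .
qed

lemma inv_wishart_one_integrable:
  fixes d :: real
  assumes d: "2 * real CARD('k) < d"
  shows "integrable lborel_pd (\<lambda>\<Sigma> :: real^'k^'k. inv_wishart_kernel d (mat 1) \<Sigma> *\<^sub>R matrix_inv \<Sigma>)"
proof (rule Bochner_Integration.integrable_bound)
  let ?K = "inv_wishart_kernel d (mat 1 :: real^'k^'k)"
  have "integrable lborel_pd (\<lambda>\<Sigma> :: real^'k^'k. ?K \<Sigma> * matrix_inv \<Sigma> $ i $ i)" for i
  proof (rule integrableI_nonneg)
    show "AE \<Sigma> in lborel_pd. 0 \<le> ?K \<Sigma> * matrix_inv \<Sigma> $ i $ i"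
      by (intro AE_I2) (auto intro!: mult_nonneg_nonneg matrix_inv_diag_nonneg)
    have "(\<integral>\<^sup>+\<Sigma>. ennreal (?K \<Sigma> * matrix_inv \<Sigma> $ i $ i) \<partial>lborel_pd)
        = (\<integral>\<^sup>+\<Sigma>. ennreal (matrix_inv \<Sigma> $ i $ i) * ennreal (?K \<Sigma>) \<partial>lborel_pd)"
      by (intro nn_integral_cong) (subst ennreal_mult[symmetric]; simp add: matrix_inv_diag_nonneg
          mult.commute)
    also have "\<dots> < \<infinity>"
      unfolding inv_wishart_diag_moment[OF d] using inv_wishart_kernel_one_finite[OF d]
      by (simp add: ennreal_mult_less_top)
    finally show "(\<integral>\<^sup>+\<Sigma>. ennreal (?K \<Sigma> * matrix_inv \<Sigma> $ i $ i) \<partial>lborel_pd) < \<infinity>" .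
  qed (rule measurable_lborel_pd, measurable)
  then show "integrable lborel_pd (\<lambda>\<Sigma> :: real^'k^'k. real CARD('k)
      * (\<Sum>i\<in>UNIV. ?K \<Sigma> * matrix_inv \<Sigma> $ i $ i))"
    by (intro integrable_mult_right Bochner_Integration.integrable_sum)
  show "(\<lambda>\<Sigma> :: real^'k^'k. ?K \<Sigma> *\<^sub>R matrix_inv \<Sigma>) \<in> borel_measurable lborel_pd"
    by (rule measurable_lborel_pd) measurable
  show "AE \<Sigma> in lborel_pd. norm (?K \<Sigma> *\<^sub>R matrix_inv \<Sigma>)
      \<le> norm (real CARD('k) * (\<Sum>i\<in>UNIV. ?K \<Sigma> * matrix_inv \<Sigma> $ i $ i))"
  proof (rule AE_I2)
    fix \<Sigma> :: "real^'k^'k" assume "\<Sigma> \<in> space lborel_pd"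
    then have "norm (matrix_inv \<Sigma>) \<le> real CARD('k) * trace (matrix_inv \<Sigma>)"
      by (intro norm_matrix_le_trace pos_def_matrix_inv) simp
    then have "?K \<Sigma> * norm (matrix_inv \<Sigma>) \<le> ?K \<Sigma> * (real CARD('k) * trace (matrix_inv \<Sigma>))"
      by (intro mult_left_mono) auto
    also have "\<dots> = real CARD('k) * (\<Sum>i\<in>UNIV. ?K \<Sigma> * matrix_inv \<Sigma> $ i $ i)"
      by (simp add: trace_def sum_distrib_left mult_ac)
    finally show "norm (?K \<Sigma> *\<^sub>R matrix_inv \<Sigma>)
        \<le> norm (real CARD('k) * (\<Sum>i\<in>UNIV. ?K \<Sigma> * matrix_inv \<Sigma> $ i $ i))"
      by simp
  qed
qed

text \<open>Reversing the sign of the \<open>i\<close>-th coordinate preserves the kernel with scale matrix 1 and reverses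
the sign of the off-diagonal entries of \<open>\<Sigma>^-1\<close> in row \<open>i\<close>, so these have mean 0.\<close>

lemma inv_wishart_one_mean:
  fixes d :: real
  assumes d: "2 * real CARD('k) < d"
  shows "(\<integral>\<Sigma>. inv_wishart_kernel d (mat 1 :: real^'k^'k) \<Sigma> *\<^sub>R matrix_inv \<Sigma> \<partial>lborel_pd)
    = ((d - real CARD('k) - 1) * (\<integral>\<Sigma>. inv_wishart_kernel d (mat 1 :: real^'k^'k) \<Sigma> \<partial>lborel_pd)) *\<^sub>R mat 1"
    (is "?T = _")
proof -
  let ?K = "inv_wishart_kernel d (mat 1 :: real^'k^'k)"
  define \<kappa> where "\<kappa> = real CARD('k)"
  have "1 \<le> \<kappa>" "2 * \<kappa> < d" using d by (simp_all add: \<kappa>_def Suc_leI)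
  then have "0 \<le> d - \<kappa> - 1" by linarith
  then have d': "0 \<le> d - real CARD('k) - 1" by (simp add: \<kappa>_def)
  have comp: "?T $ i $ j = (\<integral>\<Sigma>. ?K \<Sigma> * matrix_inv \<Sigma> $ i $ j \<partial>lborel_pd)" for i j
  proof -
    have bl: "bounded_linear (\<lambda>B :: real^'k^'k. B $ i $ j)"
      by (intro bounded_linear_compose[OF bounded_linear_vec_nth bounded_linear_vec_nth])
    from integral_bounded_linear[OF bl inv_wishart_one_integrable[OF d]] show ?thesis by simp
  qed
  have diag: "?T $ i $ i = (d - real CARD('k) - 1) * (\<integral>\<Sigma>. ?K \<Sigma> \<partial>lborel_pd)" for i
  proof -
    have "?T $ i $ i = enn2real (\<integral>\<^sup>+\<Sigma>. ennreal (?K \<Sigma> * matrix_inv \<Sigma> $ i $ i) \<partial>lborel_pd)"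
      unfolding comp
      by (intro integral_eq_nn_integral measurable_lborel_pd AE_I2) (measurable, auto intro!:
          mult_nonneg_nonneg matrix_inv_diag_nonneg)
    also have "(\<integral>\<^sup>+\<Sigma>. ennreal (?K \<Sigma> * matrix_inv \<Sigma> $ i $ i) \<partial>lborel_pd)
        = (\<integral>\<^sup>+\<Sigma>. ennreal (matrix_inv \<Sigma> $ i $ i) * ennreal (?K \<Sigma>) \<partial>lborel_pd)"
      by (intro nn_integral_cong) (subst ennreal_mult[symmetric]; simp add: matrix_inv_diag_nonneg
          mult.commute)
    also have "\<dots> = ennreal (d - real CARD('k) - 1) * ennreal (\<integral>\<Sigma>. ?K \<Sigma> \<partial>lborel_pd)"
      unfolding inv_wishart_diag_moment[OF d]
      by (subst nn_integral_eq_integral[OF integrable_inv_wishart_kernel[OF d pos_def_mat_1]]) auto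
    also have "enn2real \<dots> = (d - real CARD('k) - 1) * (\<integral>\<Sigma>. ?K \<Sigma> \<partial>lborel_pd)"
      using d' integral_inv_wishart_kernel_pos[OF d pos_def_mat_1] by (simp add: enn2real_mult less_imp_le)
    finally show ?thesis .
  qed
  have off: "?T $ i $ j = 0" if "i \<noteq> j" for i j
  proof -
    let ?D = "stretch i (-1) :: real^'k^'k"
    have "(\<integral>\<Sigma>. inv_wishart_kernel d (?D ** mat 1 ** transpose ?D) \<Sigma> *\<^sub>R (matrix_inv \<Sigma> $ i $ j) \<partial>lborel_pd)
      = \<bar>det ?D\<bar> powr (real CARD('k) + 1 - d) *\<^sub>R (\<integral>\<Sigma>. ?K \<Sigma>
          *\<^sub>R matrix_inv (?D ** \<Sigma> ** transpose ?D) $ i $ j \<partial>lborel_pd)"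
      by (rule integral_inv_wishart_kernel_congruence) auto
    then have "?T $ i $ j = (\<integral>\<Sigma>. ?K \<Sigma> * matrix_inv (?D ** \<Sigma> ** ?D) $ i $ j \<partial>lborel_pd)"
      by (simp add: comp stretch_mult)
    also have "\<dots> = (\<integral>\<Sigma>. - (?K \<Sigma> * matrix_inv \<Sigma> $ i $ j) \<partial>lborel_pd)"
    proof (rule Bochner_Integration.integral_cong[OF refl])
      fix \<Sigma> :: "real^'k^'k" assume "\<Sigma> \<in> space lborel_pd"
      then have "0 < det \<Sigma>" using pos_def_det by simp
      then show "?K \<Sigma> * matrix_inv (?D ** \<Sigma> ** ?D) $ i $ j = - (?K \<Sigma> * matrix_inv \<Sigma> $ i $ j)"
        using that by (simp add: matrix_inv_stretch_congruence stretch_congruence_component)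
    qed
    also have "\<dots> = - ?T $ i $ j" by (simp add: comp)
    finally show ?thesis by simp
  qed
  show ?thesis
    using diag off by (auto simp: vec_eq_iff mat_def)
qed

text \<open>A congruence by \<open>A\<close>, where \<open>S = A A'\<close>, reduces the scale matrix to 1.\<close>

theorem inv_wishart_precision_mean:
  fixes d :: real and S :: "real^'k^'k"
  assumes d: "2 * real CARD('k) < d" and S: "pos_def S"
  shows "integrable lborel_pd (\<lambda>\<Sigma>. inv_wishart_kernel d S \<Sigma> *\<^sub>R matrix_inv \<Sigma>)"
    and "(\<integral>\<Sigma>. inv_wishart_kernel d S \<Sigma> *\<^sub>R matrix_inv \<Sigma> \<partial>lborel_pd)
      = ((d - real CARD('k) - 1) * (\<integral>\<Sigma>. inv_wishart_kernel d S \<Sigma> \<partial>lborel_pd)) *\<^sub>R matrix_inv S"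
proof -
  obtain A where A: "det A \<noteq> 0" "S = A ** transpose A" using S by (rule pos_def_factor)
  define B where "B = matrix_inv A"
  have dB: "det B \<noteq> 0" using A by (simp add: B_def det_matrix_inv)
  let ?K1 = "inv_wishart_kernel d (mat 1 :: real^'k^'k)"
  let ?c = "\<bar>det A\<bar> powr (real CARD('k) + 1 - d)"
  have BA: "B ** A = mat 1" "A ** B = mat 1" using A by (simp_all add: B_def matrix_inv_mult)
  have inv: "matrix_inv (A ** \<Sigma> ** transpose A) = transpose B ** matrix_inv \<Sigma> ** B" if "pos_def \<Sigma>" for \<Sigma>
    using A pos_def_det[OF that] by (simp add: B_def matrix_inv_prod matrix_inv_transpose det_mul
        matrix_mul_assoc)
  have bl: "bounded_linear (\<lambda>C. transpose B ** C ** B)"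
    using linear_compose[OF linear_matrix_mult_left[of "transpose B"] linear_matrix_mult_right[of B]]
    by (simp add: o_def linear_conv_bounded_linear)
  have lin: "transpose B ** (c *\<^sub>R C) ** B = c *\<^sub>R (transpose B ** C ** B)" for c C
    using linear_cmul[OF bounded_linear.linear[OF bl]] .
  show "(\<integral>\<Sigma>. inv_wishart_kernel d S \<Sigma> *\<^sub>R matrix_inv \<Sigma> \<partial>lborel_pd)
      = ((d - real CARD('k) - 1) * (\<integral>\<Sigma>. inv_wishart_kernel d S \<Sigma> \<partial>lborel_pd)) *\<^sub>R matrix_inv S"
  proof -
    have "(\<integral>\<Sigma>. inv_wishart_kernel d S \<Sigma> *\<^sub>R matrix_inv \<Sigma> \<partial>lborel_pd)
      = ?c *\<^sub>R (\<integral>\<Sigma>. ?K1 \<Sigma> *\<^sub>R matrix_inv (A ** \<Sigma> ** transpose A) \<partial>lborel_pd)"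
      using integral_inv_wishart_kernel_congruence[OF A(1), of matrix_inv d "mat 1"] by (simp add: A(2))
    also have "(\<integral>\<Sigma>. ?K1 \<Sigma> *\<^sub>R matrix_inv (A ** \<Sigma> ** transpose A) \<partial>lborel_pd)
      = (\<integral>\<Sigma>. transpose B ** (?K1 \<Sigma> *\<^sub>R matrix_inv \<Sigma>) ** B \<partial>lborel_pd)"
      by (rule Bochner_Integration.integral_cong) (simp_all add: inv lin)
    also have "\<dots> = transpose B ** (\<integral>\<Sigma>. ?K1 \<Sigma> *\<^sub>R matrix_inv \<Sigma> \<partial>lborel_pd) ** B"
      by (rule integral_bounded_linear[OF bl inv_wishart_one_integrable[OF d]])
    also have "\<dots> = ((d - real CARD('k) - 1) * (\<integral>\<Sigma>. ?K1 \<Sigma> \<partial>lborel_pd)) *\<^sub>R (transpose B ** B)"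
      unfolding inv_wishart_one_mean[OF d] lin by simp
    also have "transpose B ** B = matrix_inv S"
      using A by (simp add: B_def matrix_inv_mult_transpose)
    also have "?c *\<^sub>R (((d - real CARD('k) - 1) * (\<integral>\<Sigma>. ?K1 \<Sigma> \<partial>lborel_pd)) *\<^sub>R matrix_inv S)
      = ((d - real CARD('k) - 1) * (?c *\<^sub>R (\<integral>\<Sigma>. ?K1 \<Sigma> *\<^sub>R 1 \<partial>lborel_pd))) *\<^sub>R matrix_inv S"
      by (simp add: mult_ac)
    also have "?c *\<^sub>R (\<integral>\<Sigma>. ?K1 \<Sigma> *\<^sub>R 1 \<partial>lborel_pd)
        = (\<integral>\<Sigma>. inv_wishart_kernel d S \<Sigma> *\<^sub>R (1::real) \<partial>lborel_pd)"
      using integral_inv_wishart_kernel_congruence[OF A(1), of "\<lambda>_. 1 :: real" d "mat 1"]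
          by (simp add: A(2))
    finally show ?thesis by simp
  qed
  \<comment> \<open>For integrability, the integrable function for scale matrix 1 is pulled back along \<open>B\<close>.\<close>
  have "integrable lborel_pd (\<lambda>\<Sigma>. ?K1 (B ** \<Sigma> ** transpose B) *\<^sub>R matrix_inv (B ** \<Sigma> ** transpose B))"
    by (rule lborel_pd_congruence_integral(2)[OF dB _ inv_wishart_one_integrable[OF d]]) measurable
  then have "integrable lborel_pd (\<lambda>\<Sigma>. transpose B ** (?K1 (B ** \<Sigma> ** transpose B)
      *\<^sub>R matrix_inv (B ** \<Sigma> ** transpose B)) ** B)"
    by (intro integrable_bounded_linear[OF bl])
  then have "integrable lborel_pd (\<lambda>\<Sigma>. \<bar>det A\<bar> powr (- d)
      *\<^sub>R (transpose B ** (?K1 (B ** \<Sigma> ** transpose B) *\<^sub>R matrix_inv (B ** \<Sigma> ** transpose B)) ** B))"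
    by (rule integrable_scaleR_right)
  then show "integrable lborel_pd (\<lambda>\<Sigma>. inv_wishart_kernel d S \<Sigma> *\<^sub>R matrix_inv \<Sigma>)"
  proof (rule Bochner_Integration.integrable_cong[OF refl, THEN iffD1, rotated])
    fix \<Sigma> :: "real^'k^'k" assume "\<Sigma> \<in> space lborel_pd"
    then have \<Sigma>: "pos_def (B ** \<Sigma> ** transpose B)" by (intro pos_def_congruence[OF dB]) simp
    have "A ** (B ** \<Sigma> ** transpose B) ** transpose A = (A ** B) ** \<Sigma> ** transpose (A ** B)"
      by (simp add: matrix_transpose_mul matrix_mul_assoc)
    then have eq: "A ** (B ** \<Sigma> ** transpose B) ** transpose A = \<Sigma>" by (simp add: BA transpose_mat)
    show "\<bar>det A\<bar> powr (- d) *\<^sub>R (transpose B ** (?K1 (B ** \<Sigma> ** transpose B)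
        *\<^sub>R matrix_inv (B ** \<Sigma> ** transpose B)) ** B)
      = inv_wishart_kernel d S \<Sigma> *\<^sub>R matrix_inv \<Sigma>"
      using inv_wishart_kernel_congruence[OF A(1) \<Sigma>, of d "mat 1"] inv[OF \<Sigma>]
      unfolding eq by (simp add: lin A(2))
  qed
qed

section \<open>Gaussian integrals over the mean vector\<close>

lemma quad_nonneg: "pos_def M \<Longrightarrow> 0 \<le> v \<bullet> (M *v v)" for M :: "real^'k^'k"
  by (cases "v = 0") (auto simp: pos_def_def less_imp_le)

lemma pos_def_swap: "pos_def M \<Longrightarrow> u \<bullet> (M *v v) = v \<bullet> (M *v u)" for M :: "real^'k^'k"
proof -
  assume "pos_def M"
  then have "transpose M = M" by (simp add: pos_def_def)
  then have "u \<bullet> (M *v v) = (M *v u) \<bullet> v" using inner_adjoint[of u M v]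
      by (simp del: transpose_matrix_vector)
  then show ?thesis by (simp add: inner_commute)
qed

lemma norm_matrix_vector_le: "norm (A *v x) \<le> norm A * norm x" for A :: "real^'k^'k"
proof -
  have "(norm (A *v x))\<^sup>2 = (\<Sum>i\<in>UNIV. (A $ i \<bullet> x)\<^sup>2)"
    unfolding power2_norm_eq_inner inner_vec_def[of "A *v x"]
    by (simp add: matrix_vector_mul_component power2_eq_square)
  also have "\<dots> \<le> (\<Sum>i\<in>UNIV. (norm (A $ i))\<^sup>2 * (norm x)\<^sup>2)"
  proof (intro sum_mono)
    fix i
    show "(A $ i \<bullet> x)\<^sup>2 \<le> (norm (A $ i))\<^sup>2 * (norm x)\<^sup>2"
      using Cauchy_Schwarz_ineq[of "A $ i" x] by (simp add: power2_norm_eq_inner)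
  qed
  also have "\<dots> = (norm A * norm x)\<^sup>2"
    by (simp add: power_mult_distrib sum_distrib_right[symmetric]) (simp add: power2_norm_eq_inner
        inner_vec_def)
  finally show ?thesis by (rule power2_le_imp_le) simp
qed

text \<open>The nonnegative form at \<open>e_i + v\<close> and \<open>e_i - v\<close> bounds each coordinate of \<open>M *v v\<close>. The bound is
linear both in the norm of \<open>M\<close>, whose inverse Wishart mean is finite,
    and in the quadratic form, which a Gaussian
weight absorbs.\<close>

lemma norm_pos_def_mult_le:
  fixes M :: "real^'k^'k"
  assumes M: "pos_def M"
  shows "norm (M *v v) \<le> real CARD('k) / 2 * (norm M + v \<bullet> (M *v v))"
proof -
  let ?q = "v \<bullet> (M *v v)"
  have "\<bar>(M *v v) $ i\<bar> \<le> (norm M + ?q) / 2" for i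
  proof -
    have e: "axis i 1 \<bullet> (M *v u) = (M *v u) $ i" for u by (simp add: inner_axis')
    have ii: "(M *v axis i 1) $ i = M $ i $ i"
      by (simp add: matrix_vector_mult_basis column_def)
    have "\<bar>M $ i $ i\<bar> \<le> norm M"
      by (meson component_le_norm_cart order_trans Finite_Cartesian_Product.norm_nth_le)
    then have d: "M $ i $ i \<le> norm M" by simp
    have "0 \<le> (axis i 1 + v) \<bullet> (M *v (axis i 1 + v))" by (rule quad_nonneg[OF M])
    then have 1: "0 \<le> M $ i $ i + ?q + 2 * (M *v v) $ i"
      using pos_def_swap[OF M, of v "axis i 1"]
      by (simp add: matrix_vector_right_distrib inner_add_left inner_add_right e ii)
    have "0 \<le> (axis i 1 - v) \<bullet> (M *v (axis i 1 - v))" by (rule quad_nonneg[OF M])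
    then have 2: "0 \<le> M $ i $ i + ?q - 2 * (M *v v) $ i"
      using pos_def_swap[OF M, of v "axis i 1"]
      by (simp add: matrix_vector_mult_diff_distrib inner_diff_left inner_diff_right e ii)
    show ?thesis using 1 2 d by (simp add: abs_le_iff)
  qed
  then have "(\<Sum>i\<in>UNIV. \<bar>(M *v v) $ i\<bar>) \<le> (\<Sum>i\<in>(UNIV :: 'k set). (norm M + ?q) / 2)" by (intro sum_mono)
  then show ?thesis using norm_le_l1_cart[of "M *v v"] by simp
qed

text \<open>Its value \<open>(2 pi / c) powr (DIM('v) / 2)\<close> cancels against the normalisation of the posterior, so
it is kept as an abstract positive constant.\<close>

definition gauss_const :: "'v::euclidean_space itself \<Rightarrow> real \<Rightarrow> real" where
  "gauss_const _ c = (\<integral>y. exp (- (1/2) * c * (norm (y :: 'v))\<^sup>2) \<partial>lborel)"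

lemma nn_integral_gauss_const:
  fixes c :: real
  assumes "0 < c"
  shows "(\<integral>\<^sup>+y. ennreal (exp (- (1/2) * c * (norm (y :: 'v::euclidean_space))\<^sup>2)) \<partial>lborel)
      = ennreal (gauss_const TYPE('v) c)"
    and "0 < gauss_const TYPE('v) c"
proof -
  have 1: "(\<integral>\<^sup>+y. ennreal (exp (- (1/2) * c * (norm (y :: 'v))\<^sup>2)) \<partial>lborel) < \<infinity>"
    using lborel_gauss_finite(1)[of "c / 2", where 'v='v] assms by simp
  have 2: "0 < (\<integral>\<^sup>+y. ennreal (exp (- (1/2) * c * (norm (y :: 'v))\<^sup>2)) \<partial>lborel)"
    using lborel_gauss_finite(2)[of "c / 2", where 'v='v] assms by simp
  have "integrable lborel (\<lambda>y :: 'v. exp (- (1/2) * c * (norm y)\<^sup>2))"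
    using 1 by (intro integrableI_nonneg) auto
  then show 3: "(\<integral>\<^sup>+y. ennreal (exp (- (1/2) * c * (norm (y :: 'v))\<^sup>2)) \<partial>lborel)
      = ennreal (gauss_const TYPE('v) c)"
    unfolding gauss_const_def by (intro nn_integral_eq_integral) auto
  show "0 < gauss_const TYPE('v) c" using 2 unfolding 3 by (simp add: ennreal_less_zero_iff)
qed

lemma nn_integral_gauss_quad:
  fixes \<Sigma> :: "real^'k^'k" and m :: "real^'k"
  assumes c: "0 < c" and \<Sigma>: "pos_def \<Sigma>"
  shows "(\<integral>\<^sup>+\<mu>. ennreal (exp (- (1/2) * c * ((\<mu> - m) \<bullet> (matrix_inv \<Sigma> *v (\<mu> - m))))) \<partial>lborel)
    = ennreal (sqrt (det \<Sigma>) * gauss_const TYPE(real^'k) c)"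
proof -
  obtain A where A: "det A \<noteq> 0" "\<Sigma> = A ** transpose A" using \<Sigma> by (rule pos_def_factor)
  let ?f = "\<lambda>y. ennreal (exp (- (1/2) * c * (y \<bullet> (matrix_inv \<Sigma> *v y))))"
  have quad: "(A *v z) \<bullet> (matrix_inv \<Sigma> *v (A *v z)) = (norm z)\<^sup>2" for z
  proof -
    have "matrix_inv \<Sigma> *v (A *v z) = transpose (matrix_inv A) *v (matrix_inv A *v (A *v z))"
      using A by (simp add: matrix_inv_mult_transpose matrix_vector_mul_assoc matrix_mul_assoc del:
          transpose_matrix_vector)
    also have "\<dots> = transpose (matrix_inv A) *v z"
        by (simp add: matrix_inv_mult_vec[OF A(1)] del: transpose_matrix_vector)
    finally have "(A *v z) \<bullet> (matrix_inv \<Sigma> *v (A *v z)) = (A *v z) \<bullet> (transpose (matrix_inv A) *v z)"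
        by simp
    also have "\<dots> = (matrix_inv A *v (A *v z)) \<bullet> z" by (subst inner_adjoint) simp
    finally show ?thesis by (simp add: matrix_inv_mult_vec[OF A(1)] power2_norm_eq_inner)
  qed
  have "(\<integral>\<^sup>+\<mu>. ?f (\<mu> - m) \<partial>lborel) = (\<integral>\<^sup>+y. ?f y \<partial>lborel)"
    using lborel_translation[of ?f "- m"] by simp
  also have "\<dots> = ennreal \<bar>det A\<bar> * (\<integral>\<^sup>+z. ?f (A *v z) \<partial>lborel)"
    by (rule lborel_matrix_image[OF A(1)]) measurable
  also have "\<dots> = ennreal \<bar>det A\<bar> * ennreal (gauss_const TYPE(real^'k) c)"
    unfolding quad using nn_integral_gauss_const(1)[OF c, where 'v="real^'k"] by simp
  also have "\<bar>det A\<bar> = sqrt (det \<Sigma>)" by (simp add: A(2) det_mul)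
  finally show ?thesis
    using nn_integral_gauss_const(2)[OF c, where 'v="real^'k"] pos_def_det[OF \<Sigma>] by (simp add: ennreal_mult)
qed

lemma mult_exp_neg_le:
  fixes q r :: real
  assumes "0 \<le> q" "0 < r"
  shows "q * exp (- (1/2) * r * q) \<le> 4 / r * exp (- (1/2) * (r / 2) * q)"
proof -
  have "r / 4 * q \<le> exp (r / 4 * q)" using exp_ge_add_one_self[of "r / 4 * q"] by linarith
  then have "q \<le> 4 / r * exp (r / 4 * q)" using assms by (simp add: field_simps)
  then have "q * exp (- (1/2) * r * q) \<le> 4 / r * exp (r / 4 * q) * exp (- (1/2) * r * q)"
    by (intro mult_right_mono) auto
  also have "\<dots> = 4 / r * exp (- (1/2) * (r / 2) * q)" by (simp add: mult.assoc exp_add[symmetric])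
  finally show ?thesis .
qed

text \<open>Half of the Gaussian exponent is spent on absorbing the quadratic form. What is left is the
dominating function for the joint integral over mean vector and covariance matrix.\<close>

lemma norm_gauss_weight_le:
  fixes M :: "real^'k^'k" and r :: real
  assumes M: "pos_def M" and r: "0 < r"
  shows "exp (- (1/2) * r * (y \<bullet> (M *v y))) * norm (M *v (y + v))
    \<le> (real CARD('k) / 2 + norm v + 2 * real CARD('k) / r) * (1
        + norm M) * exp (- (1/2) * (r / 2) * (y \<bullet> (M *v y)))"
proof -
  let ?q = "y \<bullet> (M *v y)" and ?k = "real CARD('k)"
  let ?e = "exp (- (1/2) * r * ?q)" and ?e' = "exp (- (1/2) * (r / 2) * ?q)"
  have q: "0 \<le> ?q" by (rule quad_nonneg[OF M])
  have ee: "?e \<le> ?e'" using q r by simp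
  have "norm (M *v (y + v)) \<le> norm (M *v y) + norm (M *v v)"
    by (simp add: matrix_vector_right_distrib norm_triangle_ineq)
  also have "\<dots> \<le> ?k / 2 * (norm M + ?q) + norm M * norm v"
    by (intro add_mono norm_pos_def_mult_le[OF M] norm_matrix_vector_le)
  finally have "?e * norm (M *v (y + v)) \<le> ?e * (?k / 2 * (norm M + ?q) + norm M * norm v)"
    by (intro mult_left_mono) auto
  also have "\<dots> = (?k / 2 + norm v) * norm M * ?e + ?k / 2 * (?q * ?e)" by (simp add: algebra_simps)
  also have "\<dots> \<le> (?k / 2 + norm v) * norm M * ?e' + ?k / 2 * (4 / r * ?e')"
    by (intro add_mono mult_left_mono ee mult_exp_neg_le q r) auto
  also have "\<dots> = ((?k / 2 + norm v) * norm M + 2 * ?k / r) * ?e'" by (simp add: algebra_simps)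
  also have "\<dots> \<le> ((?k / 2 + norm v + 2 * ?k / r) * (1 + norm M)) * ?e'"
  proof (intro mult_right_mono)
    have id: "(\<alpha> + \<beta>) * (1 + x) = \<alpha> * x + \<beta> + (\<alpha> + \<beta> * x)" for \<alpha> \<beta> x :: real
      by (simp add: algebra_simps)
    show "(?k / 2 + norm v) * norm M + 2 * ?k / r \<le> (?k / 2 + norm v + 2 * ?k / r) * (1 + norm M)"
      unfolding id using r by simp
  qed simp
  finally show ?thesis .
qed

lemma lborel_reflect_integral:
  fixes F :: "'v::euclidean_space \<Rightarrow> 'b::{banach, second_countable_topology}"
  assumes [measurable]: "F \<in> borel_measurable borel"
  shows "(\<integral>x. F (a - x) \<partial>lborel) = (\<integral>x. F x \<partial>lborel)"
    and "integrable lborel F \<Longrightarrow> integrable lborel (\<lambda>x. F (a - x))"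
proof -
  have eq: "distr lborel borel (\<lambda>x :: 'v. a - x) = lborel"
    using lborel_affine[of "-1" a] by (simp add: density_1)
  show "(\<integral>x. F (a - x) \<partial>lborel) = (\<integral>x. F x \<partial>lborel)"
    by (subst (2) eq[symmetric], subst integral_distr) auto
  assume "integrable lborel F"
  then have "integrable (distr lborel borel (\<lambda>x. a - x)) F" unfolding eq .
  then show "integrable lborel (\<lambda>x. F (a - x))" by (rule integrable_distr[rotated]) simp
qed

text \<open>The weight is symmetric about \<open>m\<close>, so averaging the integrand with its reflection replaces \<open>\<mu>\<close>
by \<open>m\<close>.\<close>

lemma gauss_linear_mean:
  fixes \<Sigma> :: "real^'k^'k" and m b :: "real^'k"
  assumes r: "0 < r" and \<Sigma>: "pos_def \<Sigma>"
  shows "(\<integral>\<mu>. exp (- (1/2) * r * ((\<mu> - m) \<bullet> (matrix_inv \<Sigma> *v (\<mu> - m))))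
      *\<^sub>R (matrix_inv \<Sigma> *v (\<mu> - b)) \<partial>lborel)
    = (sqrt (det \<Sigma>) * gauss_const TYPE(real^'k) r) *\<^sub>R (matrix_inv \<Sigma> *v (m - b))"
proof -
  let ?M = "matrix_inv \<Sigma>"
  have M: "pos_def ?M" by (rule pos_def_matrix_inv[OF \<Sigma>])
  define e where "e c \<mu> = exp (- (1/2) * c * ((\<mu> - m) \<bullet> (?M *v (\<mu> - m))))" for c :: real and \<mu>
  have [measurable]: "e c \<in> borel_measurable borel" for c unfolding e_def by measurable
  have inte: "integrable lborel (e c)" "(\<integral>\<mu>. e c \<mu> \<partial>lborel)
      = sqrt (det \<Sigma>) * gauss_const TYPE(real^'k) c" if "0 < c" for c
  proof -
    have nn: "(\<integral>\<^sup>+\<mu>. ennreal (e c \<mu>) \<partial>lborel) = ennreal (sqrt (det \<Sigma>) * gauss_const TYPE(real^'k) c)"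
      unfolding e_def by (rule nn_integral_gauss_quad[OF that \<Sigma>])
    then show "integrable lborel (e c)" by (intro integrableI_nonneg) (auto simp: e_def)
    show "(\<integral>\<mu>. e c \<mu> \<partial>lborel) = sqrt (det \<Sigma>) * gauss_const TYPE(real^'k) c"
      using nn_integral_gauss_const(2)[OF that, where 'v="real^'k"] pos_def_det[OF \<Sigma>]
      by (subst integral_eq_nn_integral) (auto simp: nn e_def[symmetric], auto simp: e_def less_imp_le)
  qed
  define F where "F \<mu> = e r \<mu> *\<^sub>R (?M *v (\<mu> - b))" for \<mu>
  have [measurable]: "F \<in> borel_measurable borel" unfolding F_def by measurable
  define C where "C = (real CARD('k) / 2 + norm (m - b) + 2 * real CARD('k) / r) * (1 + norm ?M)"
  have intF: "integrable lborel F"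
  proof (rule Bochner_Integration.integrable_bound)
    show "integrable lborel (\<lambda>\<mu>. C * e (r / 2) \<mu>)" using r inte(1)[of "r / 2"] by simp
    have "norm (F \<mu>) \<le> C * e (r / 2) \<mu>" for \<mu>
      using norm_gauss_weight_le[OF M r, of "\<mu> - m" "m - b"] by (simp add: F_def e_def C_def)
    then show "AE \<mu> in lborel. norm (F \<mu>) \<le> norm (C * e (r / 2) \<mu>)"
      by (intro AE_I2) (auto intro: order_trans[OF _ abs_ge_self])
  qed simp
  have "(\<integral>\<mu>. F \<mu> \<partial>lborel) + (\<integral>\<mu>. F \<mu> \<partial>lborel) = (\<integral>\<mu>. F \<mu> \<partial>lborel) + (\<integral>\<mu>. F (2 *\<^sub>R m - \<mu>) \<partial>lborel)"
    by (simp add: lborel_reflect_integral(1))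
  also have "\<dots> = (\<integral>\<mu>. F \<mu> + F (2 *\<^sub>R m - \<mu>) \<partial>lborel)"
    by (rule Bochner_Integration.integral_add[symmetric, OF intF lborel_reflect_integral(2)[OF _ intF]])
        simp
  also have "\<dots> = (\<integral>\<mu>. (2 * e r \<mu>) *\<^sub>R (?M *v (m - b)) \<partial>lborel)"
  proof (rule Bochner_Integration.integral_cong[OF refl])
    fix \<mu>
    have neg: "2 *\<^sub>R m - \<mu> - m = - (\<mu> - m)" by (simp add: scaleR_2)
    have quad: "- y \<bullet> (?M *v (- y)) = y \<bullet> (?M *v y)" for y
      using linear_neg[OF matrix_vector_mul_linear[of ?M], of y] by simp
    have "e r (2 *\<^sub>R m - \<mu>) = e r \<mu>" unfolding e_def neg quad ..
    moreover have "?M *v (\<mu> - b) + ?M *v (2 *\<^sub>R m - \<mu> - b) = 2 *\<^sub>R (?M *v (m - b))"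
      unfolding matrix_vector_right_distrib[symmetric] matrix_vector_mult_scaleR[symmetric]
      by (simp add: scaleR_2 algebra_simps)
    ultimately show "F \<mu> + F (2 *\<^sub>R m - \<mu>) = (2 * e r \<mu>) *\<^sub>R (?M *v (m - b))"
      unfolding F_def by (simp add: scaleR_add_right[symmetric])
  qed
  also have "\<dots> = (\<integral>\<mu>. 2 * e r \<mu> \<partial>lborel) *\<^sub>R (?M *v (m - b))"
    using inte(1)[OF r] by (intro integral_scaleR_left) auto
  also have "\<dots> = 2 *\<^sub>R ((sqrt (det \<Sigma>) * gauss_const TYPE(real^'k) r) *\<^sub>R (?M *v (m - b)))"
    by (simp add: inte(2)[OF r])
  finally have "2 *\<^sub>R (\<integral>\<mu>. F \<mu> \<partial>lborel) = 2 *\<^sub>R ((sqrt (det \<Sigma>) * gauss_const TYPE(real^'k) r)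
      *\<^sub>R (?M *v (m - b)))"
    by (simp add: scaleR_2)
  then show ?thesis unfolding scaleR_cancel_left F_def[abs_def] e_def by simp
qed

section \<open>The normal-inverse-Wishart posterior\<close>

text \<open>The unnormalised joint density for \<open>\<Sigma>\<close> inverse Wishart with parameters \<open>d\<close> and \<open>S\<close>, and \<open>\<mu>\<close>
given \<open>\<Sigma>\<close> normal with mean \<open>m\<close> and covariance matrix \<open>\<Sigma> / r\<close>. The power \<open>-1/2\<close> of the determinant
belongs to the normal density.\<close>

definition niw_kernel :: "real \<Rightarrow> real^'k \<Rightarrow> real \<Rightarrow> real^'k^'k \<Rightarrow> real^'k \<Rightarrow> real^'k^'k \<Rightarrow> real" where
  "niw_kernel r m d S \<mu> \<Sigma> =
     det \<Sigma> powr (- 1 / 2) * inv_wishart_kernel d S \<Sigma>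
     * exp (- (1/2) * r * ((\<mu> - m) \<bullet> (matrix_inv \<Sigma> *v (\<mu> - m))))"

lemma niw_kernel_nonneg [simp]: "0 \<le> niw_kernel r m d S \<mu> \<Sigma>"
  by (simp add: niw_kernel_def)

lemma fst_param_measurable [measurable]: "fst \<in> borel_measurable
    (param_measure :: ((real^'k) \<times> (real^'k^'k)) measure)"
  unfolding param_measure_def by measurable

lemma snd_param_measurable [measurable]: "snd \<in> borel_measurable
    (param_measure :: ((real^'k) \<times> (real^'k^'k)) measure)"
proof -
  have "(\<lambda>x. x) \<in> measurable lborel_pd (borel :: (real^'k^'k) measure)" by (rule measurable_lborel_pd) simp
  then show ?thesis unfolding param_measure_def by (rule measurable_compose[OF measurable_snd])
qed

lemma space_param_measure: "space param_measure = UNIV \<times> {\<Sigma>. pos_def \<Sigma>}"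
  by (simp add: param_measure_def space_pair_measure)

lemma nn_integral_param_measure:
  assumes [measurable]: "(\<lambda>(\<mu>, \<Sigma>). f \<mu> \<Sigma>) \<in> borel_measurable
      (param_measure :: ((real^'k) \<times> (real^'k^'k)) measure)"
  shows "(\<integral>\<^sup>+(\<mu>, \<Sigma>). f \<mu> \<Sigma> \<partial>(param_measure :: ((real^'k) \<times> (real^'k^'k)) measure))
      = (\<integral>\<^sup>+\<Sigma>. \<integral>\<^sup>+\<mu>. f \<mu> \<Sigma> \<partial>lborel \<partial>lborel_pd)"
proof -
  interpret P: sigma_finite_measure "lborel_pd :: (real^'k^'k) measure" by (rule sigma_finite_lborel_pd)
  interpret pair_sigma_finite "lborel :: (real^'k) measure" "lborel_pd :: (real^'k^'k) measure" ..
  show ?thesis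
    using nn_integral_snd[of "\<lambda>(\<mu>, \<Sigma>). f \<mu> \<Sigma>"] assms unfolding param_measure_def by simp
qed

lemma integral_param_measure:
  fixes f :: "real^'k \<Rightarrow> real^'k^'k \<Rightarrow> 'b::{banach, second_countable_topology}"
  assumes "integrable param_measure (\<lambda>(\<mu>, \<Sigma>). f \<mu> \<Sigma>)"
  shows "(\<integral>(\<mu>, \<Sigma>). f \<mu> \<Sigma> \<partial>param_measure) = (\<integral>\<Sigma>. \<integral>\<mu>. f \<mu> \<Sigma> \<partial>lborel \<partial>lborel_pd)"
proof -
  interpret P: sigma_finite_measure "lborel_pd :: (real^'k^'k) measure" by (rule sigma_finite_lborel_pd)
  interpret pair_sigma_finite "lborel :: (real^'k) measure" "lborel_pd :: (real^'k^'k) measure" ..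
  show ?thesis using integral_snd[of f] assms unfolding param_measure_def by simp
qed

text \<open>Integrating the mean vector out gives \<open>sqrt (det \<Sigma>)\<close>, which cancels the power \<open>-1/2\<close> of the
determinant and leaves the inverse Wishart kernel.\<close>

lemma nn_integral_niw_kernel_weighted:
  fixes S :: "real^'k^'k" and m :: "real^'k" and h :: "real^'k^'k \<Rightarrow> real"
  assumes r: "0 < r" and [measurable]: "h \<in> borel_measurable borel" and h: "\<And>\<Sigma>. 0 \<le> h \<Sigma>"
  shows "(\<integral>\<^sup>+(\<mu>, \<Sigma>). ennreal (h \<Sigma> * niw_kernel r m d S \<mu> \<Sigma>) \<partial>param_measure)
    = ennreal (gauss_const TYPE(real^'k) r) * (\<integral>\<^sup>+\<Sigma>. ennreal (h \<Sigma> * inv_wishart_kernel d S \<Sigma>) \<partial>lborel_pd)"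
proof -
  let ?G = "gauss_const TYPE(real^'k) r"
  have G: "0 < ?G" by (rule nn_integral_gauss_const(2)[OF r])
  have "(\<integral>\<^sup>+(\<mu>, \<Sigma>). ennreal (h \<Sigma> * niw_kernel r m d S \<mu> \<Sigma>) \<partial>param_measure)
    = (\<integral>\<^sup>+\<Sigma>. \<integral>\<^sup>+\<mu>. ennreal (h \<Sigma> * niw_kernel r m d S \<mu> \<Sigma>) \<partial>lborel \<partial>lborel_pd)"
    by (rule nn_integral_param_measure) (unfold niw_kernel_def split_beta', measurable)
  also have "\<dots> = (\<integral>\<^sup>+\<Sigma>. ennreal ?G * ennreal (h \<Sigma> * inv_wishart_kernel d S \<Sigma>) \<partial>lborel_pd)"
  proof (rule nn_integral_cong)
    fix \<Sigma> :: "real^'k^'k" assume "\<Sigma> \<in> space lborel_pd"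
    then have \<Sigma>: "pos_def \<Sigma>" by simp
    have det: "0 < det \<Sigma>" by (rule pos_def_det[OF \<Sigma>])
    let ?c = "h \<Sigma> * (det \<Sigma> powr (- 1 / 2) * inv_wishart_kernel d S \<Sigma>)"
    have "(\<integral>\<^sup>+\<mu>. ennreal (h \<Sigma> * niw_kernel r m d S \<mu> \<Sigma>) \<partial>lborel)
      = (\<integral>\<^sup>+\<mu>. ennreal ?c * ennreal (exp (- (1/2) * r * ((\<mu> - m) \<bullet> (matrix_inv \<Sigma> *v (\<mu> - m))))) \<partial>lborel)"
    proof (rule nn_integral_cong)
      fix \<mu>
      show "ennreal (h \<Sigma> * niw_kernel r m d S \<mu> \<Sigma>)
          = ennreal ?c * ennreal (exp (- (1/2) * r * ((\<mu> - m) \<bullet> (matrix_inv \<Sigma> *v (\<mu> - m)))))"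
        unfolding niw_kernel_def by (subst ennreal_mult[symmetric]) (auto simp: h mult.assoc)
    qed
    also have "\<dots> = ennreal ?c * ennreal (sqrt (det \<Sigma>) * ?G)"
      by (subst nn_integral_cmult) (measurable, simp only: nn_integral_gauss_quad[OF r \<Sigma>])
    also have "\<dots> = ennreal (?c * (sqrt (det \<Sigma>) * ?G))"
      using det G by (subst ennreal_mult) (auto simp: h)
    also have "?c * (sqrt (det \<Sigma>) * ?G) = ?G * (h \<Sigma> * inv_wishart_kernel d S \<Sigma>)"
    proof -
      have "det \<Sigma> powr (- 1 / 2) * sqrt (det \<Sigma>) = 1"
        using det by (simp add: powr_half_sqrt[symmetric] powr_add[symmetric])
      moreover have "?c * (sqrt (det \<Sigma>) * ?G)
          = (det \<Sigma> powr (- 1 / 2) * sqrt (det \<Sigma>)) * (?G * (h \<Sigma> * inv_wishart_kernel d S \<Sigma>))"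
        by (simp only: mult_ac)
      ultimately show ?thesis by simp
    qed
    also have "ennreal (?G * (h \<Sigma> * inv_wishart_kernel d S \<Sigma>))
        = ennreal ?G * ennreal (h \<Sigma> * inv_wishart_kernel d S \<Sigma>)"
      using G by (intro ennreal_mult) (auto simp: h)
    finally show "(\<integral>\<^sup>+\<mu>. ennreal (h \<Sigma> * niw_kernel r m d S \<mu> \<Sigma>) \<partial>lborel)
        = ennreal ?G * ennreal (h \<Sigma> * inv_wishart_kernel d S \<Sigma>)" .
  qed
  also have "\<dots> = ennreal ?G * (\<integral>\<^sup>+\<Sigma>. ennreal (h \<Sigma> * inv_wishart_kernel d S \<Sigma>) \<partial>lborel_pd)"
    by (rule nn_integral_cmult, rule measurable_lborel_pd) measurable
  finally show ?thesis .
qed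

lemma niw_integrable:
  fixes S :: "real^'k^'k" and m b :: "real^'k"
  assumes r: "0 < r" and d: "2 * real CARD('k) < d" and S: "pos_def S"
  shows "integrable param_measure (\<lambda>(\<mu>, \<Sigma>). niw_kernel r m d S \<mu> \<Sigma> *\<^sub>R (matrix_inv \<Sigma> *v (\<mu> - b)))"
proof -
  define C where "C = real CARD('k) / 2 + norm (m - b) + 2 * real CARD('k) / r"
  have C: "0 \<le> C" using r by (simp add: C_def)
  let ?h = "\<lambda>\<Sigma> :: real^'k^'k. C * (1 + norm (matrix_inv \<Sigma>))"
  let ?K = "inv_wishart_kernel d S"
  have "(\<integral>\<^sup>+(\<mu>, \<Sigma>). ennreal (?h \<Sigma> * niw_kernel (r / 2) m d S \<mu> \<Sigma>) \<partial>param_measure) < \<infinity>"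
  proof -
    have "integrable lborel_pd (\<lambda>\<Sigma>. C * (?K \<Sigma> + norm (?K \<Sigma> *\<^sub>R matrix_inv \<Sigma>)))"
      by (intro integrable_mult_right Bochner_Integration.integrable_add integrable_norm
          integrable_inv_wishart_kernel[OF d S] inv_wishart_precision_mean(1)[OF d S])
    also have "(\<lambda>\<Sigma>. C * (?K \<Sigma> + norm (?K \<Sigma> *\<^sub>R matrix_inv \<Sigma>))) = (\<lambda>\<Sigma>. ?h \<Sigma> * ?K \<Sigma>)"
      by (simp add: algebra_simps)
    finally have i: "integrable lborel_pd (\<lambda>\<Sigma>. ?h \<Sigma> * ?K \<Sigma>)" .
    have "(\<integral>\<^sup>+\<Sigma>. ennreal (?h \<Sigma> * ?K \<Sigma>) \<partial>lborel_pd) < \<infinity>"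
      by (subst nn_integral_eq_integral[OF i]) (use C in auto)
    then show ?thesis
      using r C by (subst nn_integral_niw_kernel_weighted) (auto simp: ennreal_mult_less_top)
  qed
  then have dom: "integrable param_measure (\<lambda>(\<mu>, \<Sigma>). ?h \<Sigma> * niw_kernel (r / 2) m d S \<mu> \<Sigma>)"
    using C unfolding split_beta' by (intro integrableI_nonneg) (auto simp: niw_kernel_def)
  show ?thesis
  proof (rule Bochner_Integration.integrable_bound[OF dom])
    show "(\<lambda>(\<mu>, \<Sigma>). niw_kernel r m d S \<mu> \<Sigma> *\<^sub>R (matrix_inv \<Sigma> *v (\<mu> - b))) \<in> borel_measurable param_measure"
      unfolding niw_kernel_def split_beta' by measurable
    show "AE x in param_measure. norm (case x of (\<mu>, \<Sigma>) \<Rightarrow> niw_kernel r m d S \<mu> \<Sigma>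
        *\<^sub>R (matrix_inv \<Sigma> *v (\<mu> - b)))
      \<le> norm (case x of (\<mu>, \<Sigma>) \<Rightarrow> ?h \<Sigma> * niw_kernel (r / 2) m d S \<mu> \<Sigma>)"
    proof (rule AE_I2, clarify)
      fix \<mu> :: "real^'k" and \<Sigma> :: "real^'k^'k" assume "(\<mu>, \<Sigma>) \<in> space param_measure"
      then have M: "pos_def (matrix_inv \<Sigma>)" by (simp add: space_param_measure pos_def_matrix_inv)
      let ?w = "det \<Sigma> powr (- 1 / 2) * ?K \<Sigma>"
      have "?w * (exp (- (1/2) * r * ((\<mu> - m) \<bullet> (matrix_inv \<Sigma> *v (\<mu> - m))))
          * norm (matrix_inv \<Sigma> *v (\<mu> - b)))
        \<le> ?w * (C * (1 + norm (matrix_inv \<Sigma>)) * exp (- (1/2) * (r / 2) * ((\<mu> - m) \<bullet> (matrix_inv \<Sigma> *v (\<mu>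
            - m)))))"
        using norm_gauss_weight_le[OF M r, of "\<mu> - m" "m - b"] by (intro mult_left_mono) (auto simp: C_def)
      then show "norm (niw_kernel r m d S \<mu> \<Sigma> *\<^sub>R (matrix_inv \<Sigma> *v (\<mu> - b)))
          \<le> norm (?h \<Sigma> * niw_kernel (r / 2) m d S \<mu> \<Sigma>)"
        using C by (simp add: niw_kernel_def abs_mult mult_ac)
    qed
  qed
qed

lemma niw_mean:
  fixes S :: "real^'k^'k" and m b :: "real^'k"
  assumes r: "0 < r" and d: "2 * real CARD('k) < d" and S: "pos_def S"
  shows "(\<integral>(\<mu>, \<Sigma>). niw_kernel r m d S \<mu> \<Sigma> *\<^sub>R (matrix_inv \<Sigma> *v (\<mu> - b)) \<partial>param_measure)
    = (gauss_const TYPE(real^'k) r * ((d - real CARD('k) - 1) * (\<integral>\<Sigma>. inv_wishart_kernel d S \<Sigma> \<partial>lborel_pd)))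
      *\<^sub>R (matrix_inv S *v (m - b))"
proof -
  let ?G = "gauss_const TYPE(real^'k) r" and ?K = "inv_wishart_kernel d S"
  have bl: "bounded_linear (\<lambda>M :: real^'k^'k. M *v (m - b))"
    by (intro linear_conv_bounded_linear[THEN iffD1] linearI)
      (simp_all add: matrix_vector_mult_add_rdistrib scaleR_matrix_vector_assoc)
  have "(\<integral>(\<mu>, \<Sigma>). niw_kernel r m d S \<mu> \<Sigma> *\<^sub>R (matrix_inv \<Sigma> *v (\<mu> - b)) \<partial>param_measure)
    = (\<integral>\<Sigma>. \<integral>\<mu>. niw_kernel r m d S \<mu> \<Sigma> *\<^sub>R (matrix_inv \<Sigma> *v (\<mu> - b)) \<partial>lborel \<partial>lborel_pd)"
    by (rule integral_param_measure[OF niw_integrable[OF assms]])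
  also have "\<dots> = (\<integral>\<Sigma>. ?G *\<^sub>R ((?K \<Sigma> *\<^sub>R matrix_inv \<Sigma>) *v (m - b)) \<partial>lborel_pd)"
  proof (rule Bochner_Integration.integral_cong[OF refl])
    fix \<Sigma> :: "real^'k^'k" assume "\<Sigma> \<in> space lborel_pd"
    then have \<Sigma>: "pos_def \<Sigma>" by simp
    have det: "0 < det \<Sigma>" by (rule pos_def_det[OF \<Sigma>])
    have one: "det \<Sigma> powr (- 1 / 2) * sqrt (det \<Sigma>) = 1"
      using det by (simp add: powr_half_sqrt[symmetric] powr_add[symmetric])
    have "(\<integral>\<mu>. niw_kernel r m d S \<mu> \<Sigma> *\<^sub>R (matrix_inv \<Sigma> *v (\<mu> - b)) \<partial>lborel)
      = (\<integral>\<mu>. (det \<Sigma> powr (- 1 / 2) * ?K \<Sigma>) *\<^sub>R (exp (- (1/2) * r * ((\<mu> - m) \<bullet> (matrix_inv \<Sigma> *v (\<mu>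
          - m)))) *\<^sub>R (matrix_inv \<Sigma> *v (\<mu> - b))) \<partial>lborel)"
      by (simp only: niw_kernel_def scaleR_scaleR)
    also have "\<dots> = (det \<Sigma> powr (- 1 / 2) * ?K \<Sigma>) *\<^sub>R ((sqrt (det \<Sigma>) * ?G) *\<^sub>R (matrix_inv \<Sigma> *v (m - b)))"
      unfolding gauss_linear_mean[OF r \<Sigma>, symmetric] by (rule Bochner_Integration.integral_scaleR_right)
    also have "\<dots> = ((det \<Sigma> powr (- 1 / 2) * sqrt (det \<Sigma>)) * (?G * ?K \<Sigma>)) *\<^sub>R (matrix_inv \<Sigma> *v (m - b))"
      by (simp only: scaleR_scaleR mult_ac)
    also have "\<dots> = ?G *\<^sub>R ((?K \<Sigma> *\<^sub>R matrix_inv \<Sigma>) *v (m - b))"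
      unfolding one by (simp add: scaleR_matrix_vector_assoc[symmetric])
    finally show "(\<integral>\<mu>. niw_kernel r m d S \<mu> \<Sigma> *\<^sub>R (matrix_inv \<Sigma> *v (\<mu> - b)) \<partial>lborel)
        = ?G *\<^sub>R ((?K \<Sigma> *\<^sub>R matrix_inv \<Sigma>) *v (m - b))" .
  qed
  also have "\<dots> = ?G *\<^sub>R (\<integral>\<Sigma>. (?K \<Sigma> *\<^sub>R matrix_inv \<Sigma>) *v (m - b) \<partial>lborel_pd)"
    by (rule Bochner_Integration.integral_scaleR_right)
  also have "(\<integral>\<Sigma>. (?K \<Sigma> *\<^sub>R matrix_inv \<Sigma>) *v (m - b) \<partial>lborel_pd)
      = (\<integral>\<Sigma>. ?K \<Sigma> *\<^sub>R matrix_inv \<Sigma> \<partial>lborel_pd) *v (m - b)"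
    by (rule integral_bounded_linear[OF bl inv_wishart_precision_mean(1)[OF d S]])
  also have "\<dots> = ((d - real CARD('k) - 1) * (\<integral>\<Sigma>. ?K \<Sigma> \<partial>lborel_pd)) *\<^sub>R (matrix_inv S *v (m - b))"
    unfolding inv_wishart_precision_mean(2)[OF d S] by (simp add: scaleR_matrix_vector_assoc)
  finally show ?thesis by simp
qed

text \<open>Any prior whose product with the likelihood is proportional to the kernel gives the same posterior,
as the factor cancels in the normalisation. Both priors below are instances.\<close>

theorem niw_posterior:
  fixes S :: "real^'k^'k" and m :: "real^'k"
  assumes r: "0 < r" and d: "2 * real CARD('k) < d" and S: "pos_def S" and \<kappa>: "0 < \<kappa>"
    and ker: "\<And>\<mu> \<Sigma>. pos_def \<Sigma> \<Longrightarrow> likelihood t n x \<mu> \<Sigma> * prior \<mu> \<Sigma> = \<kappa> * niw_kernel r m d S \<mu> \<Sigma>"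
  shows "posterior_mean_exists prior t n x (opt_weights \<gamma> W rf T t)"
    and "posterior_mean prior t n x (opt_weights \<gamma> W rf T t)
      = (C_coef \<gamma> W rf T t * (d - real CARD('k) - 1)) *\<^sub>R (matrix_inv S *v (m - rf (t + 1) *\<^sub>R ones))"
proof -
  let ?G = "gauss_const TYPE(real^'k) r" and ?K = "inv_wishart_kernel d S"
  let ?q = "\<lambda>\<mu> \<Sigma>. niw_kernel r m d S \<mu> \<Sigma>"
  define Z where "Z = (\<integral>\<Sigma>. ?K \<Sigma> \<partial>lborel_pd)"
  define b :: "real^'k" where "b = rf (t + 1) *\<^sub>R ones"
  define c where "c = C_coef \<gamma> W rf T t"
  have Z: "0 < Z" unfolding Z_def by (rule integral_inv_wishart_kernel_pos[OF d S])
  have G: "0 < ?G" by (rule nn_integral_gauss_const(2)[OF r])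
  have Nq: "(\<integral>\<^sup>+(\<mu>, \<Sigma>). ennreal (?q \<mu> \<Sigma>) \<partial>param_measure) = ennreal (?G * Z)"
  proof -
    have "(\<integral>\<^sup>+\<Sigma>. ennreal (?K \<Sigma>) \<partial>lborel_pd) = ennreal Z"
      unfolding Z_def by (rule nn_integral_eq_integral[OF integrable_inv_wishart_kernel[OF d S]]) simp
    then show ?thesis
      using nn_integral_niw_kernel_weighted[OF r, of "\<lambda>_. 1" m d S] G Z by (simp add: ennreal_mult)
  qed
  have qm: "(\<lambda>p. case p of (\<mu>, \<Sigma>) \<Rightarrow> ennreal (?q \<mu> \<Sigma>)) \<in> borel_measurable param_measure"
    unfolding niw_kernel_def split_beta' by measurable
  have N: "(\<integral>\<^sup>+(\<mu>, \<Sigma>). ennreal (likelihood t n x \<mu> \<Sigma> * prior \<mu> \<Sigma>) \<partial>param_measure) = ennreal (\<kappa> * (?G * Z))"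
  proof -
    have "(\<integral>\<^sup>+(\<mu>, \<Sigma>). ennreal (likelihood t n x \<mu> \<Sigma> * prior \<mu> \<Sigma>) \<partial>param_measure)
       = (\<integral>\<^sup>+p. ennreal \<kappa> * (case p of (\<mu>, \<Sigma>) \<Rightarrow> ennreal (?q \<mu> \<Sigma>)) \<partial>param_measure)"
      using \<kappa> by (intro nn_integral_cong) (auto simp: space_param_measure ker ennreal_mult)
    also have "\<dots> = ennreal \<kappa> * ennreal (?G * Z)"
      by (simp only: nn_integral_cmult[OF qm] Nq)
    finally show ?thesis using \<kappa> G Z by (simp add: ennreal_mult)
  qed
  define D where "D p = (case p of (\<mu>, \<Sigma>) \<Rightarrow> ?q \<mu> \<Sigma> / (?G * Z))" for p
  have [measurable]: "D \<in> borel_measurable param_measure"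
    unfolding D_def niw_kernel_def split_beta' by measurable
  have D0: "0 \<le> D p" for p using G Z by (auto simp: D_def split: prod.split)
  have dens: "(case p of (\<mu>, \<Sigma>) \<Rightarrow> ennreal (likelihood t n x \<mu> \<Sigma> * prior \<mu> \<Sigma>)
       / (\<integral>\<^sup>+(\<mu>', \<Sigma>'). ennreal (likelihood t n x \<mu>' \<Sigma>' * prior \<mu>' \<Sigma>') \<partial>param_measure)) = ennreal (D p)"
    if "p \<in> space param_measure" for p
    using that \<kappa> G Z unfolding N by (auto simp: space_param_measure ker D_def divide_ennreal)
  have post: "posterior prior t n x = density param_measure (\<lambda>p. ennreal (D p))"
    unfolding posterior_def
  proof (rule density_cong)
    show "(\<lambda>(\<mu>, \<Sigma>). ennreal (likelihood t n x \<mu> \<Sigma> * prior \<mu> \<Sigma>)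
       / (\<integral>\<^sup>+(\<mu>', \<Sigma>'). ennreal (likelihood t n x \<mu>' \<Sigma>'
           * prior \<mu>' \<Sigma>') \<partial>param_measure)) \<in> borel_measurable param_measure"
      by (subst measurable_cong[OF dens]) simp_all
  qed (use dens in auto)
  have prob: "prob_space (posterior prior t n x)"
  proof (rule prob_spaceI)
    have "emeasure (posterior prior t n x) (space (posterior prior t n x))
        = (\<integral>\<^sup>+p. ennreal (D p) \<partial>param_measure)"
      unfolding post by (simp add: emeasure_density cong: nn_integral_cong)
    also have "\<dots> = (\<integral>\<^sup>+p. ennreal (1 / (?G * Z)) * (case p of (\<mu>, \<Sigma>) \<Rightarrow> ennreal (?q \<mu> \<Sigma>)) \<partial>param_measure)"
      using G Z by (intro nn_integral_cong) (auto simp: D_def ennreal_mult[symmetric] split: prod.split)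
    also have "\<dots> = ennreal (1 / (?G * Z)) * ennreal (?G * Z)"
      by (simp only: nn_integral_cmult[OF qm] Nq)
    also have "\<dots> = 1" using G Z by (simp add: ennreal_mult[symmetric])
    finally show "emeasure (posterior prior t n x) (space (posterior prior t n x)) = 1" .
  qed
  have w: "(\<lambda>(\<mu>, \<Sigma>). opt_weights \<gamma> W rf T t \<mu> \<Sigma>) = (\<lambda>p. c *\<^sub>R (matrix_inv (snd p) *v (fst p - b)))"
    by (auto simp: opt_weights_def c_def b_def)
  have wm: "(\<lambda>p. c *\<^sub>R (matrix_inv (snd p) *v (fst p - b))) \<in> borel_measurable param_measure"
    by measurable
  have Dw: "(\<lambda>p. D p *\<^sub>R (c *\<^sub>R (matrix_inv (snd p) *v (fst p - b))))
    = (\<lambda>p. (c / (?G * Z)) *\<^sub>R (case p of (\<mu>, \<Sigma>) \<Rightarrow> ?q \<mu> \<Sigma> *\<^sub>R (matrix_inv \<Sigma> *v (\<mu> - b))))"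
    by (auto simp: D_def mult_ac)
  have int: "integrable param_measure (\<lambda>p. D p *\<^sub>R (c *\<^sub>R (matrix_inv (snd p) *v (fst p - b))))"
    unfolding Dw by (intro integrable_scaleR_right niw_integrable[OF r d S])
  have "integrable (posterior prior t n x) (\<lambda>(\<mu>, \<Sigma>). opt_weights \<gamma> W rf T t \<mu> \<Sigma>)"
    unfolding post w by (subst integrable_density[OF wm]) (auto simp: D0 int simp del: scaleR_scaleR)
  with prob show "posterior_mean_exists prior t n x (opt_weights \<gamma> W rf T t)"
    by (simp add: posterior_mean_exists_def)
  have "posterior_mean prior t n x (opt_weights \<gamma> W rf T t)
      = (\<integral>p. D p *\<^sub>R (c *\<^sub>R (matrix_inv (snd p) *v (fst p - b))) \<partial>param_measure)"
    unfolding posterior_mean_def post w by (subst integral_density[OF wm]) (auto simp: D0)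
  also have "\<dots> = (c / (?G * Z)) *\<^sub>R ((?G * ((d - real CARD('k) - 1) * Z)) *\<^sub>R (matrix_inv S *v (m - b)))"
    unfolding Dw Z_def niw_mean[OF r d S, symmetric] by (rule Bochner_Integration.integral_scaleR_right)
  also have "\<dots> = (c * (d - real CARD('k) - 1)) *\<^sub>R (matrix_inv S *v (m - b))"
    using G Z by simp
  finally show "posterior_mean prior t n x (opt_weights \<gamma> W rf T t)
      = (C_coef \<gamma> W rf T t * (d - real CARD('k) - 1)) *\<^sub>R (matrix_inv S *v (m - rf (t + 1) *\<^sub>R ones))"
    by (simp add: b_def c_def)
qed

section \<open>Likelihood, priors and completing the square\<close>

lemma trace_outer_mult: "trace (outer u u ** M) = u \<bullet> (M *v u)" for M :: "real^'k^'k"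
proof -
  have "trace (outer u u ** M) = (\<Sum>i\<in>UNIV. \<Sum>j\<in>UNIV. u $ i * u $ j * M $ j $ i)"
    by (simp add: trace_def matrix_matrix_mult_def outer_def)
  also have "\<dots> = (\<Sum>j\<in>UNIV. \<Sum>i\<in>UNIV. u $ i * u $ j * M $ j $ i)" by (rule sum.swap)
  also have "\<dots> = u \<bullet> (M *v u)"
    by (simp add: inner_vec_def matrix_vector_mult_def sum_distrib_left mult_ac)
  finally show ?thesis .
qed

lemma linear_trace_mult: "linear (\<lambda>A. trace (A ** M))" for M :: "real^'k^'k"
  by (rule linearI) (simp_all add: trace_def matrix_matrix_mult_def algebra_simps sum.distrib
      sum_distrib_left)

lemma card_obs_times [simp]: "card (obs_times t n) = n"
  by (simp add: obs_times_def)

lemma finite_obs_times [simp]: "finite (obs_times t n)"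
  by (simp add: obs_times_def)

lemma S_d_eq_sum:
  assumes "1 < n"
  shows "S_d t n x = (\<Sum>i\<in>obs_times t n. outer (x i - sample_mean t n x) (x i - sample_mean t n x))"
  using assms by (simp add: S_d_def sample_cov_def)

lemma quad_expand:
  fixes M :: "real^'k^'k"
  assumes M: "pos_def M"
  shows "(u + c *\<^sub>R v) \<bullet> (M *v (u + c *\<^sub>R v))
      = u \<bullet> (M *v u) + 2 * c * (v \<bullet> (M *v u)) + c\<^sup>2 * (v \<bullet> (M *v v))"
  using pos_def_swap[OF M, of u v]
  by (simp add: matrix_vector_right_distrib matrix_vector_mult_scaleR inner_add_left inner_add_right
      power2_eq_square algebra_simps)

text \<open>Deviations from the sample mean sum to 0, so the mixed terms cancel.\<close>

lemma sum_quad_around_mean: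
  fixes M :: "real^'k^'k"
  assumes M: "pos_def M" and n: "1 < n"
  shows "(\<Sum>i\<in>obs_times t n. (x i - \<mu>) \<bullet> (M *v (x i - \<mu>)))
    = real n * ((\<mu> - sample_mean t n x) \<bullet> (M *v (\<mu> - sample_mean t n x))) + trace (S_d t n x ** M)"
proof -
  let ?O = "obs_times t n" and ?m = "sample_mean t n x"
  have z: "(\<Sum>i\<in>?O. x i - ?m) = 0"
    using n by (simp add: sum_subtractf sample_mean_def sum_constant_scaleR del: sum_constant)
  have "(x i - \<mu>) \<bullet> (M *v (x i - \<mu>)) = (x i - ?m) \<bullet> (M *v (x i - ?m))
      - 2 * ((\<mu> - ?m) \<bullet> (M *v (x i - ?m))) + (\<mu> - ?m) \<bullet> (M *v (\<mu> - ?m))" for i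
    using quad_expand[OF M, of "x i - ?m" "-1" "\<mu> - ?m"] by simp
  then have "(\<Sum>i\<in>?O. (x i - \<mu>) \<bullet> (M *v (x i - \<mu>)))
    = (\<Sum>i\<in>?O. (x i - ?m) \<bullet> (M *v (x i - ?m))) - 2 * (\<Sum>i\<in>?O. (\<mu> - ?m) \<bullet> (M *v (x i - ?m)))
      + real n * ((\<mu> - ?m) \<bullet> (M *v (\<mu> - ?m)))"
    by (simp only: sum.distrib sum_subtractf sum_distrib_left[symmetric] sum_constant card_obs_times)
  also have "(\<Sum>i\<in>?O. (\<mu> - ?m) \<bullet> (M *v (x i - ?m))) = (\<mu> - ?m) \<bullet> (M *v (\<Sum>i\<in>?O. x i - ?m))"
    by (simp only: linear_sum[OF matrix_vector_mul_linear] inner_sum_right)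
  also have "\<dots> = 0" unfolding z by simp
  also have "(\<Sum>i\<in>?O. (x i - ?m) \<bullet> (M *v (x i - ?m))) = trace (S_d t n x ** M)"
    unfolding S_d_eq_sum[OF n] linear_sum[OF linear_trace_mult] by (simp add: trace_outer_mult)
  finally show ?thesis by simp
qed

lemma complete_square:
  fixes M :: "real^'k^'k" and a c :: real
  assumes M: "pos_def M" and ac: "0 < a" "0 < c"
  shows "a * ((\<mu> - u) \<bullet> (M *v (\<mu> - u))) + c * ((\<mu> - v) \<bullet> (M *v (\<mu> - v)))
    = (a + c) * ((\<mu> - (1 / (a + c)) *\<^sub>R (a *\<^sub>R u + c *\<^sub>R v)) \<bullet> (M *v (\<mu> - (1 / (a + c)) *\<^sub>R (a *\<^sub>R u + c
        *\<^sub>R v))))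
      + a * c / (a + c) * ((v - u) \<bullet> (M *v (v - u)))"
proof -
  define p where "p = (1 / (a + c)) *\<^sub>R (a *\<^sub>R u + c *\<^sub>R v)"
  have s: "a + c \<noteq> 0" using ac by simp
  have sp: "(a + c) *\<^sub>R p = a *\<^sub>R u + c *\<^sub>R v" using s by (simp add: p_def)
  have u: "\<mu> - u = (\<mu> - p) + (c / (a + c)) *\<^sub>R (v - u)"
  proof -
    have "(a + c) *\<^sub>R (p - u) = c *\<^sub>R (v - u)" by (simp add: scaleR_diff_right sp) (simp add: algebra_simps)
    then have "(1 / (a + c)) *\<^sub>R ((a + c) *\<^sub>R (p - u)) = (1 / (a + c)) *\<^sub>R (c *\<^sub>R (v - u))" by simp
    then have "p - u = (c / (a + c)) *\<^sub>R (v - u)" using s by simp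
    then show ?thesis by (simp add: algebra_simps)
  qed
  have v: "\<mu> - v = (\<mu> - p) + (- (a / (a + c))) *\<^sub>R (v - u)"
  proof -
    have "(a + c) *\<^sub>R (p - v) = (- a) *\<^sub>R (v - u)"
        by (simp add: scaleR_diff_right sp) (simp add: algebra_simps)
    then have "(1 / (a + c)) *\<^sub>R ((a + c) *\<^sub>R (p - v)) = (1 / (a + c)) *\<^sub>R ((- a) *\<^sub>R (v - u))" by simp
    then have "p - v = (- (a / (a + c))) *\<^sub>R (v - u)" using s by simp
    then show ?thesis by (simp add: algebra_simps)
  qed
  let ?A = "(\<mu> - p) \<bullet> (M *v (\<mu> - p))" and ?B = "(v - u) \<bullet> (M *v (\<mu> - p))" and ?C
      = "(v - u) \<bullet> (M *v (v - u))"
  have "a * ((\<mu> - u) \<bullet> (M *v (\<mu> - u))) + c * ((\<mu> - v) \<bullet> (M *v (\<mu> - v)))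
    = a * (?A + 2 * (c / (a + c)) * ?B + (c / (a + c))\<^sup>2 * ?C) + c * (?A + 2 * (- (a / (a + c))) * ?B
        + (- (a / (a + c)))\<^sup>2 * ?C)"
    unfolding u v quad_expand[OF M] ..
  also have "\<dots> = (a + c) * ?A + a * c / (a + c) * ?C"
  proof -
    have "a * (c / (a + c))\<^sup>2 + c * (a / (a + c))\<^sup>2 = a * c / (a + c)"
    proof -
      have "a * (c / (a + c))\<^sup>2 + c * (a / (a + c))\<^sup>2 = (a * c * (a + c)) / (a + c)\<^sup>2"
        by (simp add: power_divide add_divide_distrib[symmetric] power2_eq_square algebra_simps)
      also have "\<dots> = a * c / (a + c)" using s by (simp add: power2_eq_square)
      finally show ?thesis .
    qed
    then have "(a * (c / (a + c))\<^sup>2 + c * (a / (a + c))\<^sup>2) * ?C = a * c / (a + c) * ?C" by simp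
    then show ?thesis by (simp add: algebra_simps)
  qed
  finally show ?thesis unfolding p_def .
qed

lemma mvnormal_density_powr:
  fixes \<Sigma> :: "real^'k^'k"
  assumes "pos_def \<Sigma>"
  shows "mvnormal_density \<mu> \<Sigma> x = (2 * pi) powr (- real CARD('k) / 2) * det \<Sigma> powr (- 1 / 2)
    * exp (- (1/2) * ((x - \<mu>) \<bullet> (matrix_inv \<Sigma> *v (x - \<mu>))))"
proof -
  have det: "0 < det \<Sigma>" by (rule pos_def_det[OF assms])
  have "sqrt ((2 * pi) ^ CARD('k)) = (2 * pi) powr (real CARD('k) / 2)"
  proof -
    have "(2 * pi) ^ CARD('k) = (2 * pi) powr real CARD('k)" by (rule powr_realpow[symmetric]) simp
    then have "sqrt ((2 * pi) ^ CARD('k)) = ((2 * pi) powr real CARD('k)) powr (1 / 2)"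
      by (simp only: powr_half_sqrt powr_ge_zero)
    then show ?thesis by (simp only: powr_powr) simp
  qed
  moreover have "sqrt (det \<Sigma>) = det \<Sigma> powr (1 / 2)" using det by (simp add: powr_half_sqrt)
  ultimately have "1 / sqrt ((2 * pi) ^ CARD('k) * det \<Sigma>)
      = (2 * pi) powr (- (real CARD('k) / 2)) * det \<Sigma> powr (- (1 / 2))"
    by (simp only: real_sqrt_mult powr_minus inverse_eq_divide) simp
  then show ?thesis by (simp add: mvnormal_density_def)
qed

lemma likelihood_eq:
  fixes \<Sigma> :: "real^'k^'k"
  assumes \<Sigma>: "pos_def \<Sigma>" and n: "1 < n"
  shows "likelihood t n x \<mu> \<Sigma> = ((2 * pi) powr (- real CARD('k) / 2)) ^ n * det \<Sigma> powr (- real n / 2)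
    * exp (- (1/2) * (real n * ((\<mu> - sample_mean t n x) \<bullet> (matrix_inv \<Sigma> *v (\<mu> - sample_mean t n x)))
        + trace (S_d t n x ** matrix_inv \<Sigma>)))"
proof -
  have det: "0 < det \<Sigma>" by (rule pos_def_det[OF \<Sigma>])
  let ?c = "(2 * pi) powr (- real CARD('k) / 2)"
  have "likelihood t n x \<mu> \<Sigma> = (\<Prod>i\<in>obs_times t n. ?c * det \<Sigma> powr (- 1 / 2)
      * exp (- (1/2) * ((x i - \<mu>) \<bullet> (matrix_inv \<Sigma> *v (x i - \<mu>)))))"
    unfolding likelihood_def mvnormal_density_powr[OF \<Sigma>] ..
  also have "\<dots> = ?c ^ n * (det \<Sigma> powr (- 1 / 2)) ^ n
      * exp (\<Sum>i\<in>obs_times t n. - (1/2) * ((x i - \<mu>) \<bullet> (matrix_inv \<Sigma> *v (x i - \<mu>))))"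
    by (simp only: prod.distrib prod_constant card_obs_times exp_sum[OF finite_obs_times])
  also have "(det \<Sigma> powr (- 1 / 2)) ^ n = det \<Sigma> powr (- real n / 2)"
    using det by (simp add: powr_realpow[symmetric] powr_powr)
  also have "(\<Sum>i\<in>obs_times t n. - (1/2) * ((x i - \<mu>) \<bullet> (matrix_inv \<Sigma> *v (x i - \<mu>))))
    = - (1/2) * (real n * ((\<mu> - sample_mean t n x) \<bullet> (matrix_inv \<Sigma> *v (\<mu> - sample_mean t n x)))
        + trace (S_d t n x ** matrix_inv \<Sigma>))"
    unfolding sum_distrib_left[symmetric] sum_quad_around_mean[OF pos_def_matrix_inv[OF \<Sigma>] n] ..
  finally show ?thesis .
qed

text \<open>The parameter \<open>d = n + k\<close> collects the powers of the determinant: \<open>-n/2\<close> from the likelihood and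
\<open>-(k + 1)/2\<close> from the prior make \<open>-(d + 1)/2\<close>, of which \<open>-1/2\<close> goes to the normal density of the mean
vector.\<close>

lemma diffuse_posterior_kernel:
  fixes \<Sigma> :: "real^'k^'k"
  assumes \<Sigma>: "pos_def \<Sigma>" and n: "1 < n"
  shows "likelihood t n x \<mu> \<Sigma> * diffuse_prior \<mu> \<Sigma>
    = ((2 * pi) powr (- real CARD('k) / 2)) ^ n * niw_kernel (real n) (mean_d t n x) (real n
        + real CARD('k)) (S_d t n x) \<mu> \<Sigma>"
proof -
  have p: "det \<Sigma> powr (- real n / 2) * det \<Sigma> powr (- (real CARD('k) + 1) / 2)
    = det \<Sigma> powr (- 1 / 2) * det \<Sigma> powr (- (real n + real CARD('k)) / 2)"
  proof -
    have "- real n / 2 + - (real CARD('k) + 1) / 2 = - 1 / 2 + - (real n + real CARD('k)) / 2"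
        by (simp add: field_simps)
    then show ?thesis unfolding powr_add[symmetric] by (simp only:)
  qed
  have e: "exp (- (1/2) * (A + B)) = exp (- (1/2) * B) * exp (- (1/2) * A)" for A B :: real
    by (simp add: exp_add[symmetric] algebra_simps)
  have "likelihood t n x \<mu> \<Sigma> * diffuse_prior \<mu> \<Sigma>
    = ((2 * pi) powr (- real CARD('k) / 2)) ^ n * (det \<Sigma> powr (- real n / 2)
        * det \<Sigma> powr (- (real CARD('k) + 1) / 2))
      * (exp (- (1/2) * trace (S_d t n x ** matrix_inv \<Sigma>)) * exp (- (1/2) * (real n * ((\<mu>
          - sample_mean t n x) \<bullet> (matrix_inv \<Sigma> *v (\<mu> - sample_mean t n x))))))"
    unfolding likelihood_eq[OF \<Sigma> n] diffuse_prior_def e by (simp only: mult_ac)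
  then show ?thesis
    unfolding p niw_kernel_def inv_wishart_kernel_def mean_d_def by (simp only: mult_ac)
qed

lemma det_scaleR: "det (c *\<^sub>R A) = c ^ CARD('k) * det A" for A :: "real^'k^'k"
proof -
  have "det (c *\<^sub>R A) = (\<Sum>p\<in>{p. p permutes (UNIV :: 'k set)}. of_int (sign p) * (\<Prod>i\<in>UNIV. c * A $ i $ p i))"
    by (simp add: det_def)
  also have "\<dots> = c ^ CARD('k) * det A"
    by (simp add: prod.distrib det_def sum_distrib_left mult_ac)
  finally show ?thesis .
qed

lemma pos_def_scaleR: "0 < c \<Longrightarrow> pos_def A \<Longrightarrow> pos_def (c *\<^sub>R A)" for A :: "real^'k^'k"
  by (auto simp: pos_def_def scaleR_matrix_vector_assoc[symmetric] transpose_def vec_eq_iff)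

text \<open>The prior contributes a quadratic form in \<open>\<mu> - m0\<close>; merging it with the one around the sample mean
moves the centre to the weighted mean and leaves the rank-one term of \<open>S_c\<close>. The powers of the
determinant are \<open>-n/2\<close>, \<open>-1/2\<close> and \<open>-d0/2\<close>, hence \<open>d = n + d0\<close>.\<close>

lemma conjugate_posterior_kernel:
  fixes \<Sigma> S0 :: "real^'k^'k" and r0 d0 :: real
  assumes \<Sigma>: "pos_def \<Sigma>" and n: "1 < n" and r0: "0 < r0"
  shows "likelihood t n x \<mu> \<Sigma> * conjugate_prior m0 r0 d0 S0 \<mu> \<Sigma>
    = ((2 * pi) powr (- real CARD('k) / 2)) ^ n * ((2 * pi) powr (- real CARD('k) / 2)
        * ((1 / r0) ^ CARD('k)) powr (- 1 / 2)
        / (\<integral>\<Sigma>'. inv_wishart_kernel d0 S0 \<Sigma>' \<partial>lborel_pd))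
      * niw_kernel (real n + r0) (mean_c m0 r0 t n x) (real n + d0) (S_c m0 r0 S0 t n x) \<mu> \<Sigma>"
proof -
  let ?M = "matrix_inv \<Sigma>" and ?m = "sample_mean t n x"
  let ?Z = "\<integral>\<Sigma>'. inv_wishart_kernel d0 S0 \<Sigma>' \<partial>lborel_pd" and ?p = "(2 * pi) powr (- real CARD('k) / 2)"
  let ?mc = "mean_c m0 r0 t n x"
  have det: "0 < det \<Sigma>" by (rule pos_def_det[OF \<Sigma>])
  have M: "pos_def ?M" by (rule pos_def_matrix_inv[OF \<Sigma>])
  have n0: "0 < real n" using n by simp
  have prior: "mvnormal_density m0 ((1 / r0) *\<^sub>R \<Sigma>) \<mu>
    = ?p * (((1 / r0) ^ CARD('k)) powr (- 1 / 2) * det \<Sigma> powr (- 1 / 2)) * exp (- (1/2) * (r0 * ((\<mu>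
        - m0) \<bullet> (?M *v (\<mu> - m0)))))"
  proof -
    have "matrix_inv ((1 / r0) *\<^sub>R \<Sigma>) = r0 *\<^sub>R ?M" using matrix_inv_scaleR[of \<Sigma> "1 / r0"] det r0 by simp
    then show ?thesis
      using mvnormal_density_powr[OF pos_def_scaleR[OF _ \<Sigma>], of "1 / r0" m0 \<mu>] r0 det
      by (simp add: det_scaleR powr_mult scaleR_matrix_vector_assoc[symmetric] del: power_one_over)
  qed
  have Sc: "trace (S_c m0 r0 S0 t n x ** ?M) = trace (S_d t n x ** ?M) + trace (S0 ** ?M)
     + real n * r0 / (real n + r0) * ((m0 - ?m) \<bullet> (?M *v (m0 - ?m)))"
    unfolding S_c_def linear_add[OF linear_trace_mult] linear_cmul[OF linear_trace_mult]
        trace_outer_mult by simp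
  have E: "(real n * ((\<mu> - ?m) \<bullet> (?M *v (\<mu> - ?m))) + trace (S_d t n x ** ?M))
      + r0 * ((\<mu> - m0) \<bullet> (?M *v (\<mu> - m0))) + trace (S0 ** ?M)
    = trace (S_c m0 r0 S0 t n x ** ?M) + (real n + r0) * ((\<mu> - ?mc) \<bullet> (?M *v (\<mu> - ?mc)))"
    using complete_square[OF M n0 r0, of \<mu> ?m m0] unfolding Sc mean_c_def by simp
  have e: "exp (- (1/2) * A) * exp (- (1/2) * B) * exp (- (1/2) * C) = exp (- (1/2) * (A + B + C))"
      for A B C :: real
    by (simp add: exp_add[symmetric] algebra_simps)
  have e2: "exp (- (1/2) * (A + B)) = exp (- (1/2) * A) * exp (- (1/2) * B)" for A B :: real
    by (simp add: exp_add[symmetric] algebra_simps)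
  have p: "det \<Sigma> powr (- real n / 2) * det \<Sigma> powr (- 1 / 2) * det \<Sigma> powr (- d0 / 2)
    = det \<Sigma> powr (- 1 / 2) * det \<Sigma> powr (- (real n + d0) / 2)"
  proof -
    have "- real n / 2 + - 1 / 2 + - d0 / 2 = - 1 / 2 + - (real n + d0) / 2" by (simp add: field_simps)
    then show ?thesis unfolding powr_add[symmetric] by (simp only:)
  qed
  have "likelihood t n x \<mu> \<Sigma> * conjugate_prior m0 r0 d0 S0 \<mu> \<Sigma>
    = ?p ^ n * (?p * ((1 / r0) ^ CARD('k)) powr (- 1 / 2) / ?Z)
      * (det \<Sigma> powr (- real n / 2) * det \<Sigma> powr (- 1 / 2) * det \<Sigma> powr (- d0 / 2))
      * (exp (- (1/2) * (real n * ((\<mu> - ?m) \<bullet> (?M *v (\<mu> - ?m))) + trace (S_d t n x ** ?M)))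
         * exp (- (1/2) * (r0 * ((\<mu> - m0) \<bullet> (?M *v (\<mu> - m0))))) * exp (- (1/2) * trace (S0 ** ?M)))"
    unfolding likelihood_eq[OF \<Sigma> n] conjugate_prior_def prior inv_wishart_density_def
        inv_wishart_kernel_def[of d0 S0 \<Sigma>]
    by (simp only: times_divide_eq_right times_divide_eq_left mult_ac)
  also have "\<dots> = ?p ^ n * (?p * ((1 / r0) ^ CARD('k)) powr (- 1 / 2) / ?Z)
      * (det \<Sigma> powr (- 1 / 2) * det \<Sigma> powr (- (real n + d0) / 2))
      * (exp (- (1/2) * trace (S_c m0 r0 S0 t n x ** ?M)) * exp (- (1/2) * ((real n + r0) * ((\<mu>
          - ?mc) \<bullet> (?M *v (\<mu> - ?mc))))))"
    unfolding p e E by (simp only: e2)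
  also have "\<dots> = ?p ^ n * (?p * ((1 / r0) ^ CARD('k)) powr (- 1 / 2) / ?Z)
      * niw_kernel (real n + r0) ?mc (real n + d0) (S_c m0 r0 S0 t n x) \<mu> \<Sigma>"
    unfolding niw_kernel_def inv_wishart_kernel_def by (simp only: mult.assoc)
  finally show ?thesis .
qed

lemma S_d_quad:
  assumes n: "1 < n"
  shows "v \<bullet> (S_d t n x *v v) = (\<Sum>i\<in>obs_times t n. ((x i - sample_mean t n x) \<bullet> v)\<^sup>2)"
proof -
  have o: "v \<bullet> (outer u u *v v) = (u \<bullet> v)\<^sup>2" for u v :: "real^'k"
  proof -
    have "outer u u *v v = (u \<bullet> v) *\<^sub>R u"
      by (simp add: vec_eq_iff outer_def matrix_vector_mult_def inner_vec_def sum_distrib_left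
          sum_distrib_right mult_ac)
    then show ?thesis by (simp add: power2_eq_square inner_commute)
  qed
  have lin: "linear (\<lambda>A :: real^'k^'k. v \<bullet> (A *v v))" for v
    by (rule linearI) (simp_all add: matrix_vector_mult_add_rdistrib
        scaleR_matrix_vector_assoc[symmetric] inner_add_right)
  show ?thesis unfolding S_d_eq_sum[OF n] linear_sum[OF lin] o ..
qed

lemma transpose_S_d: "transpose (S_d t n x) = S_d t n x"
  by (simp add: S_d_def sample_cov_def outer_def transpose_def vec_eq_iff mult.commute)

lemma pos_def_S_c:
  assumes n: "1 < n" and r0: "0 < r0" and S0: "pos_def S0"
  shows "pos_def (S_c m0 r0 S0 t n x)"
  unfolding pos_def_def
proof (intro conjI allI impI)
  let ?w = "m0 - sample_mean t n x"
  have S0t: "transpose S0 = S0" using S0 by (simp add: pos_def_def)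
  have t: "transpose (A + B) = transpose A + transpose B" "transpose (c *\<^sub>R A) = c *\<^sub>R transpose A"
      for A B :: "real^'a^'a" and c
    by (simp_all add: transpose_def vec_eq_iff)
  have o: "transpose (outer u u) = outer u u" for u :: "real^'a"
    by (simp add: outer_def transpose_def vec_eq_iff mult.commute)
  show "transpose (S_c m0 r0 S0 t n x) = S_c m0 r0 S0 t n x"
    by (simp add: S_c_def t o S0t transpose_S_d)
  fix v :: "real^'a" assume v: "v \<noteq> 0"
  have o: "v \<bullet> (outer ?w ?w *v v) = (?w \<bullet> v)\<^sup>2"
  proof -
    have "outer ?w ?w *v v = (?w \<bullet> v) *\<^sub>R ?w"
      by (simp add: vec_eq_iff outer_def matrix_vector_mult_def inner_vec_def sum_distrib_left
          sum_distrib_right mult_ac)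
    then show ?thesis by (simp add: power2_eq_square inner_commute)
  qed
  have 1: "0 \<le> v \<bullet> (S_d t n x *v v)" unfolding S_d_quad[OF n] by (intro sum_nonneg) simp
  have 2: "0 < v \<bullet> (S0 *v v)" using S0 v by (simp add: pos_def_def)
  have 3: "0 \<le> real n * r0 / (real n + r0) * (v \<bullet> (outer ?w ?w *v v))"
    unfolding o using r0 by (intro mult_nonneg_nonneg) auto
  show "0 < v \<bullet> (S_c m0 r0 S0 t n x *v v)"
    unfolding S_c_def matrix_vector_mult_add_rdistrib scaleR_matrix_vector_assoc[symmetric]
        inner_add_right inner_scaleR_right
    by (intro add_pos_nonneg[OF add_nonneg_pos[OF 1 2] 3])
qed

section \<open>Nondegeneracy of a normal sample\<close>

text \<open>Starting from the identity matrix, the rows in \<open>I\<close> are replaced by differences between distinct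
observations and a common reference observation.\<close>

definition diff_det :: "('k::finite \<Rightarrow> int) \<Rightarrow> int \<Rightarrow> 'k set \<Rightarrow> (int \<Rightarrow> real^'k) \<Rightarrow> real" where
  "diff_det idx i0 I x = det (\<chi> j. if j \<in> I then x (idx j) - x i0 else axis j 1)"

lemma det_row_inner:
  fixes v :: "real^'k" and w :: "'k \<Rightarrow> real^'k"
  shows "det (\<chi> a. if a = j then v else w a) = v \<bullet> (\<chi> l. det (\<chi> a. if a = j then axis l 1 else w a))"
proof -
  have "v = (\<Sum>l\<in>UNIV. v $ l *s axis l 1)" by (simp add: basis_expansion)
  then have "det (\<chi> a. if a = j then v else w a)
      = det (\<chi> a. if a = j then (\<Sum>l\<in>UNIV. v $ l *s axis l 1) else w a)"
    by (rule arg_cong[where f="\<lambda>u. det (\<chi> a. if a = j then u else w a)"])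
  also have "\<dots> = (\<Sum>l\<in>UNIV. det (\<chi> a. if a = j then v $ l *s axis l 1 else w a))"
    by (rule det_linear_row_sum) simp
  also have "\<dots> = (\<Sum>l\<in>UNIV. v $ l * det (\<chi> a. if a = j then axis l 1 else w a))"
    by (intro sum.cong refl det_row_mul)
  finally show ?thesis by (simp add: inner_vec_def)
qed

text \<open>One row after the other is replaced by a difference. As a function of the observation that enters,
the determinant is affine, and one coordinate of its gradient is the determinant before the
replacement. Where the latter is nonzero, the new determinant vanishes only on a hyperplane.\<close>

lemma AE_diff_det_nonzero:
  fixes M :: "int \<Rightarrow> (real^'k) measure" and idx :: "'k \<Rightarrow> int"
  assumes T: "finite T" "i0 \<in> T" "\<And>j. idx j \<in> T - {i0}" "inj idx"
    and pM: "\<And>i. prob_space (M i)" and setsM [measurable_cong]: "\<And>i. sets (M i) = sets borel"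
    and hyp: "\<And>i c \<beta>. c \<noteq> 0 \<Longrightarrow> emeasure (M i) {y. c \<bullet> y = \<beta>} = 0"
  shows "AE x in (\<Pi>\<^sub>M i\<in>T. M i). diff_det idx i0 I x \<noteq> 0"
proof -
  interpret product_sigma_finite M
    by (simp add: product_sigma_finite_def prob_space_imp_sigma_finite pM)
  have comp: "(\<lambda>x. x i) \<in> borel_measurable (\<Pi>\<^sub>M i\<in>T. M i)" if "i \<in> T" for i
  proof -
    have "(\<lambda>x. x i) \<in> measurable (\<Pi>\<^sub>M i\<in>T. M i) (M i)" by (rule measurable_component_singleton[OF that])
    then show ?thesis by (subst (asm) measurable_cong_sets[OF refl setsM])
  qed
  have meas [measurable]: "diff_det idx i0 I \<in> borel_measurable (\<Pi>\<^sub>M i\<in>T. M i)" for I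
  proof -
    have "(\<lambda>x. (\<chi> j. if j \<in> I then x (idx j) - x i0 else axis j 1) :: real^'k^'k) \<in> borel_measurable
        (\<Pi>\<^sub>M i\<in>T. M i)"
    proof (rule measurable_matrix_componentI)
      fix a b
      have "(\<lambda>x. (x (idx a) - x i0) $ b) \<in> borel_measurable (\<Pi>\<^sub>M i\<in>T. M i)"
        using comp[of "idx a"] comp[of i0] T(2) T(3)[of a]
        by (intro measurable_compose[OF _ measurable_vec_nth] borel_measurable_diff) auto
      then show "(\<lambda>x. (\<chi> j. if j \<in> I then x (idx j)
          - x i0 else axis j 1) $ a $ b) \<in> borel_measurable (\<Pi>\<^sub>M i\<in>T. M i)"
        by (cases "a \<in> I") simp_all
    qed
    then show ?thesis unfolding diff_det_def[abs_def] by (rule measurable_det)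
  qed
  have "finite I" by simp
  then show ?thesis
  proof (induction I rule: finite_induct)
    case empty
    have "(\<chi> j. axis j 1) = (mat 1 :: real^'k^'k)" by (auto simp: vec_eq_iff mat_def axis_def)
    then show ?case by (simp add: diff_det_def)
  next
    case (insert j I)
    define i where "i = idx j"
    define T' where "T' = T - {i}"
    have T': "finite T'" "i \<notin> T'" "insert i T' = T" "i \<noteq> i0" using T(1) T(3)[of j]
        by (auto simp: T'_def i_def)
    have other: "idx a \<noteq> i" if "a \<noteq> j" for a using T(4) that by (auto simp: i_def inj_def)
    let ?N = "\<lambda>I x. indicator {x. diff_det idx i0 I x = 0} x :: ennreal"
    have Nm [measurable]: "?N I \<in> borel_measurable (\<Pi>\<^sub>M i\<in>T. M i)" for I
      by (rule borel_measurable_indicator') measurable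
    have Nm' : "?N I \<in> borel_measurable (\<Pi>\<^sub>M i\<in>insert i T'. M i)" for I
      unfolding T'(3) by (rule Nm)
    have ins: "diff_det idx i0 (insert j I) (x(i := y)) = 0 \<longleftrightarrow> c \<bullet> y = c \<bullet> x i0"
      if c: "c = (\<chi> l. det (\<chi> a. if a = j then axis l 1 else
          if a \<in> I then x (idx a) - x i0 else axis a 1))" for x y c
    proof -
      have "diff_det idx i0 (insert j I) (x(i := y))
          = det (\<chi> a. if a = j then y - x i0 else if a \<in> I then x (idx a) - x i0 else axis a 1)"
        unfolding diff_det_def using T'(4) other
            by (intro arg_cong[where f=det]) (auto simp: vec_eq_iff i_def)
      also have "\<dots> = (y - x i0) \<bullet> c" unfolding c by (rule det_row_inner)
      also have "\<dots> = c \<bullet> (y - x i0)" by (rule inner_commute)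
      finally show ?thesis by (simp add: inner_diff_right)
    qed
    have old: "diff_det idx i0 I (x(i := y)) = diff_det idx i0 I x" for x y
    proof -
      have "idx a \<noteq> i" if "a \<in> I" for a using that insert.hyps by (intro other) auto
      then show ?thesis
        unfolding diff_det_def using T'(4) by (intro arg_cong[where f=det]) (simp add: vec_eq_iff)
    qed
    have "(\<integral>\<^sup>+x. ?N (insert j I) x \<partial>(\<Pi>\<^sub>M i\<in>T. M i))
        = (\<integral>\<^sup>+x. \<integral>\<^sup>+y. ?N (insert j I) (x(i := y)) \<partial>M i \<partial>(\<Pi>\<^sub>M i\<in>T'. M i))"
      using product_nn_integral_insert[OF T'(1,2) Nm'] unfolding T'(3) .
    also have "\<dots> \<le> (\<integral>\<^sup>+x. \<integral>\<^sup>+y. ?N I (x(i := y)) \<partial>M i \<partial>(\<Pi>\<^sub>M i\<in>T'. M i))"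
    proof (rule nn_integral_mono)
      fix x :: "int \<Rightarrow> real^'k"
      define c where "c = (\<chi> l. det (\<chi> a. if a = j then axis l 1 else
          if a \<in> I then x (idx a) - x i0 else axis a 1))"
      show "(\<integral>\<^sup>+y. ?N (insert j I) (x(i := y)) \<partial>M i) \<le> (\<integral>\<^sup>+y. ?N I (x(i := y)) \<partial>M i)"
      proof (cases "diff_det idx i0 I x = 0")
        case True
        then show ?thesis by (intro nn_integral_mono) (simp add: old indicator_def)
      next
        case False
        have "c $ j = diff_det idx i0 I x"
          unfolding c_def diff_det_def using insert.hyps
          by simp (intro arg_cong[where f=det], auto simp: vec_eq_iff)
        then have "c \<noteq> 0" using False by auto
        have "(\<integral>\<^sup>+y. ?N (insert j I) (x(i := y)) \<partial>M i) = (\<integral>\<^sup>+y. indicator {y. c \<bullet> y = c \<bullet> x i0} y \<partial>M i)"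
          by (intro nn_integral_cong) (simp add: indicator_def ins[OF c_def])
        also have "\<dots> = emeasure (M i) {y. c \<bullet> y = c \<bullet> x i0}"
          by (intro nn_integral_indicator) (simp add: setsM closed_hyperplane)
        also have "\<dots> = 0" by (rule hyp[OF \<open>c \<noteq> 0\<close>])
        finally show ?thesis by simp
      qed
    qed
    also have "\<dots> = (\<integral>\<^sup>+x. ?N I x \<partial>(\<Pi>\<^sub>M i\<in>T. M i))"
      using product_nn_integral_insert[OF T'(1,2) Nm'] unfolding T'(3) by (rule sym)
    also have "\<dots> = 0"
      using insert.IH by (subst nn_integral_0_iff_AE) (auto elim!: eventually_mono)
    finally have "(\<integral>\<^sup>+x. ?N (insert j I) x \<partial>(\<Pi>\<^sub>M i\<in>T. M i)) = 0" by simp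
    then have "AE x in (\<Pi>\<^sub>M i\<in>T. M i). ?N (insert j I) x = 0"
      by (subst (asm) nn_integral_0_iff_AE) auto
    then show ?case by eventually_elim (auto simp: indicator_def split: if_splits)
  qed
qed

text \<open>If the quadratic form vanishes at \<open>v\<close>, then \<open>v\<close> is orthogonal to all deviations from the sample mean
and thus to all differences of observations.\<close>

lemma pos_def_S_d_if_diff_det:
  fixes x :: "int \<Rightarrow> real^'k"
  assumes n: "1 < n" and idx: "\<And>j. idx j \<in> obs_times t n" "i0 \<in> obs_times t n"
    and det: "diff_det idx i0 UNIV x \<noteq> 0"
  shows "pos_def (S_d t n x)"
  unfolding pos_def_def
proof (intro conjI allI impI)
  show "transpose (S_d t n x) = S_d t n x" by (rule transpose_S_d)
  fix v :: "real^'k" assume v: "v \<noteq> 0"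
  let ?s = "\<lambda>i. (x i - sample_mean t n x) \<bullet> v"
  let ?G = "(\<chi> j. x (idx j) - x i0) :: real^'k^'k"
  have "det ?G \<noteq> 0" using det by (simp add: diff_det_def)
  have "v \<bullet> (S_d t n x *v v) \<noteq> 0"
  proof
    assume "v \<bullet> (S_d t n x *v v) = 0"
    then have "(\<Sum>i\<in>obs_times t n. (?s i)\<^sup>2) = 0" by (simp add: S_d_quad[OF n])
    then have z: "?s i = 0" if "i \<in> obs_times t n" for i
      using that by (subst (asm) sum_nonneg_eq_0_iff) auto
    have "(?G *v v) $ j = 0" for j
    proof -
      have "(?G *v v) $ j = ?s (idx j) - ?s i0"
        by (simp add: matrix_vector_mul_component inner_diff_left)
      then show ?thesis using z idx by simp
    qed
    then have "?G *v v = 0" by (simp add: vec_eq_iff)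
    then have "matrix_inv ?G *v (?G *v v) = 0" by simp
    then show False using v matrix_inv_mult_vec(2)[OF \<open>det ?G \<noteq> 0\<close>] by simp
  qed
  moreover have "0 \<le> v \<bullet> (S_d t n x *v v)" unfolding S_d_quad[OF n] by (intro sum_nonneg) simp
  ultimately show "0 < v \<bullet> (S_d t n x *v v)" by simp
qed

lemma emeasure_density_hyperplane:
  fixes c :: "real^'k"
  assumes "f \<in> borel_measurable lborel" "c \<noteq> 0"
  shows "emeasure (density lborel f) {y. c \<bullet> y = \<beta>} = 0"
proof -
  have H: "{y. c \<bullet> y = \<beta>} \<in> sets (borel :: (real^'k) measure)" by (simp add: closed_hyperplane)
  have "negligible {y. c \<bullet> y = \<beta>}" using assms(2) by (intro negligible_hyperplane) simp
  then have "{y. c \<bullet> y = \<beta>} \<in> null_sets lborel"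
    using H by (simp add: negligible_iff_null_sets null_sets_completion_iff)
  then show ?thesis using assms(1) H by (simp add: emeasure_density nn_integral_null_set)
qed

lemma AE_pos_def_S_d:
  fixes X :: "int \<Rightarrow> 'a \<Rightarrow> real^'k" and f :: "int \<Rightarrow> real^'k \<Rightarrow> ennreal"
  assumes P: "prob_space P" and n: "CARD('k) < n"
    and indep: "prob_space.indep_vars P (\<lambda>_. borel) X (obs_times t n)"
    and dist: "\<And>i. i \<in> obs_times t n \<Longrightarrow> distributed P lborel (X i) (f i)"
  shows "AE \<omega> in P. pos_def (S_d t n (\<lambda>i. X i \<omega>))"
proof -
  interpret P: prob_space P by fact
  let ?T = "obs_times t n"
  have n1: "1 < n" using n zero_less_card_finite[where 'a='k] by linarith
  have "?T \<noteq> {}" using n1 card_obs_times[of t n] by (metis card.empty not_one_less_zero)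
  then obtain i0 where i0: "i0 \<in> ?T" by blast
  have "card (UNIV :: 'k set) \<le> card (?T - {i0})" using i0 n by simp
  then obtain idx :: "'k \<Rightarrow> int" where idx: "idx ` UNIV \<subseteq> ?T - {i0}" "inj idx"
    using card_le_inj[of "UNIV :: 'k set" "?T - {i0}"] by auto
  have rv: "X i \<in> borel_measurable P" if "i \<in> ?T" for i
    using distributed_measurable[OF dist[OF that]] by simp
  \<comment> \<open>A product measure takes a measure at every index; outside the window, that of \<open>X i0\<close> is repeated.\<close>
  define \<sigma> where "\<sigma> i = (if i \<in> ?T then i else i0)" for i
  have \<sigma>: "\<sigma> i \<in> ?T" for i using i0 by (simp add: \<sigma>_def)
  define M where "M i = distr P borel (X (\<sigma> i))" for i
  have M: "M i = density lborel (f (\<sigma> i))" for i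
    using distributed_distr_eq_density[OF dist[OF \<sigma>[of i]]] by (simp add: M_def cong: distr_cong)
  have ae: "AE x in (\<Pi>\<^sub>M i\<in>?T. M i). diff_det idx i0 UNIV x \<noteq> 0"
  proof (rule AE_diff_det_nonzero)
    show "prob_space (M i)" for i unfolding M_def by (rule P.prob_space_distr[OF rv[OF \<sigma>]])
    show "emeasure (M i) {y. c \<bullet> y = \<beta>} = 0" if "c \<noteq> 0" for i c \<beta>
      unfolding M using distributed_borel_measurable[OF dist[OF \<sigma>]] that
          by (intro emeasure_density_hyperplane) auto
  qed (use i0 idx in \<open>auto simp: M_def\<close>)
  have eq: "(\<Pi>\<^sub>M i\<in>?T. M i) = distr P (\<Pi>\<^sub>M i\<in>?T. borel) (\<lambda>\<omega>. \<lambda>i\<in>?T. X i \<omega>)"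
  proof -
    have "distr P (\<Pi>\<^sub>M i\<in>?T. borel) (\<lambda>\<omega>. \<lambda>i\<in>?T. X i \<omega>) = (\<Pi>\<^sub>M i\<in>?T. distr P borel (X i))"
      using P.indep_vars_iff_distr_eq_PiM'[OF \<open>?T \<noteq> {}\<close>, of X "\<lambda>_. borel"] rv indep by simp
    also have "\<dots> = (\<Pi>\<^sub>M i\<in>?T. M i)" by (rule PiM_cong) (auto simp: M_def \<sigma>_def)
    finally show ?thesis ..
  qed
  from ae have "AE \<omega> in P. diff_det idx i0 UNIV (\<lambda>i\<in>?T. X i \<omega>) \<noteq> 0"
    unfolding eq by (rule AE_distrD[rotated]) (intro measurable_restrict rv)
  then show ?thesis
  proof eventually_elim
    fix \<omega> assume "diff_det idx i0 UNIV (\<lambda>i\<in>?T. X i \<omega>) \<noteq> 0"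
    moreover have "diff_det idx i0 UNIV (\<lambda>i\<in>?T. X i \<omega>) = diff_det idx i0 UNIV (\<lambda>i. X i \<omega>)"
      using idx(1) i0 unfolding diff_det_def by (intro arg_cong[where f=det]) (auto simp: vec_eq_iff)
    ultimately show "pos_def (S_d t n (\<lambda>i. X i \<omega>))"
      using idx(1) i0 by (intro pos_def_S_d_if_diff_det[OF n1, of idx t i0]) auto
  qed
qed

section \<open>The Bayes estimates of the optimal weights\<close>

theorem theorem3:
  fixes P :: "real^'k \<Rightarrow> real^'k^'k \<Rightarrow> 'a measure"
    and X :: "int \<Rightarrow> 'a \<Rightarrow> real^'k"
    and t T :: int and n :: nat
    and \<gamma> W :: real and rf :: "int \<Rightarrow> real"
    and m0 :: "real^'k" and r0 d0 :: real and S0 :: "real^'k^'k"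
  assumes "0 \<le> t" "t < T" "CARD('k) < n" "0 < \<gamma>"
    and model_prob: "\<And>\<mu> \<Sigma>. pos_def \<Sigma> \<Longrightarrow> prob_space (P \<mu> \<Sigma>)"
    and model_indep: "\<And>\<mu> \<Sigma>. pos_def \<Sigma> \<Longrightarrow>
          prob_space.indep_vars (P \<mu> \<Sigma>) (\<lambda>_. borel) X (obs_times t n)"
    and model_normal: "\<And>\<mu> \<Sigma> i. pos_def \<Sigma> \<Longrightarrow> i \<in> obs_times t n \<Longrightarrow>
          distributed (P \<mu> \<Sigma>) lborel (X i) (\<lambda>x. ennreal (mvnormal_density \<mu> \<Sigma> x))"
    and "0 < r0" "2 * real CARD('k) < d0" "pos_def S0"
  shows
    "(\<forall>\<mu> \<Sigma>. pos_def \<Sigma> \<longrightarrow> (AE \<omega> in P \<mu> \<Sigma>. pos_def (S_d t n (\<lambda>i. X i \<omega>))))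
     \<and> (\<forall>\<omega>. let x = (\<lambda>i. X i \<omega>); w = opt_weights \<gamma> W rf T t in
          pos_def (S_d t n x) \<longrightarrow>
            posterior_mean_exists diffuse_prior t n x w
            \<and> posterior_mean diffuse_prior t n x w
              = (C_coef \<gamma> W rf T t * (real n - 1)) *\<^sub>R
                  (matrix_inv (S_d t n x) *v (mean_d t n x - rf (t + 1) *\<^sub>R ones)))
     \<and> (\<forall>\<omega>. let x = (\<lambda>i. X i \<omega>); w = opt_weights \<gamma> W rf T t in
          posterior_mean_exists (conjugate_prior m0 r0 d0 S0) t n x w
          \<and> posterior_mean (conjugate_prior m0 r0 d0 S0) t n x w
            = (C_coef \<gamma> W rf T t * (real n + d0 - real CARD('k) - 1)) *\<^sub>R
                (matrix_inv (S_c m0 r0 S0 t n x) *v (mean_c m0 r0 t n x - rf (t + 1) *\<^sub>R ones)))"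
proof (intro conjI allI impI)
  have n: "1 < n" using \<open>CARD('k) < n\<close> zero_less_card_finite[where 'a='k] by linarith
  show "AE \<omega> in P \<mu> \<Sigma>. pos_def (S_d t n (\<lambda>i. X i \<omega>))" if "pos_def \<Sigma>" for \<mu> \<Sigma>
    by (rule AE_pos_def_S_d[OF model_prob[OF that] \<open>CARD('k)
        < n\<close> model_indep[OF that] model_normal[OF that]])
  let ?p = "(2 * pi) powr (- real CARD('k) / 2)"
  show "let x = (\<lambda>i. X i \<omega>); w = opt_weights \<gamma> W rf T t in
          pos_def (S_d t n x) \<longrightarrow>
            posterior_mean_exists diffuse_prior t n x w
            \<and> posterior_mean diffuse_prior t n x w
              = (C_coef \<gamma> W rf T t * (real n - 1)) *\<^sub>R
                  (matrix_inv (S_d t n x) *v (mean_d t n x - rf (t + 1) *\<^sub>R ones))" for \<omega>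
  proof -
    define x where "x = (\<lambda>i. X i \<omega>)"
    have d: "2 * real CARD('k) < real n + real CARD('k)" using \<open>CARD('k) < n\<close> by simp
    have "posterior_mean_exists diffuse_prior t n x (opt_weights \<gamma> W rf T t)
        \<and> posterior_mean diffuse_prior t n x (opt_weights \<gamma> W rf T t)
          = (C_coef \<gamma> W rf T t * (real n - 1)) *\<^sub>R (matrix_inv (S_d t n x) *v (mean_d t n x - rf (t + 1)
              *\<^sub>R ones))"
      if S: "pos_def (S_d t n x)"
      using niw_posterior[OF _ d S _ diffuse_posterior_kernel[OF _ n], of \<gamma> W rf T] n by simp
    then show ?thesis by (simp add: x_def Let_def)
  qed
  show "let x = (\<lambda>i. X i \<omega>); w = opt_weights \<gamma> W rf T t in
          posterior_mean_exists (conjugate_prior m0 r0 d0 S0) t n x w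
          \<and> posterior_mean (conjugate_prior m0 r0 d0 S0) t n x w
            = (C_coef \<gamma> W rf T t * (real n + d0 - real CARD('k) - 1)) *\<^sub>R
                (matrix_inv (S_c m0 r0 S0 t n x) *v (mean_c m0 r0 t n x - rf (t + 1) *\<^sub>R ones))" for \<omega>
  proof -
    define x where "x = (\<lambda>i. X i \<omega>)"
    have d: "2 * real CARD('k) < real n + d0" using \<open>2 * real CARD('k) < d0\<close> by simp
    have S: "pos_def (S_c m0 r0 S0 t n x)" by (rule pos_def_S_c[OF n \<open>0 < r0\<close> \<open>pos_def S0\<close>])
    have r: "0 < real n + r0" using \<open>0 < r0\<close> by simp
    have \<kappa>: "0 < ?p ^ n * (?p * ((1 / r0) ^ CARD('k)) powr (- 1 / 2) /
        (\<integral>\<Sigma>'. inv_wishart_kernel d0 S0 \<Sigma>' \<partial>lborel_pd))"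
      using integral_inv_wishart_kernel_pos[OF \<open>2 * real CARD('k) < d0\<close> \<open>pos_def S0\<close>] \<open>0 < r0\<close>
      by (intro mult_pos_pos divide_pos_pos zero_less_power) auto
    show ?thesis
      using niw_posterior[OF r d S \<kappa> conjugate_posterior_kernel[OF _ n \<open>0 < r0\<close>], of \<gamma> W rf T]
      by (simp add: x_def Let_def)
  qed
qed

end
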